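(* For every $d\ge1$, the measures $\mu_n$ (laws of the rescaled empirical measures of mean-field lattice trees with $n$ vertices) converge weakly to $\mu_{\mathrm{ISE}}$ as $n\to\infty$, as probability measures on the compact space $M_1(\dot{\mathbb R}^d)$; i.e. for every continuous $F:M_1(\dot{\mathbb R}^d)\to\mathbb R$, $\lim_{n\to\infty}\int F\,d\mu_n=\int F\,d\mu_{\mathrm{ISE}}$.
   Context: Plane trees $T$ (finite sets of words: root $0$, children of $w$ are $w1,\dots,w\xi_w$), $|T|$ = number of vertices, $\mathbb P(T)=e^{-|T|}\prod_{i\in T}1/\xi_i!$ (critical Poisson Galton–Watson law). Embedding $\varphi$: map from vertices of $T$ to $\mathbb Z^d$, root to $0$, adjacent vertices to nearest neighbours; $\mathbb P(T,\varphi)=(2d)^{-(|T|-1)}\mathbb P(T)$. $\dot{\mathbb R}^d$ is the one-point compactification of $\mathbb R^d$, $M_1(\dot{\mathbb R}^d)$ the space of probability measures on it with the weak topology, with $M_1(\mathbb R^d)$ regarded as a subset. For a tree $T$ with $|T|=n$ and an embedding $\varphi$, $\mu(T,\varphi)$ is the probability measure on $\mathbb R^d$ giving mass $n^{-1}\#\{i\in T:\varphi(i)=x\}$ to the point $x\,d^{1/2}n^{-1/4}$ for each $x\in\mathbb Z^d$. $\mu_n$ is the law of $\mu(T,\varphi)$ when $(T,\varphi)$ has law $\mathbb P(\cdot\mid |T|=n)$. ISE: $\mu_{\mathrm{ISE}}$ (integrated super-Brownian excursion) is the probability measure on $M_1(\mathbb R^d)$ which is the law of the random probability measure on $\mathbb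 R^d$ obtained from super-Brownian motion by conditioning its total integrated mass to be $1$; it is uniquely characterised by its moment measures $M^{(l)}(dx_1\cdots dx_l)=\int\nu(dx_1)\cdots\nu(dx_l)\,\mu_{\mathrm{ISE}}(d\nu)$, $l\ge1$, whose characteristic functions are $\hat M^{(l)}(k_1,\dots,k_l)=\sum_{\sigma\in\Sigma_{l+1}}\hat A^{(l+1)}(\sigma;\vec k)$. Here $\Sigma_m$ is the set of $m$-shapes (trees with $m$ external degree-1 vertices labelled $0,\dots,m-1$, $m-2$ unlabelled internal vertices of degree 3, and a fixed labelling of the $2m-3$ edges by $1,\dots,2m-3$, edges oriented away from $0$); $\vec k=(\kappa_1,\dots,\kappa_{2l-1})$ with $\kappa_j=\sum\{k_i: 1\le i\le l,\ \text{edge }j\text{ lies on the path in }\sigma\text{ from }0\text{ to }i\}$; and for $\kappa_j\in\mathbb R^d$, $$\hat A^{(m)}(\sigma;\vec\kappa)=\int_{[0,\infty)^{2m-3}}\Big(\sum_j t_j\Big)e^{-(\sum_j t_j)^2/2}\prod_{j=1}^{2m-3}e^{-\kappa_j^2t_j/2}\,dt_1\cdots dt_{2m-3}.$$ *)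

theory Defs
  imports "HOL-Probability.Probability"
begin

text \<open>Points of the one-point compactification: Some x for x in R^d, None for the point at infinity.\<close>
type_synonym 'd cpt = "(real^'d) option"

definition cpt_open :: "'d::finite cpt set \<Rightarrow> bool" where
  "cpt_open U \<longleftrightarrow> open (Some -` U) \<and> (None \<in> U \<longrightarrow> compact (- (Some -` U)))"

lemma istopology_cpt_open: "istopology cpt_open"
  unfolding istopology_def
proof (intro conjI allI impI ballI)
  fix S T :: "'d::finite cpt set"
  assume S: "cpt_open S" and T: "cpt_open T"
  have e: "- (Some -` (S \<inter> T)) = (- (Some -` S)) \<union> (- (Some -` T))" by auto
  show "cpt_open (S \<inter> T)"
    using S T unfolding cpt_open_def e by (auto intro: compact_Un)
next
  fix K :: "'d::finite cpt set set"
  assume K: "\<forall>k\<in>K. cpt_open k"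
  have op: "open (Some -` \<Union>K)"
    using K unfolding cpt_open_def vimage_Union by auto
  moreover have "compact (- (Some -` \<Union>K))" if N: "None \<in> \<Union>K"
  proof -
    obtain k where k: "k \<in> K" "None \<in> k" using N by auto
    then have c: "compact (- (Some -` k))" using K unfolding cpt_open_def by auto
    have "closed (- (Some -` \<Union>K))" using op by (simp add: closed_def)
    moreover have "- (Some -` \<Union>K) \<subseteq> - (Some -` k)" using k by auto
    ultimately show ?thesis using c compact_Int_closed[of "- (Some -` k)" "- (Some -` \<Union>K)"]
      by (simp add: Int_absorb1)
  qed
  ultimately show "cpt_open (\<Union>K)" unfolding cpt_open_def by auto
qed

definition cpt_top :: "'d::finite cpt topology" where
  "cpt_top = topology cpt_open"

definition borel_of :: "'a topology \<Rightarrow> 'a measure" where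
  "borel_of X = sigma (topspace X) {U. openin X U}"

definition M1 :: "'d::finite cpt measure set" where
  "M1 = {\<nu>. sets \<nu> = sets (borel_of cpt_top) \<and> prob_space \<nu>}"

definition weak_top :: "'d::finite cpt measure topology" where
  "weak_top = topology_generated_by
     {{\<nu> \<in> M1. (\<integral>x. f x \<partial>\<nu>) \<in> U} | f U. continuous_map cpt_top euclideanreal f \<and> open U}"

text \<open>Vertices are words (lists of positive naturals); the root is the empty word.\<close>
definition plane_tree :: "nat list set \<Rightarrow> bool" where
  "plane_tree T \<longleftrightarrow> finite T \<and> [] \<in> T \<and>
     (\<forall>w j. w @ [j] \<in> T \<longrightarrow> w \<in> T \<and> 1 \<le> j \<and> (\<forall>i\<in>{1..j}. w @ [i] \<in> T))"

definition nchildren :: "nat list set \<Rightarrow> nat list \<Rightarrow> nat" where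
  "nchildren T w = card {j. w @ [j] \<in> T}"

definition P_tree :: "nat list set \<Rightarrow> real" where
  "P_tree T = exp (- real (card T)) * (\<Prod>w\<in>T. 1 / fact (nchildren T w))"

definition embedding :: "nat list set \<Rightarrow> (nat list \<Rightarrow> int^'d) \<Rightarrow> bool" where
  "embedding T \<phi> \<longleftrightarrow> \<phi> [] = 0 \<and> (\<forall>w. w \<notin> T \<longrightarrow> \<phi> w = 0) \<and>
     (\<forall>w j. w @ [j] \<in> T \<longrightarrow> (\<exists>i. \<phi> (w @ [j]) - \<phi> w = axis i 1 \<or> \<phi> (w @ [j]) - \<phi> w = axis i (-1)))"

definition P_tree_emb :: "nat list set \<Rightarrow> (nat list \<Rightarrow> int^'d::finite) \<Rightarrow> real" where
  "P_tree_emb T \<phi> = (1 / (2 * real CARD('d))) ^ (card T - 1) * P_tree T"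

definition pairs :: "nat \<Rightarrow> (nat list set \<times> (nat list \<Rightarrow> int^'d)) set" where
  "pairs n = {(T, \<phi>). plane_tree T \<and> card T = n \<and> embedding T \<phi>}"

definition rescale :: "nat \<Rightarrow> int^'d::finite \<Rightarrow> real^'d" where
  "rescale n x = (sqrt (real CARD('d)) * real n powr (-1/4)) *\<^sub>R (\<chi> i. real_of_int (x $ i))"

definition emp_measure :: "nat list set \<Rightarrow> (nat list \<Rightarrow> int^'d::finite) \<Rightarrow> 'd cpt measure" where
  "emp_measure T \<phi> = measure_of UNIV (sets (borel_of cpt_top))
     (\<lambda>A. ennreal (real (card {w\<in>T. Some (rescale (card T) (\<phi> w)) \<in> A}) / real (card T)))"

text \<open>Integral of F against mu_n, the law of mu(T,phi) under P(. | |T| = n).\<close>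
definition int_mu_n :: "nat \<Rightarrow> ('d::finite cpt measure \<Rightarrow> real) \<Rightarrow> real" where
  "int_mu_n n F = (\<Sum>(T,\<phi>)\<in>(pairs n :: (nat list set \<times> (nat list \<Rightarrow> int^'d)) set).
      P_tree_emb T \<phi> / (\<Sum>(T',\<phi>')\<in>(pairs n :: (nat list set \<times> (nat list \<Rightarrow> int^'d)) set). P_tree_emb T' \<phi>')
      * F (emp_measure T \<phi>))"

text \<open>An (l+1)-shape, rooted at leaf 0, is encoded by its set of clades: edge j is identified
  with the set of leaves i in {1..l} such that edge j lies on the path from 0 to i.\<close>
definition shapes :: "nat \<Rightarrow> nat set set set" where
  "shapes l = {H. H \<subseteq> Pow {1..l} - {{}} \<and> {1..l} \<in> H \<and> (\<forall>i\<in>{1..l}. {i} \<in> H) \<and>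
     (\<forall>A\<in>H. \<forall>B\<in>H. A \<subseteq> B \<or> B \<subseteq> A \<or> A \<inter> B = {}) \<and>
     (\<forall>A\<in>H. 2 \<le> card A \<longrightarrow> (\<exists>B\<in>H. \<exists>C\<in>H. B \<inter> C = {} \<and> B \<union> C = A \<and> B \<noteq> A \<and> C \<noteq> A))}"

definition Ahat :: "nat set set \<Rightarrow> (nat \<Rightarrow> real^'d::finite) \<Rightarrow> real" where
  "Ahat H k = (\<integral>t. (\<Sum>A\<in>H. t A) * exp (- ((\<Sum>A\<in>H. t A) ^ 2) / 2) *
       (\<Prod>A\<in>H. exp (- ((norm (\<Sum>i\<in>A. k i)) ^ 2) * t A / 2))
     \<partial>(PiM H (\<lambda>_. restrict_space lborel {0::real..})))"

definition charfun_cpt :: "'d::finite cpt measure \<Rightarrow> real^'d \<Rightarrow> complex" where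
  "charfun_cpt \<nu> k = (\<integral>x. (case x of None \<Rightarrow> 0 | Some y \<Rightarrow> cis (k \<bullet> y)) \<partial>\<nu>)"

definition is_ISE :: "'d::finite cpt measure measure \<Rightarrow> bool" where
  "is_ISE Q \<longleftrightarrow> prob_space Q \<and> sets Q = sets (borel_of weak_top) \<and>
     (AE \<nu> in Q. emeasure \<nu> {None} = 0) \<and>
     (\<forall>l\<ge>1. \<forall>k :: nat \<Rightarrow> real^'d.
        (\<integral>\<nu>. (\<Prod>i\<in>{1..l}. charfun_cpt \<nu> (k i)) \<partial>Q) = complex_of_real (\<Sum>H\<in>shapes l. Ahat H k))"

end

theory Submission
  imports Defs "HOL-Computational_Algebra.Formal_Power_Series" "HOL-Real_Asymp.Real_Asymp"
begin

text \<open>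
  A Poisson Galton--Watson tree with marks \<open>I\<close> decomposes at its root, and this gives a recursion
  for the generating functions \<open>W\<^sub>I(z)\<close> of marked trees in which every marked vertex contributes a
  character of its position. Solving the recursion shows that \<open>W\<^sub>I = C\<^sub>I(t(z))\<close>, where \<open>t = z e\<^bsup>t-1\<^esup>\<close> is
  the tree function and \<open>C\<^sub>I\<close> is, up to terms of lower order, the sum over shapes of the products
  of \<open>1 / (1 - D\<^sub>A x)\<close> over the edges \<open>A\<close>, with \<open>D\<^sub>A\<close> the step characteristic function at
  the sum of the frequencies above the edge. Since the ratio of the coefficients of \<open>z\<^sup>n\<close> in \<open>t\<^sup>m\<close> and in \<open>t\<close> is exactly
  \<open>m (1 - 1/n) \<cdots> (1 - (m-1)/n)\<close>, which is about \<open>m exp (- m\<^sup>2 / (2 n))\<close>, the moments of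
  the empirical measure are Riemann sums for the integrals that define the ISE. Convergence of these
  moments passes to Gaussian test functions by Fourier inversion, and to all continuous functionals by
  the Stone--Weierstrass theorem on the compact space of probability measures.
\<close>

section \<open>Trees with an embedding as binary trees\<close>

text \<open>Powers of \<open>sqrt n\<close> organise the estimates. A shape with \<open>l\<close>
  marked leaves has \<open>2 l - 1\<close> edges; each edge factor \<open>1 / (1 - D x)\<close> has
  size \<open>sqrt n\<close>, and the ratio of coefficients contributes one more such factor, which
  together balance the normalisation \<open>n ^ l\<close>. Every other contribution (a mark on the
  path to another mark, a factor \<open>x\<close> or \<open>D\<close> replaced by \<open>1\<close>)
  has lost at least one factor \<open>sqrt n\<close>. As the errors are products of power series,
  they are measured in a submultiplicative weighted norm and not coefficient by coefficient. The
  other obstacle is the point at infinity: a character does not extend continuously to it, so the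
  moments are not continuous functionals on \<open>M1\<close>. A Gaussian vanishes at infinity and
  is an average of characters over a normally distributed frequency, so integrals of Gaussians
  inherit convergence from the moments. Gaussians also separate the points of the compactification,
  infinity included, and a product of two is a multiple of a third. Both approximation steps can
  therefore work directly on compact spaces, where mass that escapes to infinity is already
  accounted for.\<close>

text \<open>
  A tree is stored by its first child: in \<open>Br s c r\<close> the first child of the root is reached by the
  step \<open>s\<close> and carries the subtree \<open>c\<close>, and \<open>r\<close> is the tree that remains when this child is removed.
\<close>

datatype 's btree = Tip | Br 's "'s btree" "'s btree"

fun num_vertices :: "'s btree \<Rightarrow> nat" where
  "num_vertices Tip = 1" | "num_vertices (Br s c r) = num_vertices c + num_vertices r"

fun root_degree :: "'s btree \<Rightarrow> nat" where
  "root_degree Tip = 0" | "root_degree (Br s c r) = Suc (root_degree r)"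

lemma num_vertices_pos: "num_vertices t > 0" by (induction t) auto
lemma root_degree_less_num_vertices: "root_degree t < num_vertices t"
proof (induction t)
  case (Br s c r) then show ?case using num_vertices_pos[of c] by simp
qed simp

lemma finite_num_vertices_le: "finite {t :: 's::finite btree. num_vertices t \<le> n}"
proof (induction n)
  case 0
  have "\<not> num_vertices t \<le> 0" for t :: "'s btree" using num_vertices_pos[of t] by simp
  then have "{t :: 's btree. num_vertices t \<le> 0} = {}" by blast
  then show ?case by (simp only: finite.emptyI)
next
  case (Suc n)
  let ?S = "{t :: 's btree. num_vertices t \<le> n}"
  have "{t :: 's btree. num_vertices t \<le> Suc n} \<subseteq> insert Tip ((\<lambda>(s,c,r). Br s c r) ` (UNIV \<times> ?S \<times> ?S))"
  proof
    fix t :: "'s btree" assume t: "t \<in> {t. num_vertices t \<le> Suc n}"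
    show "t \<in> insert Tip ((\<lambda>(s,c,r). Br s c r) ` (UNIV \<times> ?S \<times> ?S))"
    proof (cases t)
      case (Br s c r)
      then show ?thesis using t num_vertices_pos[of c] num_vertices_pos[of r]
        by (auto simp: image_iff intro!: bexI[of _ "(s,c,r)"])
    qed simp
  qed
  then show ?case by (rule finite_subset) (use Suc in auto)
qed

lemma finite_num_vertices_eq: "finite {t :: 's::finite btree. num_vertices t = n}"
  by (rule finite_subset[OF _ finite_num_vertices_le[of n]]) auto

definition step_vec :: "'d::finite \<times> bool \<Rightarrow> int^'d" where
  "step_vec s = axis (fst s) (if snd s then 1 else -1)"

lemma inj_step_vec: "inj step_vec"
  unfolding inj_def step_vec_def by (auto simp: axis_eq_axis split: if_splits)

lemma step_vec_range: "(\<exists>i. v = axis i 1 \<or> v = axis i (-1)) \<longleftrightarrow> v \<in> range step_vec"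
  unfolding step_vec_def image_iff by auto

text \<open>One partial map carries both the vertex set (its domain) and the embedding (its values).
  Removing the first child lowers the numbers of its siblings by one, hence the last equation.
  Children are numbered from 1, so the letter \<open>0\<close> never occurs.\<close>

fun pos :: "('d::finite \<times> bool) btree \<Rightarrow> nat list \<Rightarrow> (int^'d) option" where
  "pos t [] = Some 0"
| "pos Tip (j # w) = None"
| "pos (Br s c r) (0 # w) = None"
| "pos (Br s c r) (Suc 0 # w) = map_option ((+) (step_vec s)) (pos c w)"
| "pos (Br s c r) (Suc (Suc j) # w) = pos r (Suc j # w)"

text \<open>Undoes this renumbering: words of the remaining tree become words of the whole tree, and
  the root is common to both.\<close>

fun shiftw :: "nat list \<Rightarrow> nat list" where
  "shiftw [] = []" | "shiftw (j # w) = Suc j # w"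

lemma inj_shiftw: "inj shiftw"
proof (rule injI)
  fix x y assume "shiftw x = shiftw y"
  then show "x = y" by (cases x; cases y) auto
qed

lemma pos_zero [simp]: "pos t (0 # w) = None"
  by (cases t) auto

lemma word_cases:
  fixes w :: "nat list"
  obtains "w = []" | v where "w = 0 # v" | v where "w = Suc 0 # v" | j v where "w = Suc (Suc j) # v"
  by (metis list.exhaust nat.exhaust)

lemma dom_pos_Br: "dom (pos (Br s c r)) = Cons 1 ` dom (pos c) \<union> shiftw ` dom (pos r)"
proof (intro set_eqI)
  fix w
  have "shiftw v = Suc (Suc j) # u \<longleftrightarrow> v = Suc j # u" for v j u by (cases v) auto
  moreover have "shiftw v = 0 # u \<longleftrightarrow> False" for v u by (cases v) auto
  moreover have "shiftw v = Suc 0 # u \<longleftrightarrow> v = 0 # u" for v u by (cases v) auto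
  moreover have "shiftw v = [] \<longleftrightarrow> v = []" for v by (cases v) auto
  ultimately show "w \<in> dom (pos (Br s c r)) \<longleftrightarrow> w \<in> Cons 1 ` dom (pos c) \<union> shiftw ` dom (pos r)"
    by (cases w rule: word_cases) (auto simp: image_iff dom_def eq_commute[of _ "shiftw _"])
qed

lemma dom_pos_Tip: "dom (pos Tip) = {[]}"
proof (rule set_eqI)
  fix w show "w \<in> dom (pos Tip) \<longleftrightarrow> w \<in> {[]}" by (cases w) auto
qed

lemma dom_pos_disj: "Cons (Suc 0) ` dom (pos c) \<inter> shiftw ` dom (pos r) = {}"
proof -
  have "False" if "1 # w = shiftw v" "v \<in> dom (pos r)" for w v
    using that pos_zero[of r] by (cases v) auto
  then show ?thesis by auto
qed

lemma finite_dom_pos: "finite (dom (pos t))"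
  by (induction t) (simp_all add: dom_pos_Br dom_pos_Tip)

lemma card_dom_pos: "card (dom (pos t)) = num_vertices t"
proof (induction t)
  case (Br s c r)
  then show ?case
    using card_Un_disjoint[OF _ _ dom_pos_disj[of c r]] finite_dom_pos[of c] finite_dom_pos[of r]
    by (simp add: dom_pos_Br card_image inj_on_subset[OF inj_shiftw])
qed (simp add: dom_pos_Tip)

lemma sum_dom_pos_Br:
  "(\<Sum>w\<in>dom (pos (Br s c r)). f w) = (\<Sum>w\<in>dom (pos c). f (1 # w)) + (\<Sum>w\<in>dom (pos r). f (shiftw w))"
  for f :: "nat list \<Rightarrow> 'a::comm_monoid_add"
  using finite_dom_pos[of c] finite_dom_pos[of r] dom_pos_disj[of c r]
  by (simp add: dom_pos_Br sum.union_disjoint sum.reindex inj_on_subset[OF inj_shiftw] o_def)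

lemma prod_dom_pos_Br:
  "(\<Prod>w\<in>dom (pos (Br s c r)). f w) = (\<Prod>w\<in>dom (pos c). f (1 # w)) * (\<Prod>w\<in>dom (pos r). f (shiftw w))"
  for f :: "nat list \<Rightarrow> 'a::comm_monoid_mult"
  using finite_dom_pos[of c] finite_dom_pos[of r] dom_pos_disj[of c r]
  by (simp add: dom_pos_Br prod.union_disjoint prod.reindex inj_on_subset[OF inj_shiftw] o_def)

lemma pos_shiftw: "w \<in> dom (pos r) \<Longrightarrow> pos (Br s c r) (shiftw w) = pos r w"
  by (cases w rule: word_cases) auto

lemma dom_pos_shiftw_append:
  "w \<in> dom (pos r) \<Longrightarrow> w \<noteq> [] \<Longrightarrow> pos (Br s c r) (shiftw w @ v) = pos r (w @ v)"
  by (cases w rule: word_cases) auto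

lemma children_root: "[j] \<in> dom (pos t) \<longleftrightarrow> j \<in> {1..root_degree t}"
proof (induction t arbitrary: j)
  case (Br s c r)
  consider "j = 0" | "j = 1" | i where "j = Suc (Suc i)" by (metis One_nat_def not0_implies_Suc)
  then show ?case using Br.IH(2)[of "j - 1"] by cases (auto simp: dom_def)
qed (simp add: dom_pos_Tip)

lemma nchildren_root: "nchildren (dom (pos t)) [] = root_degree t"
  proof -
  have "{j. [] @ [j] \<in> dom (pos t)} = {1..root_degree t}" using children_root[of _ t] by auto
  then show ?thesis unfolding nchildren_def by simp
qed

lemma nchildren_first: "nchildren (dom (pos (Br s c r))) (1 # w) = nchildren (dom (pos c)) w"
  unfolding nchildren_def by (rule arg_cong[of _ _ card]) auto

lemma nchildren_shiftw: "w \<in> dom (pos r) \<Longrightarrow> w \<noteq> [] \<Longrightarrow>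
    nchildren (dom (pos (Br s c r))) (shiftw w) = nchildren (dom (pos r)) w"
  unfolding nchildren_def by (simp add: dom_def dom_pos_shiftw_append)

definition tree_factor :: "('d::finite \<times> bool) btree \<Rightarrow> real" where
  "tree_factor t = (\<Prod>w\<in>dom (pos t). 1 / fact (nchildren (dom (pos t)) w))"

lemma tree_factor_Tip: "tree_factor Tip = 1"
  by (simp add: tree_factor_def dom_pos_Tip nchildren_def)

text \<open>Attaching a first child changes the number of children of the root only, from
  \<open>g\<close> to \<open>Suc g\<close>; the quotient of the two factorials is the factor on the
  left.\<close>

lemma tree_factor_Br: "real (Suc (root_degree r)) * tree_factor (Br s c r) = tree_factor c * tree_factor r"
proof -
  let ?D = "dom (pos r)"
  have finite_indicator: "finite ?D" and nil: "[] \<in> ?D" by (auto simp: finite_dom_pos)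
  have "(\<Prod>w\<in>?D. 1 / fact (nchildren (dom (pos (Br s c r))) (shiftw w)))
      = 1 / fact (Suc (root_degree r)) * (\<Prod>w\<in>?D - {[]}. 1 / fact (nchildren ?D w) :: real)"
    using nchildren_root[of "Br s c r"]
    by (subst prod.remove[OF finite_indicator nil]) (simp add: nchildren_shiftw del: fact_Suc)
  also have "\<dots> = 1 / real (Suc (root_degree r)) * tree_factor r"
    unfolding tree_factor_def by (subst prod.remove[OF finite_indicator nil]) (simp add: nchildren_root)
  finally show ?thesis
    unfolding tree_factor_def[of "Br s c r"] prod_dom_pos_Br
    using nchildren_first[of s c r] by (simp add: tree_factor_def ac_simps)
qed

text \<open>Vertices correspond to the occurrences of \<open>Tip\<close>, whence
  \<open>exp (-1)\<close> for each. Each \<open>Br\<close> is an edge, with step probability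
  \<open>1 / (2 d)\<close>, and the factors \<open>1 / Suc (root_degree r)\<close> build up the
  inverse factorials by \<open>tree_factor_Br\<close>.\<close>

fun tree_weight :: "('d::finite \<times> bool) btree \<Rightarrow> real" where
  "tree_weight Tip = exp (-1)"
| "tree_weight (Br s c r) = tree_weight c * tree_weight r / (2 * real CARD('d) * real (Suc (root_degree r)))"

lemma tree_weight_pos: "tree_weight t > 0"
  by (induction t) auto

definition tree_embedding :: "('d::finite \<times> bool) btree \<Rightarrow> nat list \<Rightarrow> int^'d" where
  "tree_embedding t w = (case pos t w of None \<Rightarrow> 0 | Some x \<Rightarrow> x)"

lemma tree_weight_eq:
  fixes t :: "('d::finite \<times> bool) btree"
  shows "P_tree_emb (dom (pos t)) (tree_embedding t) = tree_weight t"
proof -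
  have "exp (- real (num_vertices t)) * tree_factor t * (1 / (2 * real CARD('d))) ^ (num_vertices t - 1) = tree_weight t"
  proof (induction t)
    case Tip then show ?case by (simp add: tree_factor_Tip)
  next
    case (Br s c r)
    have e: "num_vertices c + num_vertices r - 1 = Suc ((num_vertices c - 1) + (num_vertices r - 1))"
      using num_vertices_pos[of c] num_vertices_pos[of r] by simp
    have t: "tree_factor (Br s c r) = tree_factor c * tree_factor r / real (Suc (root_degree r))"
      using tree_factor_Br[of r s c] by (simp add: field_simps)
    show ?case
      unfolding tree_weight.simps num_vertices.simps e Br[symmetric] t
      by (simp add: power_add exp_add[symmetric] field_simps)
  qed
  then show ?thesis
    by (simp add: P_tree_emb_def P_tree_def card_dom_pos tree_factor_def mult_ac)
qed

lemma dom_pos_snoc: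
  "w @ [j] \<in> dom (pos t) \<Longrightarrow>
    w \<in> dom (pos t) \<and> 1 \<le> j \<and> (\<forall>i\<in>{1..j}. w @ [i] \<in> dom (pos t)) \<and> tree_embedding t (w @ [j]) - tree_embedding t w \<in> range step_vec"
proof (induction t arbitrary: w j)
  case Tip then show ?case by (cases w) auto
next
  case (Br s c r)
  show ?case
  proof (cases w rule: word_cases)
    case 1
    have j: "j \<in> {1..root_degree (Br s c r)}" using Br.prems 1 children_root[of _ "Br s c r"] by auto
    have "tree_embedding (Br s c r) [j] \<in> range step_vec"
    proof (cases "j = 1")
      case False
      then obtain i where i: "j = Suc (Suc i)" using j by (metis One_nat_def atLeastAtMost_iff not0_implies_Suc not_one_le_zero)
      then have "[] @ [Suc i] \<in> dom (pos r)" using Br.prems 1 by auto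
      from Br.IH(2)[OF this] show ?thesis by (simp add: tree_embedding_def i)
    qed (simp add: tree_embedding_def)
    with 1 j show ?thesis using children_root[of _ "Br s c r"] by (auto simp: tree_embedding_def)
  next
    case (2 v) then show ?thesis using Br.prems by auto
  next
    case (3 v)
    then have a: "v @ [j] \<in> dom (pos c)" using Br.prems by auto
    obtain x where "pos c (v @ [j]) = Some x" using a by auto
    moreover obtain y where "pos c v = Some y" using Br.IH(1)[OF a] by auto
    ultimately show ?thesis using Br.IH(1)[OF a] 3 by (auto simp: tree_embedding_def)
  next
    case (4 i v)
    then have a: "(Suc i # v) @ [j] \<in> dom (pos r)" using Br.prems by auto
    with Br.IH(2)[OF a] 4 show ?thesis by (auto simp: tree_embedding_def)
  qed
qed

lemma tree_embedding_pairs: "(dom (pos t), tree_embedding t) \<in> pairs (num_vertices t)"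
proof -
  have "plane_tree (dom (pos t))"
    unfolding plane_tree_def
  proof (intro conjI allI impI)
    show "finite (dom (pos t))" "[] \<in> dom (pos t)" by (auto simp: finite_dom_pos)
    fix w j assume "w @ [j] \<in> dom (pos t)"
    from dom_pos_snoc[OF this]
    show "w \<in> dom (pos t)" "1 \<le> j" "\<forall>i\<in>{1..j}. w @ [i] \<in> dom (pos t)" by blast+
  qed
  moreover have "embedding (dom (pos t)) (tree_embedding t)"
    unfolding embedding_def step_vec_range using dom_pos_snoc[of _ _ t]
    by (simp add: tree_embedding_def domIff)
  ultimately show ?thesis unfolding pairs_def by (simp add: card_dom_pos)
qed

lemma pos_eq_tree_embedding: "pos t w = (if w \<in> dom (pos t) then Some (tree_embedding t w) else None)"
  by (auto simp: tree_embedding_def split: option.splits)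

lemma inj_pos: "pos t = pos t' \<Longrightarrow> t = t'"
proof (induction t arbitrary: t')
  case Tip
  have "pos t' [Suc 0] = None" using fun_cong[OF Tip, of "[Suc 0]"] by simp
  then show ?case by (cases t') auto
next
  case (Br s c r)
  show ?case
  proof (cases t')
    case Tip then show ?thesis using fun_cong[OF Br.prems, of "[Suc 0]"] by auto
  next
    case t': (Br s' c' r')
    have s: "s = s'" using fun_cong[OF Br.prems, of "[Suc 0]"] t' by (simp add: inj_eq[OF inj_step_vec])
    have "pos c = pos c'"
    proof
      fix w show "pos c w = pos c' w"
        using fun_cong[OF Br.prems, of "Suc 0 # w"] t' s by (cases "pos c w"; cases "pos c' w") auto
    qed
    moreover have "pos r = pos r'"
    proof
      fix w show "pos r w = pos r' w"
      proof (cases w)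
        case (Cons j v)
        then show ?thesis using fun_cong[OF Br.prems, of "Suc j # v"] t' by (cases j) auto
      qed simp
    qed
    ultimately show ?thesis using Br.IH s t' by blast
  qed
qed

lemma inj_tree_embedding: "inj (\<lambda>t. (dom (pos t), tree_embedding t))"
proof (rule injI)
  fix t t' :: "('a::finite \<times> bool) btree" assume "(dom (pos t), tree_embedding t) = (dom (pos t'), tree_embedding t')"
  then have "pos t w = pos t' w" for w
    using pos_eq_tree_embedding[of t w] pos_eq_tree_embedding[of t' w] by (metis prod.inject)
  then show "t = t'" by (intro inj_pos ext)
qed

text \<open>The conditions \<open>plane_tree\<close> and \<open>embedding\<close> imposed on a
  single partial map, so that one induction rebuilds the vertex set and the positions
  together.\<close>

definition tree_map :: "(nat list \<Rightarrow> (int^'d::finite) option) \<Rightarrow> bool" where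
  "tree_map p \<longleftrightarrow> finite (dom p) \<and> p [] = Some 0 \<and>
     (\<forall>w j. w @ [j] \<in> dom p \<longrightarrow> w \<in> dom p \<and> 1 \<le> j \<and> (\<forall>i\<in>{1..j}. w @ [i] \<in> dom p) \<and>
        the (p (w @ [j])) - the (p w) \<in> range step_vec)"

lemma tree_map_prefix: "tree_map p \<Longrightarrow> w @ v \<in> dom p \<Longrightarrow> w \<in> dom p"
proof (induction v rule: rev_induct)
  case (snoc x xs)
  then show ?case unfolding tree_map_def by (metis append_assoc)
qed simp

text \<open>Induction on the number of vertices. If \<open>[1]\<close> is a vertex, the map splits
  into \<open>pc\<close>, the subtree at the first child with positions relative to that child, and
  \<open>pr\<close>, the rest with the other children renumbered. Otherwise the root has no children
  at all and the tree is \<open>Tip\<close>.\<close>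

lemma tree_map_imp_pos: "tree_map p \<Longrightarrow> \<exists>t. pos t = p"
proof (induction "card (dom p)" arbitrary: p rule: less_induct)
  case less
  note v = less.prems[unfolded tree_map_def]
  have snocD: "w \<in> dom p" "1 \<le> j" "\<And>i. i \<in> {1..j} \<Longrightarrow> w @ [i] \<in> dom p"
     "the (p (w @ [j])) - the (p w) \<in> range step_vec" if "w @ [j] \<in> dom p" for w j
    using v that by blast+
  have zero: "p (0 # w) = None" for w
  proof (rule ccontr)
    assume "p (0 # w) \<noteq> None"
    then have "[] @ [0] \<in> dom p" using tree_map_prefix[OF less.prems, of "[0]" w] by auto
    from snocD(2)[OF this] show False by simp
  qed
  show ?case
  proof (cases "[1] \<in> dom p")
    case False
    have "p (j # w) = None" for j w
    proof (rule ccontr)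
      assume "p (j # w) \<noteq> None"
      then have "[] @ [j] \<in> dom p" using tree_map_prefix[OF less.prems, of "[j]" w] by auto
      from snocD(2,3)[OF this] False show False by force
    qed
    then have "pos Tip w = p w" for w using v by (cases w) auto
    then show ?thesis by blast
  next
    case True
    have "[] @ [1] \<in> dom p" using True by simp
    from snocD(4)[OF this] obtain s where s: "p [1] = Some (step_vec s)" using v True by auto
    define pc where "pc = (\<lambda>w. map_option (\<lambda>x. x - step_vec s) (p (Suc 0 # w)))"
    define pr where "pr = (\<lambda>w. case w of [] \<Rightarrow> Some 0 | 0 # u \<Rightarrow> None | Suc j # u \<Rightarrow> p (Suc (Suc j) # u))"
    have dc: "w \<in> dom pc \<longleftrightarrow> Suc 0 # w \<in> dom p" for w by (auto simp: pc_def)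
    have pr_simps: "pr [] = Some 0" "pr (0 # u) = None" "pr (Suc j # u) = p (Suc (Suc j) # u)" for j u
      by (auto simp: pr_def)
    have dr: "w \<in> dom pr \<Longrightarrow> shiftw w \<in> dom p" for w
      using v by (cases w rule: word_cases) (auto simp: pr_simps)
    have fp: "finite (dom p)" using v by simp
    have nil: "[] \<in> dom p" using v by auto
    have fc: "finite (dom pc)"
      by (rule finite_imageD[of "Cons (Suc 0)"], rule finite_subset[OF _ fp]) (use dc in auto)
    have fr: "finite (dom pr)"
      by (rule finite_imageD[of shiftw], rule finite_subset[OF _ fp])
        (use dr inj_on_subset[OF inj_shiftw] in auto)
    \<comment> \<open>Prefixing \<open>Suc 0\<close> never gives the root, and further below
      \<open>shiftw\<close> never gives \<open>[1]\<close>; so both parts have strictly fewer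
      vertices.\<close>
    have "card (dom pc) \<le> card (dom p - {[]})"
      by (rule card_inj_on_le[of "Cons (Suc 0)"]) (use dc fp in auto)
    then have cc: "card (dom pc) < card (dom p)" using card_Diff1_less[OF fp nil] by simp
    have "shiftw w \<noteq> [1]" if "w \<in> dom pr" for w
      using that by (cases w rule: word_cases) (auto simp: pr_simps)
    then have "card (dom pr) \<le> card (dom p - {[1]})"
      by (intro card_inj_on_le[of shiftw]) (use dr fp inj_on_subset[OF inj_shiftw] in auto)
    then have cr: "card (dom pr) < card (dom p)" using card_Diff1_less[OF fp True] by simp
    have "tree_map pc"
      unfolding tree_map_def
    proof (intro conjI allI impI fc)
      show "pc [] = Some 0" using s by (simp add: pc_def)
      fix w j assume a: "w @ [j] \<in> dom pc"
      then have a': "(Suc 0 # w) @ [j] \<in> dom p" using dc by simp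
      note b = snocD[OF a']
      show "w \<in> dom pc" using b(1) dc by simp
      show "1 \<le> j" by (rule b(2))
      show "\<forall>i\<in>{1..j}. w @ [i] \<in> dom pc" using b(3) dc by simp
      show "the (pc (w @ [j])) - the (pc w) \<in> range step_vec"
        using b(1,4) a' by (auto simp: pc_def)
    qed
    with less.hyps[OF cc] obtain c where c: "pos c = pc" by blast
    have "tree_map pr"
      unfolding tree_map_def
    proof (intro conjI allI impI fr)
      show "pr [] = Some 0" by (simp add: pr_simps)
      fix w j assume a: "w @ [j] \<in> dom pr"
      have "w \<in> dom pr \<and> 1 \<le> j \<and> (\<forall>i\<in>{1..j}. w @ [i] \<in> dom pr) \<and> the (pr (w @ [j])) - the (pr w) \<in> range step_vec"
      proof (cases w)
        case Nil
        obtain i where i: "j = Suc i" using a Nil by (cases j) (auto simp: pr_simps)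
        then have a': "[] @ [Suc (Suc i)] \<in> dom p" using a Nil by (auto simp: pr_simps)
        note b = snocD[OF a']
        have "[k] \<in> dom pr" if k: "k \<in> {1..j}" for k
        proof -
          obtain k' where k': "k = Suc k'" using k by (cases k) auto
          then show ?thesis using b(3)[of "Suc k"] k i by (auto simp: pr_simps)
        qed
        then show ?thesis using b(4) v i Nil by (auto simp: pr_simps)
      next
        case (Cons k u)
        obtain k' where k': "k = Suc k'" using a Cons by (cases k) (auto simp: pr_simps)
        then have a': "(Suc (Suc k') # u) @ [j] \<in> dom p" using a Cons by (auto simp: pr_simps)
        note b = snocD[OF a']
        then show ?thesis using Cons k' by (auto simp: pr_simps dom_def)
      qed
      then show "w \<in> dom pr" "1 \<le> j" "\<forall>i\<in>{1..j}. w @ [i] \<in> dom pr" "the (pr (w @ [j])) - the (pr w) \<in> range step_vec"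
        by blast+
    qed
    with less.hyps[OF cr] obtain r where r: "pos r = pr" by blast
    have "pos (Br s c r) w = p w" for w
      using v zero by (cases w rule: word_cases)
        (auto simp: c r pr_simps pc_def option.map_comp o_def option.map_ident)
    then show ?thesis by blast
  qed
qed

text \<open>Together with \<open>inj_tree_embedding\<close> this turns every sum over trees with
  embeddings into a sum over binary trees, where structural recursion is available.\<close>

lemma pairs_eq_image: "pairs n = (\<lambda>t. (dom (pos t), tree_embedding t)) ` {t. num_vertices t = n}"
proof (intro set_eqI iffI)
  fix x :: "nat list set \<times> (nat list \<Rightarrow> int^'d)" assume "x \<in> pairs n"
  then obtain T \<phi> where x: "x = (T, \<phi>)" and T: "plane_tree T" "card T = n" and \<phi>: "embedding T \<phi>"
    by (auto simp: pairs_def)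
  define p where "p = (\<lambda>w. if w \<in> T then Some (\<phi> w) else None)"
  have dp: "dom p = T" by (auto simp: p_def dom_def split: if_splits)
  have "tree_map p"
    unfolding tree_map_def dp
  proof (intro conjI allI impI)
    show "finite T" "p [] = Some 0" using T \<phi> by (auto simp: plane_tree_def embedding_def p_def)
    fix w j assume a: "w @ [j] \<in> T"
    then show "w \<in> T" "1 \<le> j" "\<forall>i\<in>{1..j}. w @ [i] \<in> T"
      using T(1) unfolding plane_tree_def by blast+
    then show "the (p (w @ [j])) - the (p w) \<in> range step_vec"
      using \<phi> a unfolding embedding_def step_vec_range p_def by simp
  qed
  then obtain t where t: "pos t = p" using tree_map_imp_pos by blast
  then have "dom (pos t) = T" using dp by simp
  moreover have "tree_embedding t = \<phi>" using \<phi> t by (auto simp: tree_embedding_def p_def embedding_def)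
  ultimately show "x \<in> (\<lambda>t. (dom (pos t), tree_embedding t)) ` {t. num_vertices t = n}"
    using T card_dom_pos[of t] x by (auto simp: image_iff)
qed (use tree_embedding_pairs in auto)

lemma sum_pairs:
  "(\<Sum>x\<in>(pairs n :: (nat list set \<times> (nat list \<Rightarrow> int^'d::finite)) set). f x) = (\<Sum>t | num_vertices t = n. f (dom (pos t), tree_embedding t))"
  unfolding pairs_eq_image by (subst sum.reindex) (auto intro: inj_on_subset[OF inj_tree_embedding])

text \<open>For a character \<open>e\<close> this is the sum of \<open>e\<close> over the positions
  of all vertices (\<open>char_sum_eq\<close>): moving a subtree by a step multiplies its sum by
  \<open>e\<close> of that step.\<close>

fun char_sum :: "(int^'d::finite \<Rightarrow> 'c::comm_semiring_1) \<Rightarrow> ('d \<times> bool) btree \<Rightarrow> 'c" where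
  "char_sum e Tip = 1"
| "char_sum e (Br s c r) = e (step_vec s) * char_sum e c + char_sum e r"

lemma char_sum_eq:
  assumes "e 0 = 1" "\<And>x y. e (x + y) = e x * e y"
  shows "(\<Sum>w\<in>dom (pos t). e (tree_embedding t w)) = char_sum e t"
proof (induction t)
  case Tip then show ?case using assms by (simp add: dom_pos_Tip tree_embedding_def)
next
  case (Br s c r)
  have "(\<Sum>w\<in>dom (pos c). e (tree_embedding (Br s c r) (1 # w))) = (\<Sum>w\<in>dom (pos c). e (step_vec s) * e (tree_embedding c w))"
    by (rule sum.cong) (auto simp: tree_embedding_def assms)
  moreover have "(\<Sum>w\<in>dom (pos r). e (tree_embedding (Br s c r) (shiftw w))) = (\<Sum>w\<in>dom (pos r). e (tree_embedding r w))"
    by (rule sum.cong) (simp_all add: tree_embedding_def pos_shiftw)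
  ultimately show ?case
    unfolding sum_dom_pos_Br char_sum.simps Br[symmetric] by (simp add: sum_distrib_left)
qed


section \<open>The recursion for marked trees\<close>

notation fps_nth (infixl "$$" 75)

text \<open>Expanding the product distributes the marks in \<open>I\<close> independently over the
  vertices; several marks may share a vertex.\<close>

definition marked_weight :: "('i \<Rightarrow> int^'d::finite \<Rightarrow> complex) \<Rightarrow> 'i set \<Rightarrow> ('d \<times> bool) btree \<Rightarrow> complex" where
  "marked_weight e I t = of_real (tree_weight t) * (\<Prod>i\<in>I. char_sum (e i) t)"

definition gf_degree :: "('i \<Rightarrow> int^'d::finite \<Rightarrow> complex) \<Rightarrow> nat \<Rightarrow> 'i set \<Rightarrow> complex fps" where
  "gf_degree e g I = Abs_fps (\<lambda>n. \<Sum>t | num_vertices t = n \<and> root_degree t = g. marked_weight e I t)"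

definition gf :: "('i \<Rightarrow> int^'d::finite \<Rightarrow> complex) \<Rightarrow> 'i set \<Rightarrow> complex fps" where
  "gf e I = Abs_fps (\<lambda>n. \<Sum>t | num_vertices t = n. marked_weight e I t)"

text \<open>Expectation of the characters of all marks in \<open>B\<close> at one uniform step: a
  step towards a subtree is shared by every mark inside that subtree.\<close>

definition stepsum :: "('i \<Rightarrow> int^'d::finite \<Rightarrow> complex) \<Rightarrow> 'i set \<Rightarrow> complex" where
  "stepsum e B = (\<Sum>s\<in>UNIV. \<Prod>i\<in>B. e i (step_vec s)) / (2 * of_nat CARD('d))"

lemma sum_Br:
  fixes h :: "'s::finite btree \<Rightarrow> 'c::comm_monoid_add"
  shows "(\<Sum>t | num_vertices t = n \<and> root_degree t = Suc g. h t) =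
    (\<Sum>k=0..n. \<Sum>c | num_vertices c = k. \<Sum>r | num_vertices r = n - k \<and> root_degree r = g. \<Sum>s\<in>UNIV. h (Br s c r))"
proof -
  let ?R = "\<lambda>k. {r :: 's btree. num_vertices r = n - k \<and> root_degree r = g}"
  let ?S = "SIGMA k:{0..n}. SIGMA c:{c :: 's btree. num_vertices c = k}. SIGMA r:?R k. (UNIV :: 's set)"
  have fR: "finite (?R k)" for k
    by (rule finite_subset[OF _ finite_num_vertices_eq[of "n - k"]]) auto
  have "(\<Sum>k=0..n. \<Sum>c | num_vertices c = k. \<Sum>r | num_vertices r = n - k \<and> root_degree r = g. \<Sum>s\<in>UNIV. h (Br s c r))
      = (\<Sum>(k,c,r,s)\<in>?S. h (Br s c r))"
    using fR finite_num_vertices_eq by (simp add: sum.cartesian_product split_def) (subst sum.Sigma, auto simp: split_def intro!: finite_cartesian_product)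
  also have "\<dots> = (\<Sum>t | num_vertices t = n \<and> root_degree t = Suc g. h t)"
  proof (rule sum.reindex_bij_witness[where j = "\<lambda>(k,c,r,s). Br s c r" and
        i = "\<lambda>t. case t of Br s c r \<Rightarrow> (num_vertices c, c, r, s)"])
    fix t :: "'s btree" assume "t \<in> {t. num_vertices t = n \<and> root_degree t = Suc g}"
    then show "(case t of Br s c r \<Rightarrow> (num_vertices c, c, r, s)) \<in> ?S" by (cases t) auto
    show "(case case t of Br s c r \<Rightarrow> (num_vertices c, c, r, s) of (k, c, r, s) \<Rightarrow> Br s c r) = t"
      using \<open>t \<in> _\<close> by (cases t) auto
  qed auto
  finally show ?thesis by simp
qed

text \<open>The product over \<open>I\<close> is expanded. \<open>B\<close> is the set of marks
  placed in the subtree of the first child, and exactly these marks see the step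
  \<open>s\<close>.\<close>

lemma marked_weight_Br:
  assumes "finite I"
  shows "of_nat (Suc (root_degree r)) * marked_weight e I (Br s c r) =
    (\<Sum>B\<in>Pow I. (\<Prod>i\<in>B. e i (step_vec s)) / (2 * of_nat CARD('d)) * marked_weight e B c * marked_weight e (I - B) (r :: ('d::finite \<times> bool) btree))"
proof -
  have w: "of_nat (Suc (root_degree r)) * complex_of_real (tree_weight (Br s c r)) = of_real (tree_weight c) * of_real (tree_weight r) / (2 * of_nat CARD('d))"
    by (simp add: field_simps del: of_nat_Suc)
  have "of_nat (Suc (root_degree r)) * marked_weight e I (Br s c r)
     = (of_nat (Suc (root_degree r)) * complex_of_real (tree_weight (Br s c r))) * (\<Prod>i\<in>I. e i (step_vec s) * char_sum (e i) c + char_sum (e i) r)"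
    by (simp add: marked_weight_def mult_ac)
  also have "\<dots> = of_real (tree_weight c) * of_real (tree_weight r) / (2 * of_nat CARD('d)) *
      (\<Sum>B\<in>Pow I. (\<Prod>i\<in>B. e i (step_vec s)) * (\<Prod>i\<in>B. char_sum (e i) c) * (\<Prod>i\<in>I - B. char_sum (e i) r))"
    unfolding w prod_add[OF assms] by (simp add: prod.distrib)
  also have "\<dots> = (\<Sum>B\<in>Pow I. (\<Prod>i\<in>B. e i (step_vec s)) / (2 * of_nat CARD('d)) * marked_weight e B c * marked_weight e (I - B) r)"
    unfolding sum_distrib_left by (simp add: marked_weight_def mult_ac)
  finally show ?thesis .
qed

text \<open>The factor \<open>Suc g\<close> compensates the Poisson weight \<open>1 / (Suc g)!\<close> of the root degree.\<close>

lemma gf_degree_Suc: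
  fixes e :: "'i \<Rightarrow> int^'d::finite \<Rightarrow> complex"
  assumes "finite I"
  shows "of_nat (Suc g) * gf_degree e (Suc g) I = (\<Sum>B\<in>Pow I. fps_const (stepsum e B) * gf e B * gf_degree e g (I - B))"
proof (rule fps_ext)
  fix n
  have "(of_nat (Suc g) * gf_degree e (Suc g) I) $$ n = of_nat (Suc g) * gf_degree e (Suc g) I $$ n"
    by (simp add: fps_mult_of_nat_nth del: of_nat_Suc)
  also have "\<dots> = of_nat (Suc g) * (\<Sum>k=0..n. \<Sum>c | num_vertices c = k. \<Sum>r | num_vertices r = n - k \<and> root_degree r = g. \<Sum>s\<in>UNIV. marked_weight e I (Br s c r))"
    unfolding gf_degree_def by (simp add: sum_Br del: of_nat_Suc)
  also have "\<dots> = (\<Sum>k=0..n. \<Sum>c | num_vertices c = k. \<Sum>r | num_vertices r = n - k \<and> root_degree r = g. \<Sum>s\<in>UNIV.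
      \<Sum>B\<in>Pow I. (\<Prod>i\<in>B. e i (step_vec s)) / (2 * of_nat CARD('d)) * marked_weight e B c * marked_weight e (I - B) r)"
    unfolding sum_distrib_left by (intro sum.cong refl) (auto simp only: marked_weight_Br[OF assms, symmetric])
  also have "\<dots> = (\<Sum>k=0..n. \<Sum>c | num_vertices c = k. \<Sum>r | num_vertices r = n - k \<and> root_degree r = g.
      \<Sum>B\<in>Pow I. stepsum e B * marked_weight e B c * marked_weight e (I - B) r)"
    by (intro sum.cong refl, subst sum.swap) (simp add: stepsum_def sum_distrib_right sum_divide_distrib)
  also have "\<dots> = (\<Sum>k=0..n. \<Sum>B\<in>Pow I. \<Sum>c | num_vertices c = k. \<Sum>r | num_vertices r = n - k \<and> root_degree r = g.
      stepsum e B * marked_weight e B c * marked_weight e (I - B) r)"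
    by (subst sum.swap[where B = "Pow I"])+ (rule refl)
  also have "\<dots> = (\<Sum>B\<in>Pow I. \<Sum>k=0..n. stepsum e B * (\<Sum>c | num_vertices c = k. marked_weight e B c) * (\<Sum>r | num_vertices r = n - k \<and> root_degree r = g. marked_weight e (I - B) r))"
    by (subst sum.swap[where A = "{0..n}" and B = "Pow I"])
      (simp only: mult.assoc sum_product, simp only: sum_distrib_left)
  also have "\<dots> = (\<Sum>B\<in>Pow I. fps_const (stepsum e B) * gf e B * gf_degree e g (I - B)) $$ n"
    unfolding fps_sum_nth mult.assoc unfolding fps_mult_left_const_nth unfolding fps_mult_nth
    by (simp only: gf_def gf_degree_def fps_nth_Abs_fps sum_distrib_left[symmetric])
  finally show "(of_nat (Suc g) * gf_degree e (Suc g) I) $$ n = (\<Sum>B\<in>Pow I. fps_const (stepsum e B) * gf e B * gf_degree e g (I - B)) $$ n" .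
qed

lemma gf_degree_0:
  fixes e :: "'i \<Rightarrow> int^'d::finite \<Rightarrow> complex"
  shows "gf_degree e 0 I = fps_const (of_real (exp (-1))) * fps_X"
proof (rule fps_ext)
  fix n
  have "{t :: ('d \<times> bool) btree. num_vertices t = n \<and> root_degree t = 0} = (if n = 1 then {Tip} else {})"
  proof -
    have "root_degree t = 0 \<longleftrightarrow> t = Tip" for t :: "('d \<times> bool) btree" by (cases t) auto
    then have "{t :: ('d \<times> bool) btree. num_vertices t = n \<and> root_degree t = 0} = {t. num_vertices t = n \<and> t = Tip}" by (simp only:)
    also have "\<dots> = (if n = 1 then {Tip} else {})" by (cases "n = 1") (simp_all add: conj_commute cong: conj_cong)
    finally show ?thesis .
  qed
  then show "gf_degree e 0 I $$ n = (fps_const (of_real (exp (-1))) * fps_X) $$ n"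
    by (simp add: gf_degree_def marked_weight_def)
qed

lemma sum_Pow_nested:
  assumes "finite I" "i \<in> I"
  shows "(\<Sum>B\<in>{B. B \<subseteq> I \<and> i \<notin> B}. \<Sum>C\<in>{C. i \<in> C \<and> C \<subseteq> I - B}. f B C)
     = (\<Sum>C\<in>{C. i \<in> C \<and> C \<subseteq> I}. \<Sum>B\<in>{B. B \<subseteq> I - C}. f B C)"
proof -
  have f: "finite {B. B \<subseteq> J \<and> P B}" if "finite J" for J :: "'a set" and P
    by (rule finite_subset[of _ "Pow J"]) (use that in auto)
  show ?thesis
    using assms f[of I] f[of "I - _"]
    by (subst sum.Sigma, auto simp: conj_commute)
      (subst sum.Sigma, auto simp: conj_commute intro!: sum.reindex_bij_witness[where i = prod.swap and j = prod.swap])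
qed

text \<open>Either the mark \<open>i\<close> sits at the root, where its character is
  \<open>1\<close>, or it lies in one of the \<open>Suc g\<close> child subtrees. Choosing that
  subtree cancels the factor \<open>Suc g\<close> in the factorial of the root and leaves root
  degree \<open>g\<close> for the other children. As \<open>gf_degree_Suc\<close> only sees the
  first child, this symmetry among the children is proved by induction on \<open>g\<close>.\<close>

lemma gf_degree_split:
  fixes e :: "'i \<Rightarrow> int^'d::finite \<Rightarrow> complex"
  assumes "finite I" "i \<in> I"
  shows "gf_degree e (Suc g) I = gf_degree e (Suc g) (I - {i}) +
    (\<Sum>B\<in>{B. i \<in> B \<and> B \<subseteq> I}. fps_const (stepsum e B) * gf e B * gf_degree e g (I - B))"
  using assms
proof (induction g arbitrary: I)
  case 0
  note finite_indicator = \<open>finite I\<close>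
  have P: "Pow I = {B. i \<in> B \<and> B \<subseteq> I} \<union> Pow (I - {i})" by auto
  have "gf_degree e (Suc 0) I = (\<Sum>B\<in>Pow I. fps_const (stepsum e B) * gf e B * gf_degree e 0 (I - B))"
    using gf_degree_Suc[OF finite_indicator, of 0 e] by simp
  also have "\<dots> = (\<Sum>B\<in>{B. i \<in> B \<and> B \<subseteq> I}. fps_const (stepsum e B) * gf e B * gf_degree e 0 (I - B))
      + (\<Sum>B\<in>Pow (I - {i}). fps_const (stepsum e B) * gf e B * gf_degree e 0 (I - B))"
    unfolding P by (rule sum.union_disjoint) (use finite_indicator in auto)
  also have "(\<Sum>B\<in>Pow (I - {i}). fps_const (stepsum e B) * gf e B * gf_degree e 0 (I - B)) = gf_degree e (Suc 0) (I - {i})"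
    using gf_degree_Suc[of "I - {i}" 0 e] finite_indicator by (simp add: gf_degree_0)
  finally show ?case by simp
next
  case (Suc g)
  note finite_indicator = \<open>finite I\<close>
  let ?Y = "\<lambda>B. fps_const (stepsum e B) * gf e B"
  let ?In = "{B. i \<in> B \<and> B \<subseteq> I}"
  have P: "Pow I = ?In \<union> Pow (I - {i})" by auto
  have "of_nat (Suc (Suc g)) * gf_degree e (Suc (Suc g)) I = (\<Sum>B\<in>Pow I. ?Y B * gf_degree e (Suc g) (I - B))"
    by (rule gf_degree_Suc[OF finite_indicator])
  also have "\<dots> = (\<Sum>B\<in>?In. ?Y B * gf_degree e (Suc g) (I - B)) + (\<Sum>B\<in>Pow (I - {i}). ?Y B * gf_degree e (Suc g) (I - B))"
    unfolding P by (rule sum.union_disjoint) (use finite_indicator in auto)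
  \<comment> \<open>In these terms the first child does not carry \<open>i\<close>. The induction
    hypothesis finds \<open>i\<close> in the remaining tree, at the root or in a subtree with mark
    set \<open>C\<close>.\<close>
  also have "(\<Sum>B\<in>Pow (I - {i}). ?Y B * gf_degree e (Suc g) (I - B))
      = (\<Sum>B\<in>Pow (I - {i}). ?Y B * gf_degree e (Suc g) ((I - {i}) - B))
        + (\<Sum>B\<in>Pow (I - {i}). \<Sum>C\<in>{C. i \<in> C \<and> C \<subseteq> I - B}. ?Y B * (?Y C * gf_degree e g (I - B - C)))"
    unfolding sum.distrib[symmetric]
  proof (rule sum.cong)
    fix B assume B: "B \<in> Pow (I - {i})"
    then have "gf_degree e (Suc g) (I - B) = gf_degree e (Suc g) (I - B - {i}) + (\<Sum>C\<in>{C. i \<in> C \<and> C \<subseteq> I - B}. ?Y C * gf_degree e g (I - B - C))"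
      by (intro Suc.IH) (use Suc.prems in auto)
    moreover have "I - B - {i} = I - {i} - B" by auto
    ultimately show "?Y B * gf_degree e (Suc g) (I - B) = ?Y B * gf_degree e (Suc g) (I - {i} - B)
        + (\<Sum>C\<in>{C. i \<in> C \<and> C \<subseteq> I - B}. ?Y B * (?Y C * gf_degree e g (I - B - C)))"
      by (simp add: ring_distribs sum_distrib_left)
  qed simp
  also have "(\<Sum>B\<in>Pow (I - {i}). ?Y B * gf_degree e (Suc g) ((I - {i}) - B)) = of_nat (Suc (Suc g)) * gf_degree e (Suc (Suc g)) (I - {i})"
    by (rule gf_degree_Suc[symmetric]) (use finite_indicator in auto)
  also have "(\<Sum>B\<in>Pow (I - {i}). \<Sum>C\<in>{C. i \<in> C \<and> C \<subseteq> I - B}. ?Y B * (?Y C * gf_degree e g (I - B - C)))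
     = (\<Sum>C\<in>?In. \<Sum>B\<in>{B. B \<subseteq> I - C}. ?Y B * (?Y C * gf_degree e g (I - B - C)))"
    using sum_Pow_nested[OF Suc.prems, of "\<lambda>B C. ?Y B * (?Y C * gf_degree e g (I - B - C))"]
    by (simp add: Pow_def subset_Diff_insert)
  also have "\<dots> = (\<Sum>C\<in>?In. ?Y C * (of_nat (Suc g) * gf_degree e (Suc g) (I - C)))"
  proof (rule sum.cong)
    fix C assume "C \<in> ?In"
    have "I - B - C = I - C - B" for B by auto
    then have "(\<Sum>B\<in>{B. B \<subseteq> I - C}. ?Y B * (?Y C * gf_degree e g (I - B - C))) = ?Y C * (\<Sum>B\<in>Pow (I - C). ?Y B * gf_degree e g (I - C - B))"
      by (simp add: sum_distrib_left Pow_def mult_ac)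
    also have "\<dots> = ?Y C * (of_nat (Suc g) * gf_degree e (Suc g) (I - C))"
      by (subst gf_degree_Suc) (use finite_indicator in auto)
    finally show "(\<Sum>B\<in>{B. B \<subseteq> I - C}. ?Y B * (?Y C * gf_degree e g (I - B - C))) = ?Y C * (of_nat (Suc g) * gf_degree e (Suc g) (I - C))" .
  qed simp
  \<comment> \<open>The first child as carrier of \<open>i\<close> counts once, the other children
    count \<open>Suc g\<close> times; together they give the common factor
    \<open>Suc (Suc g)\<close> that is cancelled at the end.\<close>
  also have "(\<Sum>B\<in>?In. ?Y B * gf_degree e (Suc g) (I - B)) + (of_nat (Suc (Suc g)) * gf_degree e (Suc (Suc g)) (I - {i})
        + (\<Sum>C\<in>?In. ?Y C * (of_nat (Suc g) * gf_degree e (Suc g) (I - C))))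
      = of_nat (Suc (Suc g)) * (gf_degree e (Suc (Suc g)) (I - {i}) + (\<Sum>B\<in>?In. ?Y B * gf_degree e (Suc g) (I - B)))"
    by (simp add: ring_distribs sum_distrib_left sum.distrib mult_ac)
  finally have "of_nat (Suc (Suc g)) * gf_degree e (Suc (Suc g)) I = \<dots>" .
  then show ?case
    by (subst (asm) mult_cancel_left) (use of_nat_neq_0[of "Suc g", where 'a = "complex fps"] in \<open>simp del: of_nat_Suc\<close>)
qed

text \<open>The root degree of a tree is less than its number of vertices, so each coefficient only
  involves finitely many root degrees.\<close>

lemma gf_nth: "n \<le> N \<Longrightarrow> gf e I $$ n = (\<Sum>g<N. gf_degree e g I $$ n)"
proof -
  assume n: "n \<le> N"
  have "gf e I $$ n = (\<Sum>g<N. \<Sum>t\<in>{t \<in> {t. num_vertices t = n}. root_degree t = g}. marked_weight e I t)"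
    unfolding gf_def fps_nth_Abs_fps
    by (rule sum.group[symmetric]) (use finite_num_vertices_eq root_degree_less_num_vertices n in \<open>auto intro: less_le_trans\<close>)
  then show ?thesis by (simp add: gf_degree_def)
qed

lemma gf_nth_0: "gf e I $$ 0 = 0"
  using gf_nth[of 0 0 e I] by simp

text \<open>The recursion according to the subtree of the root that contains the mark \<open>i\<close>.\<close>

lemma gf_rec:
  fixes e :: "'i \<Rightarrow> int^'d::finite \<Rightarrow> complex"
  assumes "finite I" "i \<in> I"
  shows "gf e I = gf e (I - {i}) + (\<Sum>B\<in>{B. i \<in> B \<and> B \<subseteq> I}. fps_const (stepsum e B) * gf e B * gf e (I - B))"
proof (rule fps_ext)
  fix n
  let ?Y = "\<lambda>B. fps_const (stepsum e B) * gf e B" and ?In = "{B. i \<in> B \<and> B \<subseteq> I}"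
  have tr: "(?Y B * gf e J) $$ n = (\<Sum>g<n. (?Y B * gf_degree e g J) $$ n)" for B J
  proof -
    have "(?Y B * gf e J) $$ n = (\<Sum>k=0..n. ?Y B $$ k * (\<Sum>g<n. gf_degree e g J $$ (n - k)))"
      unfolding fps_mult_nth[of "?Y B"] by (simp add: gf_nth[of "n - _" n])
    also have "\<dots> = (\<Sum>g<n. (?Y B * gf_degree e g J) $$ n)"
      unfolding fps_mult_nth[of "?Y B"] sum_distrib_left by (rule sum.swap)
    finally show ?thesis .
  qed
  have "gf e I $$ n = gf_degree e 0 I $$ n + (\<Sum>g<n. gf_degree e (Suc g) I $$ n)"
    using gf_nth[of n "Suc n" e I] by (simp add: sum.lessThan_Suc_shift del: sum.lessThan_Suc)
  also have "\<dots> = gf_degree e 0 (I - {i}) $$ n + (\<Sum>g<n. gf_degree e (Suc g) (I - {i}) $$ n)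
      + (\<Sum>g<n. \<Sum>B\<in>?In. (?Y B * gf_degree e g (I - B)) $$ n)"
    unfolding gf_degree_split[OF assms] by (simp add: gf_degree_0 sum.distrib fps_sum_nth)
  also have "gf_degree e 0 (I - {i}) $$ n + (\<Sum>g<n. gf_degree e (Suc g) (I - {i}) $$ n) = gf e (I - {i}) $$ n"
    using gf_nth[of n "Suc n" e "I - {i}"] by (simp add: sum.lessThan_Suc_shift del: sum.lessThan_Suc)
  also have "(\<Sum>g<n. \<Sum>B\<in>?In. (?Y B * gf_degree e g (I - B)) $$ n) = (\<Sum>B\<in>?In. (?Y B * gf e (I - B)) $$ n)"
    unfolding tr by (rule sum.swap)
  finally show "gf e I $$ n = (gf e (I - {i}) + (\<Sum>B\<in>?In. ?Y B * gf e (I - B))) $$ n"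
    by (simp add: fps_sum_nth)
qed


section \<open>The tree function and skeletons\<close>

text \<open>The Galton-Watson probability of having \<open>n\<close> vertices: summing over all
  embeddings cancels the step probabilities. The type argument fixes the set of steps.\<close>

definition tree_mass :: "'d::finite itself \<Rightarrow> nat \<Rightarrow> real" where
  "tree_mass _ n = (\<Sum>t | num_vertices (t :: ('d \<times> bool) btree) = n. tree_weight t)"

lemma tree_mass_pos:
  assumes "n > 0" shows "tree_mass TYPE('d::finite) n > 0"
proof -
  have "\<exists>t :: ('d \<times> bool) btree. num_vertices t = Suc m" for m
  proof (induction m)
    case (Suc m)
    then obtain t :: "('d \<times> bool) btree" where "num_vertices t = Suc m" by blast
    then show ?case by (intro exI[of _ "Br undefined t Tip"]) simp
  qed (auto intro: exI[of _ Tip])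
  from this[of "n - 1"] obtain t :: "('d \<times> bool) btree" where "num_vertices t = n" using assms by auto
  then show ?thesis
    unfolding tree_mass_def by (intro sum_pos finite_num_vertices_eq) (auto simp: tree_weight_pos)
qed

definition tree_gf :: "'d::finite itself \<Rightarrow> complex fps" where
  "tree_gf d = Abs_fps (\<lambda>n. of_real (tree_mass d n))"

lemma gf_empty: "gf (e :: 'i \<Rightarrow> int^'d::finite \<Rightarrow> complex) {} = tree_gf TYPE('d)"
  by (rule fps_ext) (simp add: gf_def tree_gf_def tree_mass_def marked_weight_def)

lemma tree_gf_nth: "tree_gf d $$ n = of_real (tree_mass d n)" by (simp add: tree_gf_def)

lemma tree_gf_nth_0: "tree_gf TYPE('d::finite) $$ 0 = 0"
  using gf_nth_0[of _ "{}"] by (simp add: gf_empty)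

lemma tree_gf_nth_neq_0: "n > 0 \<Longrightarrow> tree_gf TYPE('d::finite) $$ n \<noteq> 0"
  using tree_mass_pos[of n, where 'd = 'd] by (simp add: tree_gf_nth)

lemma char_sum_const_1: "char_sum (\<lambda>_. 1) t = of_nat (num_vertices t)"
  by (induction t) auto

text \<open>For trivial characters the recursion is the differential equation \<open>z t' = t + z t' t\<close>
  of the tree function, which replaces Lagrange inversion.\<close>

lemma tree_gf_ode: "fps_X * fps_deriv (tree_gf TYPE('d::finite)) * (1 - tree_gf TYPE('d)) = tree_gf TYPE('d)"
proof -
  \<comment> \<open>One mark with the trivial character counts the vertices, so its generating
    function is \<open>z t'\<close>; the recursion for this mark is the differential
    equation.\<close>
  let ?e = "\<lambda>(_::unit) (_::int^'d). 1 :: complex"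
  have g: "gf ?e {()} = fps_X * fps_deriv (tree_gf TYPE('d))"
  proof (rule fps_ext)
    fix n
    have "gf ?e {()} $$ n = (\<Sum>t | num_vertices (t :: ('d \<times> bool) btree) = n. of_real (tree_weight t) * of_nat n)"
      unfolding gf_def by (simp add: marked_weight_def char_sum_const_1)
    also have "\<dots> = of_nat n * tree_gf TYPE('d) $$ n"
      by (simp add: tree_gf_nth tree_mass_def sum_distrib_left mult_ac)
    finally show "gf ?e {()} $$ n = (fps_X * fps_deriv (tree_gf TYPE('d))) $$ n"
      by (cases n) simp_all
  qed
  have B: "{B. () \<in> B \<and> B \<subseteq> {()}} = {{()}}" by auto
  have s: "stepsum ?e {()} = 1" by (simp add: stepsum_def)
  let ?t = "tree_gf TYPE('d)"
  let ?th = "fps_X * fps_deriv ?t"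
  have h: "?th = ?t + ?th * ?t"
    using gf_rec[of "{()}" "()" ?e] unfolding B by (simp add: gf_empty g s)
  have "?th * (1 - ?t) = ?th - ?th * ?t" by (simp add: right_diff_distrib)
  also have "\<dots> = ?t" using h by (simp only: diff_eq_eq)
  finally show ?thesis .
qed

definition path_ratio :: "nat \<Rightarrow> nat \<Rightarrow> real" where
  "path_ratio n m = real m * (\<Prod>j\<in>{1..<m}. 1 - real j / real n)"

text \<open>With \<open>t\<close> the tree function, \<open>(m + 1) z (t^m)' - m z (t^(m+1))' = (m +
  1) m t^(m-1) z t' (1 - t)\<close>, which is \<open>(m + 1) m t^m\<close> by
  \<open>tree_gf_ode\<close>. Since \<open>z d/dz\<close> multiplies the coefficient of
  \<open>z^n\<close> by \<open>n\<close>, comparing coefficients gives the recurrence in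
  \<open>m\<close>.\<close>

lemma tree_gf_power_nth_Suc:
  assumes "n > 0" "m > 0"
  shows "(tree_gf TYPE('d::finite) ^ Suc m) $$ n = of_real (real (Suc m) / real m * (1 - real m / real n)) * (tree_gf TYPE('d) ^ m) $$ n"
proof -
  let ?t = "tree_gf TYPE('d)"
  let ?th = "fps_X * fps_deriv ?t"
  have d: "fps_X * fps_deriv (?t ^ Suc k) = of_nat (Suc k) * ?t ^ k * ?th" for k
    by (simp add: fps_deriv_power fps_of_nat del: power_Suc of_nat_Suc)
  obtain k where k: "m = Suc k" using assms by (cases m) auto
  have "of_nat (Suc m) * (fps_X * fps_deriv (?t ^ m)) - of_nat m * (fps_X * fps_deriv (?t ^ Suc m))
      = of_nat (Suc m) * of_nat m * ?t ^ k * (?th * (1 - ?t))"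
    unfolding d unfolding k d by (simp add: algebra_simps)
  also have "\<dots> = of_nat (Suc m) * of_nat m * ?t ^ m"
    unfolding tree_gf_ode by (simp add: k mult_ac)
  finally have "(of_nat (Suc m) * (fps_X * fps_deriv (?t ^ m)) - of_nat m * (fps_X * fps_deriv (?t ^ Suc m))) $$ n
     = (of_nat (Suc m * m) * ?t ^ m) $$ n"
    by (simp only: of_nat_mult)
  moreover have "(fps_X * fps_deriv f) $$ n = of_nat n * f $$ n" for f :: "complex fps"
    using assms by (cases n) auto
  ultimately have "of_nat (Suc m) * (of_nat n * (?t ^ m) $$ n) - of_nat m * (of_nat n * (?t ^ Suc m) $$ n)
     = of_nat (Suc m * m) * (?t ^ m) $$ n"
    by (simp only: fps_sub_nth fps_mult_of_nat_nth)
  then have "of_nat m * of_nat n * (?t ^ Suc m) $$ n = of_nat (Suc m) * (of_nat n - of_nat m) * (?t ^ m) $$ n"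
    by (simp add: algebra_simps)
  then show ?thesis using assms by (simp add: field_simps del: power_Suc)
qed

lemma tree_gf_power_nth:
  assumes "n > 0"
  shows "(tree_gf TYPE('d::finite) ^ m) $$ n = of_real (path_ratio n m) * tree_gf TYPE('d) $$ n"
proof (induction m)
  case 0 then show ?case using assms by (simp add: path_ratio_def)
next
  case (Suc m)
  show ?case
  proof (cases "m = 0")
    case False
    then show ?thesis
      unfolding tree_gf_power_nth_Suc[OF assms, of m, simplified, OF False[simplified]]
      using tree_gf_power_nth_Suc[OF assms, of m, where 'd = 'd] Suc
      by (simp add: path_ratio_def prod.atLeastLessThan_Suc del: power_Suc)
  qed (simp add: path_ratio_def)
qed

text \<open>The series \<open>C_I\<close> of the overview, obtained by substituting the
  compositional inverse of the tree function. In the new variable an unmarked tree is just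
  \<open>fps_X\<close>, and the recursion keeps its form.\<close>

definition skeleton_gf :: "('i \<Rightarrow> int^'d::finite \<Rightarrow> complex) \<Rightarrow> 'i set \<Rightarrow> complex fps" where
  "skeleton_gf e I = fps_compose (gf e I) (fps_inv (tree_gf TYPE('d)))"

lemma skeleton_gf_empty: "skeleton_gf (e :: 'i \<Rightarrow> int^'d::finite \<Rightarrow> complex) {} = fps_X"
  unfolding skeleton_gf_def gf_empty using tree_gf_nth_0[where 'd = 'd] tree_gf_nth_neq_0[of 1, where 'd = 'd] by (simp add: fps_inv_right)

lemma gf_eq_skeleton_gf: "gf (e :: 'i \<Rightarrow> int^'d::finite \<Rightarrow> complex) I = fps_compose (skeleton_gf e I) (tree_gf TYPE('d))"
proof -
  let ?t = "tree_gf TYPE('d)"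
  have t: "?t $$ 0 = 0" "?t $$ 1 \<noteq> 0" using tree_gf_nth_0[where 'd = 'd] tree_gf_nth_neq_0[of 1, where 'd = 'd] by auto
  show ?thesis
    unfolding skeleton_gf_def using t fps_inv[of ?t] by (subst fps_compose_assoc[symmetric]) (auto simp: fps_inv_def)
qed

text \<open>Coefficient extraction after substituting the tree function, normalised by
  \<open>tree_mass\<close>: \<open>x^m\<close> is sent to the ratio of the coefficients of
  \<open>z^n\<close> in \<open>t^m\<close> and in \<open>t\<close>.\<close>

definition path_functional :: "nat \<Rightarrow> complex fps \<Rightarrow> complex" where
  "path_functional n f = (\<Sum>m=0..n. f $$ m * of_real (path_ratio n m))"

lemma gf_nth_eq_path_functional:
  "n > 0 \<Longrightarrow> gf (e :: 'i \<Rightarrow> int^'d::finite \<Rightarrow> complex) I $$ n = of_real (tree_mass TYPE('d) n) * path_functional n (skeleton_gf e I)"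
  unfolding gf_eq_skeleton_gf path_functional_def fps_compose_nth
  by (simp add: tree_gf_power_nth tree_gf_nth sum_distrib_left mult_ac)

lemma skeleton_gf_rec:
  fixes e :: "'i \<Rightarrow> int^'d::finite \<Rightarrow> complex"
  assumes "finite I" "i \<in> I"
  shows "skeleton_gf e I = skeleton_gf e (I - {i}) + (\<Sum>B\<in>{B. i \<in> B \<and> B \<subseteq> I}. fps_const (stepsum e B) * skeleton_gf e B * skeleton_gf e (I - B))"
  unfolding skeleton_gf_def by (subst gf_rec[OF assms])
    (simp add: fps_compose_add_distrib fps_compose_sum_distrib fps_compose_mult_distrib fps_inv_def)

lemma path_ratio_nonneg: "m \<le> n \<Longrightarrow> 0 \<le> path_ratio n m"
  unfolding path_ratio_def by (intro mult_nonneg_nonneg prod_nonneg) auto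

lemma path_ratio_eq_0: "n > 0 \<Longrightarrow> m > n \<Longrightarrow> path_ratio n m = 0"
  unfolding path_ratio_def by (auto intro!: bexI[of _ n])

lemma path_ratio_le_exp:
  assumes "n > 0"  "m \<le> n"
  shows "path_ratio n m \<le> real m * exp (- (real m * (real m - 1)) / (2 * real n))"
proof -
  have "(\<Prod>j\<in>{1..<m}. 1 - real j / real n) \<le> (\<Prod>j\<in>{1..<m}. exp (- real j / real n))"
    by (rule prod_mono) (use assms exp_ge_add_one_self[of "- real _ / real n"] in auto)
  also have "\<dots> = exp (\<Sum>j\<in>{1..<m}. - real j / real n)"
    by (simp add: exp_sum)
  also have "(\<Sum>j\<in>{1..<m}. - real j / real n) = - (\<Sum>j\<in>{1..<m}. real j) / real n"
    by (simp add: sum_negf sum_divide_distrib)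
  also have "(\<Sum>j\<in>{1..<m}. real j) = real m * (real m - 1) / 2"
    by (induction m) (auto simp: algebra_simps)
  finally show ?thesis
    unfolding path_ratio_def by (intro mult_left_mono) auto
qed

text \<open>The Gaussian decay in \<open>m / sqrt n\<close> is weakened to an exponential one. An
  exponential weight is multiplicative in \<open>m\<close>, which makes the norm built from it
  submultiplicative.\<close>

lemma path_ratio_le:
  assumes "n > 0"
  shows "path_ratio n m \<le> exp 4 * (sqrt n * exp (- real m / sqrt n))"
proof (cases "m \<le> n")
  case True
  define u where "u = real m / sqrt n"
  have s1: "sqrt n \<ge> 1" using assms by simp
  have u: "u \<ge> 0" by (simp add: u_def)
  have mu: "real m = sqrt n * u" using s1 by (simp add: u_def)
  have n2: "real n = sqrt n * sqrt n" by simp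
  have "- (real m * (real m - 1)) / (2 * real n) = - (u * u) / 2 + u / (2 * sqrt n)"
    unfolding mu using s1 by (subst n2) (simp add: field_simps)
  also have "u / (2 * sqrt n) \<le> u / 2" using u s1 by (intro divide_left_mono) auto
  finally have e: "- (real m * (real m - 1)) / (2 * real n) \<le> - (u * u) / 2 + u / 2" by simp
  have "u \<le> exp u" using exp_ge_add_one_self[of u] by linarith
  then have "u * exp (- (u * u) / 2 + u / 2) \<le> exp u * exp (- (u * u) / 2 + u / 2)"
    by (intro mult_right_mono) auto
  also have "\<dots> = exp (u - u * u / 2 + u / 2)" by (simp add: exp_add[symmetric])
  also have "\<dots> \<le> exp (4 - u)"
  proof -
    \<comment> \<open>The claim amounts to \<open>u * u - 5 * u + 8 \<ge> 0\<close>, and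
      \<open>8\<close> exceeds \<open>25 / 4\<close>; this is the origin of the constant
      \<open>exp 4\<close>.\<close>
    have "0 \<le> (u - 5 / 2)\<^sup>2" by simp
    then show ?thesis by (simp add: power2_eq_square algebra_simps)
  qed
  finally have k: "u * exp (- (u * u) / 2 + u / 2) \<le> exp 4 * exp (- u)" by (simp add: exp_add[symmetric] exp_diff exp_minus field_simps)
  have "path_ratio n m \<le> real m * exp (- (real m * (real m - 1)) / (2 * real n))"
    by (rule path_ratio_le_exp[OF assms True])
  also have "\<dots> \<le> real m * exp (- (u * u) / 2 + u / 2)"
    using e by (intro mult_left_mono) auto
  also have "\<dots> = sqrt n * (u * exp (- (u * u) / 2 + u / 2))" unfolding mu by simp
  also have "\<dots> \<le> sqrt n * (exp 4 * exp (- u))" using k s1 by (intro mult_left_mono) auto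
  finally show ?thesis by (simp add: u_def mult_ac)
next
  case False
  then show ?thesis using path_ratio_eq_0[OF assms] by (simp add: mult_nonneg_nonneg)
qed

text \<open>
  For \<open>0 \<le> D \<le> 1\<close> the series \<open>1 / (1 - D x)\<close> has norm of order \<open>sqrt n\<close>. The truncation at \<open>n\<close> loses
  nothing because \<open>path_ratio n m\<close> vanishes for \<open>m > n > 0\<close>.
\<close>

definition damped_norm :: "nat \<Rightarrow> complex fps \<Rightarrow> real" where
  "damped_norm n f = (\<Sum>m\<le>n. norm (f $$ m) * exp (- real m / sqrt n))"

lemma damped_norm_nonneg: "damped_norm n f \<ge> 0" by (simp add: damped_norm_def sum_nonneg)

lemma norm_path_functional_le: assumes "n > 0" shows "norm (path_functional n f) \<le> exp 4 * sqrt n * damped_norm n f"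
proof -
  have "norm (path_functional n f) \<le> (\<Sum>m=0..n. norm (f $$ m) * path_ratio n m)"
    unfolding path_functional_def by (rule order_trans[OF norm_sum]) (simp add: norm_mult path_ratio_nonneg)
  also have "\<dots> \<le> (\<Sum>m=0..n. norm (f $$ m) * (exp 4 * (sqrt n * exp (- real m / sqrt n))))"
    by (intro sum_mono mult_left_mono path_ratio_le assms) auto
  also have "\<dots> = exp 4 * sqrt n * damped_norm n f"
    by (simp add: damped_norm_def sum_distrib_left mult_ac atMost_atLeast0)
  finally show ?thesis .
qed

lemma damped_norm_add: "damped_norm n (f + g) \<le> damped_norm n f + damped_norm n g"
  unfolding damped_norm_def sum.distrib[symmetric]
  by (intro sum_mono) (simp add: norm_triangle_ineq ring_distribs(2)[symmetric])

text \<open>The weight of a product of monomials is the product of the weights, and the index pairs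
  with sum at most \<open>n\<close> lie in the square of side \<open>n\<close>.\<close>

lemma damped_norm_mult: "damped_norm n (f * g) \<le> damped_norm n f * damped_norm n g"
proof -
  let ?w = "\<lambda>m. exp (- real m / sqrt n)"
  have "damped_norm n (f * g) \<le> (\<Sum>m\<le>n. \<Sum>i\<le>m. (norm (f $$ i) * ?w i) * (norm (g $$ (m - i)) * ?w (m - i)))"
    unfolding damped_norm_def
  proof (rule sum_mono)
    fix m
    have "norm ((f * g) $$ m) * ?w m \<le> (\<Sum>i=0..m. norm (f $$ i) * norm (g $$ (m - i))) * ?w m"
      unfolding fps_mult_nth by (intro mult_right_mono order_trans[OF norm_sum]) (auto simp: norm_mult)
    also have "\<dots> = (\<Sum>i\<le>m. (norm (f $$ i) * ?w i) * (norm (g $$ (m - i)) * ?w (m - i)))"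
      unfolding sum_distrib_right atMost_atLeast0
    proof (rule sum.cong)
      fix i assume "i \<in> {0..m}"
      then have "?w m = ?w i * ?w (m - i)"
        by (simp add: exp_add[symmetric] of_nat_diff diff_divide_distrib add_divide_distrib[symmetric])
      then show "norm (f $$ i) * norm (g $$ (m - i)) * ?w m = (norm (f $$ i) * ?w i) * (norm (g $$ (m - i)) * ?w (m - i))"
        by simp
    qed simp
    finally show "norm ((f * g) $$ m) * ?w m \<le> (\<Sum>i\<le>m. (norm (f $$ i) * ?w i) * (norm (g $$ (m - i)) * ?w (m - i)))" .
  qed
  also have "\<dots> = (\<Sum>(i,j)\<in>{(i,j). i + j \<le> n}. (norm (f $$ i) * ?w i) * (norm (g $$ j) * ?w j))"
    by (rule sum.triangle_reindex_eq[symmetric])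
  also have "\<dots> \<le> (\<Sum>(i,j)\<in>{..n} \<times> {..n}. (norm (f $$ i) * ?w i) * (norm (g $$ j) * ?w j))"
    by (rule sum_mono2) auto
  also have "\<dots> = damped_norm n f * damped_norm n g"
    unfolding damped_norm_def sum_product by (simp add: sum.cartesian_product)
  finally show ?thesis .
qed

definition geo :: "real \<Rightarrow> complex fps" where
  "geo D = Abs_fps (\<lambda>m. of_real (D ^ m))"

lemma geo_eq: "geo D = 1 + fps_const (of_real D) * fps_X * geo D"
proof (rule fps_ext)
  fix n show "geo D $$ n = (1 + fps_const (of_real D) * fps_X * geo D) $$ n"
    by (cases n) (simp_all add: geo_def mult.assoc)
qed

lemma geo_inverse: "(1 - fps_const (of_real D) * fps_X) * geo D = 1"
  using geo_eq[of D] by (simp add: algebra_simps)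

lemma damped_norm_const: "damped_norm n (fps_const c) = norm c"
  by (simp add: damped_norm_def atMost_atLeast0 sum.atLeast_Suc_atMost)

lemma damped_norm_X: "damped_norm n fps_X \<le> 1"
proof -
  have "damped_norm n fps_X = (\<Sum>m\<le>n. if m = 1 then exp (- 1 / sqrt n) else 0)"
    unfolding damped_norm_def by (intro sum.cong) auto
  also have "\<dots> \<le> 1" by simp
  finally show ?thesis .
qed

text \<open>A geometric series whose ratio is at most \<open>exp (- 1 / sqrt n)\<close>; this ratio
  stays below \<open>1\<close> by at least \<open>1 / (2 * sqrt n)\<close>.\<close>

lemma damped_norm_geo:
  assumes "n > 0" "0 \<le> D" "D \<le> 1" shows "damped_norm n (geo D) \<le> 2 * sqrt n"
proof -
  define r where "r = exp (- 1 / sqrt n)"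
  have s: "sqrt n \<ge> 1" using assms by simp
  have r: "0 \<le> r" "r < 1" using s by (auto simp: r_def)
  have "1 + 1 / sqrt n \<le> exp (1 / sqrt n)" by (rule exp_ge_add_one_self)
  then have "r \<le> 1 / (1 + 1 / sqrt n)"
    unfolding r_def using s by (simp add: exp_minus inverse_eq_divide add_pos_pos divide_left_mono)
  moreover have "1 / (1 + 1 / x) \<le> 1 - 1 / (2 * x)" if "x \<ge> 1" for x :: real
    using that by (simp add: field_simps)
  from this[OF s] have "1 / (1 + 1 / sqrt n) \<le> 1 - 1 / (2 * sqrt n)" .
  ultimately have "1 - r \<ge> 1 / (2 * sqrt n)" by linarith
  have "damped_norm n (geo D) \<le> (\<Sum>m\<le>n. r ^ m)"
    unfolding damped_norm_def
  proof (rule sum_mono)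
    fix m
    have "D ^ m \<le> 1" using assms by (simp add: power_le_one)
    moreover have "exp (- real m / sqrt n) = r ^ m" by (simp add: r_def exp_of_nat_mult[symmetric])
    ultimately show "norm (geo D $$ m) * exp (- real m / sqrt n) \<le> r ^ m"
      using assms r by (simp add: geo_def norm_power mult_left_le_one_le)
  qed
  also have "\<dots> = (1 - r ^ Suc n) / (1 - r)" using r by (simp add: sum_gp0)
  also have "\<dots> \<le> 1 / (1 - r)" using r by (intro divide_right_mono) auto
  also have "\<dots> \<le> 1 / (1 / (2 * sqrt n))"
    using \<open>1 - r \<ge> _\<close> s r by (intro divide_left_mono) auto
  finally show ?thesis by simp
qed


section \<open>Asymptotics of skeletons\<close>

text \<open>Growth of order \<open>sqrt n ^ N\<close> in the damped norm. Each edge factor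
  \<open>geo\<close> has order one, so \<open>N\<close> counts edges.\<close>

definition damped_bound :: "nat \<Rightarrow> (nat \<Rightarrow> complex fps) \<Rightarrow> bool" where
  "damped_bound N f \<longleftrightarrow> (\<exists>K. \<forall>\<^sub>F n in sequentially. damped_norm n (f n) \<le> K * sqrt (real n) ^ N)"

lemma damped_bound_add: "damped_bound N f \<Longrightarrow> damped_bound N g \<Longrightarrow> damped_bound N (\<lambda>n. f n + g n)"
  unfolding damped_bound_def
proof (elim exE)
  fix K L
  assume "\<forall>\<^sub>F n in sequentially. damped_norm n (f n) \<le> K * sqrt (real n) ^ N"
    and "\<forall>\<^sub>F n in sequentially. damped_norm n (g n) \<le> L * sqrt (real n) ^ N"
  then have "\<forall>\<^sub>F n in sequentially. damped_norm n (f n + g n) \<le> (K + L) * sqrt (real n) ^ N"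
    by eventually_elim (use damped_norm_add in \<open>fastforce simp: ring_distribs intro: order_trans\<close>)
  then show "\<exists>K. \<forall>\<^sub>F n in sequentially. damped_norm n (f n + g n) \<le> K * sqrt (real n) ^ N" by blast
qed

lemma damped_bound_mult: "damped_bound N f \<Longrightarrow> damped_bound M g \<Longrightarrow> damped_bound (N + M) (\<lambda>n. f n * g n)"
  unfolding damped_bound_def
proof (elim exE)
  fix K L
  assume "\<forall>\<^sub>F n in sequentially. damped_norm n (f n) \<le> K * sqrt (real n) ^ N"
    and "\<forall>\<^sub>F n in sequentially. damped_norm n (g n) \<le> L * sqrt (real n) ^ M"
  then have "\<forall>\<^sub>F n in sequentially. damped_norm n (f n * g n) \<le> (K * L) * sqrt (real n) ^ (N + M)"
  proof eventually_elim
    case (elim n)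
    have "damped_norm n (f n * g n) \<le> damped_norm n (f n) * damped_norm n (g n)" by (rule damped_norm_mult)
    also have "\<dots> \<le> (K * sqrt (real n) ^ N) * (L * sqrt (real n) ^ M)"
      using elim damped_norm_nonneg[of n "f n"] damped_norm_nonneg[of n "g n"] by (intro mult_mono) linarith+
    finally show ?case by (simp add: power_add mult_ac)
  qed
  then show "\<exists>K. \<forall>\<^sub>F n in sequentially. damped_norm n (f n * g n) \<le> K * sqrt (real n) ^ (N + M)" by blast
qed

lemma damped_bound_mono: assumes "damped_bound N f" "N \<le> M" shows "damped_bound M f"
proof -
  from assms obtain K where "\<forall>\<^sub>F n in sequentially. damped_norm n (f n) \<le> K * sqrt (real n) ^ N" by (auto simp: damped_bound_def)
  then have "\<forall>\<^sub>F n in sequentially. damped_norm n (f n) \<le> \<bar>K\<bar> * sqrt (real n) ^ M"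
    using eventually_gt_at_top[of 0]
  proof eventually_elim
    case (elim n)
    have "damped_norm n (f n) \<le> K * sqrt (real n) ^ N" by (rule elim(1))
    also have "\<dots> \<le> \<bar>K\<bar> * sqrt (real n) ^ N" by (intro mult_right_mono) auto
    also have "\<dots> \<le> \<bar>K\<bar> * sqrt (real n) ^ M"
      using elim(2) assms(2) by (intro mult_left_mono power_increasing) auto
    finally show ?case .
  qed
  then show ?thesis unfolding damped_bound_def by blast
qed

lemma damped_bound_zero: "damped_bound N (\<lambda>_. 0)"
  unfolding damped_bound_def by (intro exI[of _ 0]) (simp add: damped_norm_def)

lemma damped_bound_sum: "finite A \<Longrightarrow> (\<And>a. a \<in> A \<Longrightarrow> damped_bound N (f a)) \<Longrightarrow> damped_bound N (\<lambda>n. \<Sum>a\<in>A. f a n)"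
  by (induction rule: finite_induct) (auto intro: damped_bound_add damped_bound_zero)

lemma damped_bound_uminus: "damped_bound N f \<Longrightarrow> damped_bound N (\<lambda>n. - f n)"
  unfolding damped_bound_def damped_norm_def by simp

lemma damped_bound_diff: "damped_bound N f \<Longrightarrow> damped_bound N g \<Longrightarrow> damped_bound N (\<lambda>n. f n - g n)"
  using damped_bound_add[OF _ damped_bound_uminus] by fastforce

lemma damped_bound_X: "damped_bound 0 (\<lambda>_. fps_X)"
  unfolding damped_bound_def using damped_norm_X by (intro exI[of _ 1]) auto

lemma damped_bound_1: "damped_bound 0 (\<lambda>_. 1)"
  unfolding damped_bound_def using damped_norm_const[of _ 1] by (intro exI[of _ 1]) auto

section \<open>Shapes as laminar families of leaf sets, and their decomposition at the root
  edge\<close>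

definition laminar_family :: "'a set \<Rightarrow> 'a set set \<Rightarrow> bool" where
  "laminar_family I H \<longleftrightarrow> H \<subseteq> Pow I - {{}} \<and> I \<in> H \<and> (\<forall>i\<in>I. {i} \<in> H) \<and>
     (\<forall>A\<in>H. \<forall>B\<in>H. A \<subseteq> B \<or> B \<subseteq> A \<or> A \<inter> B = {}) \<and>
     (\<forall>A\<in>H. 2 \<le> card A \<longrightarrow> (\<exists>B\<in>H. \<exists>C\<in>H. B \<inter> C = {} \<and> B \<union> C = A \<and> B \<noteq> A \<and> C \<noteq> A))"

text \<open>Shapes over an arbitrary leaf set in place of \<open>{1..l}\<close>, because the
  recursion passes from \<open>I\<close> to the subsets \<open>B\<close> and
  \<open>I - B\<close>.\<close>

definition clade_families :: "'a set \<Rightarrow> 'a set set set" where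
  "clade_families I = Collect (laminar_family I)"

lemma shapes_eq_clades: "shapes l = clade_families {1..l}"
  unfolding shapes_def clade_families_def laminar_family_def by auto

lemma finite_clades: assumes "finite I" shows "finite (clade_families I)"
proof -
  have "clade_families I \<subseteq> Pow (Pow I)" unfolding clade_families_def laminar_family_def by blast
  then show ?thesis using assms finite_subset by blast
qed

lemma clade_families_subset: "H \<in> clade_families I \<Longrightarrow> H \<subseteq> Pow I" "H \<in> clade_families I \<Longrightarrow> I \<in> H" "H \<in> clade_families I \<Longrightarrow> {} \<notin> H"
  by (auto simp: clade_families_def laminar_family_def)

lemma finite_clade: "finite I \<Longrightarrow> H \<in> clade_families I \<Longrightarrow> finite H"
  using clade_families_subset(1) finite_subset by (metis finite_Pow_iff)

lemma clade_families_singleton: "clade_families {i} = {{{i}}}"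
proof -
  have "H = {{i}}" if "laminar_family {i} H" for H
    using that unfolding laminar_family_def by (auto simp: subset_singleton_iff)
  moreover have "laminar_family {i} {{i}}" unfolding laminar_family_def by auto
  ultimately have "laminar_family {i} H \<longleftrightarrow> H = {{i}}" for H by blast
  then show ?thesis unfolding clade_families_def by (intro set_eqI) simp
qed

text \<open>Two shapes on complementary leaf sets are grafted onto a new root edge, whose clade is
  the full set \<open>I\<close>.\<close>

lemma clade_families_join:
  assumes i: "i \<in> B" "B \<subset> I" and H1: "laminar_family B H1" and H2: "laminar_family (I - B) H2"
  shows "laminar_family I (insert I (H1 \<union> H2))"
proof -
  note 1 = H1[unfolded laminar_family_def] and 2 = H2[unfolded laminar_family_def]
  have s: "A \<subseteq> B" "A \<noteq> {}" if "A \<in> H1" for A using that 1 by auto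
  have t: "A \<subseteq> I - B" "A \<noteq> {}" if "A \<in> H2" for A using that 2 by auto
  show ?thesis
    unfolding laminar_family_def
  proof (intro conjI ballI impI)
    show "insert I (H1 \<union> H2) \<subseteq> Pow I - {{}}" using s t i by blast
    show "I \<in> insert I (H1 \<union> H2)" by simp
    fix k assume "k \<in> I"
    have "\<forall>k\<in>B. {k} \<in> H1" "\<forall>k\<in>I - B. {k} \<in> H2" using 1 2 by simp_all
    then show "{k} \<in> insert I (H1 \<union> H2)" using \<open>k \<in> I\<close> by (cases "k \<in> B") simp_all
  next
    fix A C assume A: "A \<in> insert I (H1 \<union> H2)" and C: "C \<in> insert I (H1 \<union> H2)"
    have "A \<subseteq> C \<or> C \<subseteq> A \<or> A \<inter> C = {}" if "A \<in> H1" "C \<in> H1" using that 1 by blast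
    moreover have "A \<subseteq> C \<or> C \<subseteq> A \<or> A \<inter> C = {}" if "A \<in> H2" "C \<in> H2" using that 2 by blast
    moreover have "A \<inter> C = {}" if "A \<in> H1" "C \<in> H2" using s(1)[OF that(1)] t(1)[OF that(2)] by blast
    moreover have "A \<inter> C = {}" if "A \<in> H2" "C \<in> H1" using t(1)[OF that(1)] s(1)[OF that(2)] by blast
    moreover have "A \<subseteq> I" "C \<subseteq> I" using A C s(1) t(1) i(2) by blast+
    ultimately show "A \<subseteq> C \<or> C \<subseteq> A \<or> A \<inter> C = {}" using A C by (elim insertE UnE) simp_all
  next
    fix A assume A: "A \<in> insert I (H1 \<union> H2)" "2 \<le> card A"
    consider "A = I" | "A \<in> H1" | "A \<in> H2" using A by auto
    then show "\<exists>B\<in>insert I (H1 \<union> H2). \<exists>C\<in>insert I (H1 \<union> H2). B \<inter> C = {} \<and> B \<union> C = A \<and> B \<noteq> A \<and> C \<noteq> A"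
    proof cases
      case 1
      have "B \<in> H1" "I - B \<in> H2" using H1 H2 unfolding laminar_family_def by auto
      moreover have "B \<inter> (I - B) = {}" "B \<union> (I - B) = A" "B \<noteq> A" "I - B \<noteq> A" using i 1 by auto
      ultimately show ?thesis by (intro bexI[of _ B] bexI[of _ "I - B"]) simp_all
    next
      case 2
      then obtain B' C' where "B' \<in> H1" "C' \<in> H1" "B' \<inter> C' = {}" "B' \<union> C' = A" "B' \<noteq> A" "C' \<noteq> A"
        using A(2) H1 unfolding laminar_family_def by meson
      then show ?thesis by (intro bexI[of _ B'] bexI[of _ C']) simp_all
    next
      case 3
      then obtain B' C' where "B' \<in> H2" "C' \<in> H2" "B' \<inter> C' = {}" "B' \<union> C' = A" "B' \<noteq> A" "C' \<noteq> A"
        using A(2) H2 unfolding laminar_family_def by meson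
      then show ?thesis by (intro bexI[of _ B'] bexI[of _ C']) simp_all
    qed
  qed
qed

lemma laminar_familyD:
  assumes "laminar_family I H"
  shows "A \<in> H \<Longrightarrow> A \<subseteq> I" "A \<in> H \<Longrightarrow> A \<noteq> {}" "I \<in> H" "k \<in> I \<Longrightarrow> {k} \<in> H"
    "A \<in> H \<Longrightarrow> B \<in> H \<Longrightarrow> A \<subseteq> B \<or> B \<subseteq> A \<or> A \<inter> B = {}"
    "A \<in> H \<Longrightarrow> 2 \<le> card A \<Longrightarrow> \<exists>B\<in>H. \<exists>C\<in>H. B \<inter> C = {} \<and> B \<union> C = A \<and> B \<noteq> A \<and> C \<noteq> A"
proof -
  note h0 = assms[unfolded laminar_family_def]
  note h = conjunct1[OF h0] conjunct1[OF conjunct2[OF h0]] conjunct1[OF conjunct2[OF conjunct2[OF h0]]]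
    conjunct1[OF conjunct2[OF conjunct2[OF conjunct2[OF h0]]]] conjunct2[OF conjunct2[OF conjunct2[OF conjunct2[OF h0]]]]
  show "A \<in> H \<Longrightarrow> A \<subseteq> I" "A \<in> H \<Longrightarrow> A \<noteq> {}" using h(1) by auto
  show "I \<in> H" by (rule h(2))
  show "k \<in> I \<Longrightarrow> {k} \<in> H" using h(3) by (rule bspec)
  show "A \<in> H \<Longrightarrow> B \<in> H \<Longrightarrow> A \<subseteq> B \<or> B \<subseteq> A \<or> A \<inter> B = {}" using h(4) by simp
  show "A \<in> H \<Longrightarrow> 2 \<le> card A \<Longrightarrow> \<exists>B\<in>H. \<exists>C\<in>H. B \<inter> C = {} \<and> B \<union> C = A \<and> B \<noteq> A \<and> C \<noteq> A"
    using h(5) by simp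
qed

lemma laminar_family_restrict:
  assumes H: "laminar_family I H" and B: "B \<in> H"
  shows "laminar_family B {A \<in> H. A \<subseteq> B}"
  unfolding laminar_family_def
proof (intro conjI ballI impI)
  show "{A \<in> H. A \<subseteq> B} \<subseteq> Pow B - {{}}" using laminar_familyD(2)[OF H] by auto
  show "B \<in> {A \<in> H. A \<subseteq> B}" using B by simp
  fix k assume "k \<in> B"
  then show "{k} \<in> {A \<in> H. A \<subseteq> B}" using laminar_familyD(4)[OF H, of k] laminar_familyD(1)[OF H B] by auto
next
  fix A C assume "A \<in> {A \<in> H. A \<subseteq> B}" "C \<in> {A \<in> H. A \<subseteq> B}"
  then show "A \<subseteq> C \<or> C \<subseteq> A \<or> A \<inter> C = {}" using laminar_familyD(5)[OF H, of A C] by simp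
next
  fix A assume A: "A \<in> {A \<in> H. A \<subseteq> B}" "2 \<le> card A"
  then obtain B' C' where "B' \<in> H" "C' \<in> H" "B' \<inter> C' = {}" "B' \<union> C' = A" "B' \<noteq> A" "C' \<noteq> A"
    using laminar_familyD(6)[OF H, of A] by auto
  moreover from this A have "B' \<subseteq> B" "C' \<subseteq> B" by auto
  ultimately show "\<exists>B'\<in>{A \<in> H. A \<subseteq> B}. \<exists>C\<in>{A \<in> H. A \<subseteq> B}. B' \<inter> C = {} \<and> B' \<union> C = A \<and> B' \<noteq> A \<and> C \<noteq> A"
    by (intro bexI[of _ B'] bexI[of _ C']) simp_all
qed

text \<open>The root edge \<open>I\<close> branches into two clades. Calling \<open>B\<close> the
  one that contains \<open>i\<close> fixes their order, which is needed for a decomposition without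
  double counting.\<close>

lemma laminar_family_split:
  assumes H: "laminar_family I H" and i: "i \<in> I" and c: "2 \<le> card I"
  obtains B where "i \<in> B" "B \<subset> I" "B \<in> H" "I - B \<in> H"
    "H = insert I ({A \<in> H. A \<subseteq> B} \<union> {A \<in> H. A \<subseteq> I - B})"
proof -
  obtain B0 C0 where BC0: "B0 \<in> H" "C0 \<in> H" "B0 \<inter> C0 = {}" "B0 \<union> C0 = I" "B0 \<noteq> I" "C0 \<noteq> I"
    using laminar_familyD(6)[OF H laminar_familyD(3)[OF H] c] by auto
  have "\<exists>B C. i \<in> B \<and> B \<in> H \<and> C \<in> H \<and> B \<inter> C = {} \<and> B \<union> C = I \<and> B \<noteq> I \<and> C \<noteq> I"
  proof (cases "i \<in> B0")
    case True then show ?thesis using BC0 by (intro exI[of _ B0] exI[of _ C0]) simp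
  next
    case False
    then have "i \<in> C0" using BC0(4) i by blast
    moreover have "C0 \<inter> B0 = {}" "C0 \<union> B0 = I" using BC0 by auto
    ultimately show ?thesis using BC0 by (intro exI[of _ C0] exI[of _ B0]) simp
  qed
  then obtain B C where BC: "i \<in> B" "B \<in> H" "C \<in> H" "B \<inter> C = {}" "B \<union> C = I" "B \<noteq> I" "C \<noteq> I" by auto
  then have C: "C = I - B" by blast
  \<comment> \<open>A proper clade \<open>A\<close> that meets both \<open>B\<close> and
    \<open>I - B\<close> is contained in neither; by laminarity it would contain both and hence be
    \<open>I\<close>.\<close>
  have ex: "A \<subseteq> B \<or> A \<subseteq> I - B" if A: "A \<in> H" "A \<noteq> I" for A
  proof (rule ccontr)
    assume n: "\<not> (A \<subseteq> B \<or> A \<subseteq> I - B)"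
    have AI: "A \<subseteq> I" by (rule laminar_familyD(1)[OF H A(1)])
    have "B \<subseteq> A" using n AI laminar_familyD(5)[OF H A(1) BC(2)] by blast
    moreover have "I - B \<subseteq> A" using n AI laminar_familyD(5)[OF H A(1) BC(3)] unfolding C by blast
    ultimately show False using A(2) AI by blast
  qed
  have "H = insert I ({A \<in> H. A \<subseteq> B} \<union> {A \<in> H. A \<subseteq> I - B})"
    using ex laminar_familyD(3)[OF H] by (intro set_eqI) auto
  moreover have "B \<subset> I" "I - B \<in> H" using BC C by auto
  ultimately show ?thesis using that BC(1,2) by simp
qed

text \<open>A shape with at least two leaves is its root edge together with an unordered pair of
  shapes on complementary leaf sets. The condition that \<open>i\<close> lies in \<open>B\<close>
  orders the pair, so each shape arises exactly once.\<close>

lemma clade_families_bij: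
  assumes i: "i \<in> I" and c: "2 \<le> card I"
  shows "bij_betw (\<lambda>(B,H1,H2). insert I (H1 \<union> H2))
    (SIGMA B:{B. i \<in> B \<and> B \<subset> I}. clade_families B \<times> clade_families (I - B)) (clade_families I)"
  unfolding bij_betw_def
proof
  let ?S = "SIGMA B:{B. i \<in> B \<and> B \<subset> I}. clade_families B \<times> clade_families (I - B)"
  let ?j = "\<lambda>(B,H1,H2). insert I (H1 \<union> H2)"
  have sub: "H1 = {A \<in> insert I (H1 \<union> H2). A \<subseteq> B}" "H2 = {A \<in> insert I (H1 \<union> H2). A \<subseteq> I - B}"
    if "i \<in> B" "B \<subset> I" "H1 \<in> clade_families B" "H2 \<in> clade_families (I - B)" for B H1 H2
  proof -
    have 1: "A \<subseteq> B" "A \<noteq> {}" if "A \<in> H1" for A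
      using clade_families_subset[OF \<open>H1 \<in> clade_families B\<close>] that by auto
    have 2: "A \<subseteq> I - B" "A \<noteq> {}" if "A \<in> H2" for A
      using clade_families_subset[OF \<open>H2 \<in> clade_families (I - B)\<close>] that by auto
    have 3: "\<not> A \<subseteq> I - B" if "A \<in> H1" for A using 1[OF that] by blast
    have 4: "\<not> A \<subseteq> B" if "A \<in> H2" for A using 2[OF that] by blast
    have 5: "\<not> I \<subseteq> B" "\<not> I \<subseteq> I - B" using \<open>i \<in> B\<close> \<open>B \<subset> I\<close> by blast+
    show "H1 = {A \<in> insert I (H1 \<union> H2). A \<subseteq> B}" using 1(1) 4 5(1) by (intro set_eqI) auto
    show "H2 = {A \<in> insert I (H1 \<union> H2). A \<subseteq> I - B}" using 2(1) 3 5(2) by (intro set_eqI) auto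
  qed
  \<comment> \<open>\<open>B\<close> is a clade of the second family as well. It contains
    \<open>i\<close>, so it cannot come from \<open>H2'\<close>, and it must lie below
    \<open>B'\<close>; by symmetry the two sets agree.\<close>
  have le: "B \<subseteq> B'" if "i \<in> B" "B \<subset> I" "H1 \<in> clade_families B" "H2 \<in> clade_families (I - B)"
     "i \<in> B'" "B' \<subset> I" "H1' \<in> clade_families B'" "H2' \<in> clade_families (I - B')"
     and e: "insert I (H1 \<union> H2) = insert I (H1' \<union> H2')" for B H1 H2 B' H1' H2'
  proof -
    have "B \<in> insert I (H1' \<union> H2')" using clade_families_subset(2)[OF that(3)] e by blast
    then have "B \<in> H1' \<union> H2'" using that by blast
    moreover have "B \<notin> H2'" using clade_families_subset(1)[OF that(8)] that(1,5) by blast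
    ultimately show ?thesis using clade_families_subset(1)[OF that(7)] by blast
  qed
  show "inj_on ?j ?S"
  proof (rule inj_onI)
    fix x y assume x: "x \<in> ?S" and y: "y \<in> ?S" and e: "?j x = ?j y"
    obtain B H1 H2 where x': "x = (B, H1, H2)" by (cases x)
    obtain B' H1' H2' where y': "y = (B', H1', H2')" by (cases y)
    have B: "i \<in> B" "B \<subset> I" "H1 \<in> clade_families B" "H2 \<in> clade_families (I - B)" using x x' by auto
    have B': "i \<in> B'" "B' \<subset> I" "H1' \<in> clade_families B'" "H2' \<in> clade_families (I - B')" using y y' by auto
    have e': "insert I (H1 \<union> H2) = insert I (H1' \<union> H2')" using e x' y' by simp
    have "B = B'" using le[OF B B' e'] le[OF B' B e'[symmetric]] by auto
    moreover have "H1 = H1'" using sub(1)[OF B] sub(1)[OF B'] e' \<open>B = B'\<close> by simp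
    moreover have "H2 = H2'" using sub(2)[OF B] sub(2)[OF B'] e' \<open>B = B'\<close> by simp
    ultimately show "x = y" using x' y' by simp
  qed
  show "?j ` ?S = clade_families I"
  proof (intro set_eqI iffI)
    fix H assume "H \<in> ?j ` ?S"
    then show "H \<in> clade_families I" using clade_families_join[of i _ I] by (auto simp: clade_families_def)
  next
    fix H assume "H \<in> clade_families I"
    then have H: "laminar_family I H" by (simp add: clade_families_def)
    obtain B where B: "i \<in> B" "B \<subset> I" "B \<in> H" "I - B \<in> H"
      "H = insert I ({A \<in> H. A \<subseteq> B} \<union> {A \<in> H. A \<subseteq> I - B})"
      using laminar_family_split[OF H i c] .
    then have "(B, {A \<in> H. A \<subseteq> B}, {A \<in> H. A \<subseteq> I - B}) \<in> ?S"
      using laminar_family_restrict[OF H] by (auto simp: clade_families_def)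
    then show "H \<in> ?j ` ?S" using B(5) by (intro image_eqI[of _ _ "(B, {A \<in> H. A \<subseteq> B}, {A \<in> H. A \<subseteq> I - B})"]) auto
  qed
qed

lemma clade_families_disjoint:
  assumes "B \<subset> I" "B \<noteq> {}" "H1 \<in> clade_families B" "H2 \<in> clade_families (I - B)"
  shows "H1 \<inter> H2 = {}" "I \<notin> H1 \<union> H2"
proof -
  have 1: "A \<subseteq> B" "A \<noteq> {}" if "A \<in> H1" for A using clade_families_subset[OF assms(3)] that by auto
  have 2: "A \<subseteq> I - B" if "A \<in> H2" for A using clade_families_subset[OF assms(4)] that by auto
  have "A \<notin> H2" if "A \<in> H1" for A using 1[OF that] 2[of A] by blast
  then show "H1 \<inter> H2 = {}" by blast
  have "I \<notin> H1" using 1(1)[of I] assms(1) by blast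
  moreover have "I \<notin> H2" using 2[of I] assms(1,2) by blast
  ultimately show "I \<notin> H1 \<union> H2" by simp
qed

text \<open>The decomposition at the root gives \<open>1 + (2 * a - 1) + (2 * b - 1)\<close> edges
  for \<open>a + b\<close> leaves. This number determines the power of \<open>sqrt n\<close> in the
  normalisation.\<close>

lemma card_clade:
  "finite I \<Longrightarrow> I \<noteq> {} \<Longrightarrow> H \<in> clade_families I \<Longrightarrow> card H = 2 * card I - 1"
proof (induction "card I" arbitrary: I H rule: less_induct)
  case less
  obtain i where i: "i \<in> I" using less by auto
  show ?case
  proof (cases "2 \<le> card I")
    case False
    then have "card I = 1" using less.prems by (metis One_nat_def Suc_1 card_gt_0_iff less_2_cases_iff neq0_conv not_le)
    then obtain j where "I = {j}" by (auto simp: card_1_singleton_iff)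
    then show ?thesis using less.prems by (simp add: clade_families_singleton)
  next
    case True
    have "H \<in> (\<lambda>(B,H1,H2). insert I (H1 \<union> H2)) ` (SIGMA B:{B. i \<in> B \<and> B \<subset> I}. clade_families B \<times> clade_families (I - B))"
      using bij_betw_imp_surj_on[OF clade_families_bij[OF i True]] less.prems(3) by simp
    then obtain B H1 H2 where
      B: "i \<in> B" "B \<subset> I" "H1 \<in> clade_families B" "H2 \<in> clade_families (I - B)" and H: "H = insert I (H1 \<union> H2)"
      by (elim imageE SigmaE) auto
    have finite_indicator: "finite B" "finite (I - B)" using B less.prems finite_subset by auto
    have "card B < card I" using B less.prems by (simp add: psubset_card_mono)
    moreover have "card (I - B) < card I" using B less.prems i by (intro psubset_card_mono) auto
    ultimately have "card H1 = 2 * card B - 1" "card H2 = 2 * card (I - B) - 1"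
      using less.hyps[OF _ finite_indicator(1) _ B(3)] less.hyps[OF _ finite_indicator(2) _ B(4)] B by auto
    moreover have "B \<noteq> {}" using B(1) by blast
    then have "card H = Suc (card H1 + card H2)"
      using clade_families_disjoint[OF B(2) _ B(3,4)] B(1) finite_indicator finite_clade[OF finite_indicator(1) B(3)] finite_clade[OF finite_indicator(2) B(4)]
      by (auto simp: H card_insert_if card_Un_disjoint)
    moreover have "card B > 0" "card (I - B) > 0" using B finite_indicator by (auto simp only: card_gt_0_iff)
    moreover have "card I = card B + card (I - B)"
      using B finite_indicator less.prems(1) card_mono[of I B] by (simp add: card_Diff_subset psubset_imp_subset)
    ultimately show ?thesis by simp
  qed
qed

text \<open>The leading part of the recursion for skeletons, with every step factor at a branching
  replaced by \<open>1\<close>; the sum over shapes solves it exactly.\<close>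

lemma sum_clades:
  fixes f :: "'a set \<Rightarrow> 'c::comm_semiring_1"
  assumes "finite I" and i: "i \<in> I" and c: "2 \<le> card I"
  shows "(\<Sum>H\<in>clade_families I. \<Prod>A\<in>H. f A) = f I * (\<Sum>B\<in>{B. i \<in> B \<and> B \<subset> I}.
     (\<Sum>H\<in>clade_families B. \<Prod>A\<in>H. f A) * (\<Sum>H\<in>clade_families (I - B). \<Prod>A\<in>H. f A))"
proof -
  let ?T = "{B. i \<in> B \<and> B \<subset> I}"
  have fT: "finite ?T" by (rule finite_subset[of _ "Pow I"]) (use assms in auto)
  have fB: "finite B" if "B \<in> ?T" for B using that assms finite_subset by auto
  have "(\<Sum>H\<in>clade_families I. \<Prod>A\<in>H. f A)
    = (\<Sum>(B,H1,H2)\<in>(SIGMA B:?T. clade_families B \<times> clade_families (I - B)). \<Prod>A\<in>insert I (H1 \<union> H2). f A)"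
    using sum.reindex_bij_betw[OF clade_families_bij[OF i c], of "\<lambda>H. \<Prod>A\<in>H. f A"] by (simp add: split_def)
  also have "\<dots> = (\<Sum>(B,H1,H2)\<in>(SIGMA B:?T. clade_families B \<times> clade_families (I - B)). f I * ((\<Prod>A\<in>H1. f A) * (\<Prod>A\<in>H2. f A)))"
  proof (rule sum.cong[OF refl])
    fix x assume "x \<in> (SIGMA B:?T. clade_families B \<times> clade_families (I - B))"
    then obtain B H1 H2 where x: "x = (B, H1, H2)"
      and B: "i \<in> B" "B \<subset> I" "H1 \<in> clade_families B" "H2 \<in> clade_families (I - B)" by auto
    have "finite H1" "finite H2" using B assms finite_clade finite_subset by (metis psubset_imp_subset, metis finite_Diff)
    moreover have "B \<noteq> {}" using B(1) by blast
    ultimately have "(\<Prod>A\<in>insert I (H1 \<union> H2). f A) = f I * ((\<Prod>A\<in>H1. f A) * (\<Prod>A\<in>H2. f A))"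
      using clade_families_disjoint[OF B(2) _ B(3,4)] by (simp add: prod.union_disjoint)
    then show "(case x of (B, H1, H2) \<Rightarrow> \<Prod>A\<in>insert I (H1 \<union> H2). f A) =
        (case x of (B, H1, H2) \<Rightarrow> f I * ((\<Prod>A\<in>H1. f A) * (\<Prod>A\<in>H2. f A)))"
      by (simp only: x split_conv)
  qed
  also have "\<dots> = (\<Sum>B\<in>?T. \<Sum>(H1,H2)\<in>clade_families B \<times> clade_families (I - B). f I * ((\<Prod>A\<in>H1. f A) * (\<Prod>A\<in>H2. f A)))"
    using fT fB assms by (subst sum.Sigma) (auto simp: finite_clades split_def)
  also have "\<dots> = f I * (\<Sum>B\<in>?T. (\<Sum>H\<in>clade_families B. \<Prod>A\<in>H. f A) * (\<Sum>H\<in>clade_families (I - B). \<Prod>A\<in>H. f A))"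
    unfolding sum_product sum.cartesian_product unfolding sum_distrib_left split_def ..
  finally show ?thesis .
qed

text \<open>
  On the right-hand side of the recursion \<open>sk n I\<close> only occurs in the term \<open>B = I\<close>, so the recursion is solved by
  multiplication with \<open>geo (D n I)\<close>, the factor of the root edge of a shape.
\<close>

lemma skeleton_gf_asymp:
  fixes D :: "nat \<Rightarrow> 'a set \<Rightarrow> real" and sk :: "nat \<Rightarrow> 'a set \<Rightarrow> complex fps"
  defines "S \<equiv> \<lambda>n I. \<Sum>H\<in>clade_families I. \<Prod>A\<in>H. geo (D n A)"
  assumes J: "finite J"
    and sk0: "\<And>n. sk n {} = fps_X"
    and rec: "\<And>n I i. I \<subseteq> J \<Longrightarrow> i \<in> I \<Longrightarrow> sk n I = sk n (I - {i}) +
       (\<Sum>B\<in>{B. i \<in> B \<and> B \<subseteq> I}. fps_const (of_real (D n B)) * sk n B * sk n (I - B))"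
    and D: "\<forall>\<^sub>F n in sequentially. \<forall>B\<subseteq>J. 0 \<le> D n B \<and> D n B \<le> 1 \<and> 1 - D n B \<le> K / sqrt (real n)"
  shows "I \<subseteq> J \<Longrightarrow> I \<noteq> {} \<Longrightarrow> damped_bound (2 * card I - 2) (\<lambda>n. sk n I - S n I) \<and> damped_bound (2 * card I - 1) (\<lambda>n. S n I)"
proof (induction "card I" arbitrary: I rule: less_induct)
  case less
  have fI: "finite I" using J less.prems finite_subset by auto
  obtain i where i: "i \<in> I" using less by auto
  have geo1: "damped_bound 1 (\<lambda>n. geo (D n A))" if "A \<subseteq> J" for A
  proof -
    have "\<forall>\<^sub>F n in sequentially. damped_norm n (geo (D n A)) \<le> 2 * sqrt (real n) ^ 1"
      using D eventually_gt_at_top[of 0] by eventually_elim (use damped_norm_geo that in auto)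
    then show ?thesis unfolding damped_bound_def by blast
  qed
  have D0: "damped_bound 0 (\<lambda>n. fps_const (of_real (D n B)))" if "B \<subseteq> J" for B
  proof -
    have "\<forall>\<^sub>F n in sequentially. damped_norm n (fps_const (of_real (D n B))) \<le> 1 * sqrt (real n) ^ 0"
      using D by eventually_elim (use that in \<open>auto simp: damped_norm_const\<close>)
    then show ?thesis unfolding damped_bound_def by blast
  qed
  \<comment> \<open>The factor \<open>1 - D\<close>, of order \<open>1 / sqrt n\<close>, uses up the
    order of one edge factor. Replacing a step factor \<open>D\<close> by \<open>1\<close> thus
    costs one order.\<close>
  have D1: "damped_bound 0 (\<lambda>n. fps_const (of_real (1 - D n B)) * geo (D n A))" if "B \<subseteq> J" "A \<subseteq> J" for A B
  proof -
    have "\<forall>\<^sub>F n in sequentially. damped_norm n (fps_const (of_real (1 - D n B)) * geo (D n A)) \<le> (2 * K) * sqrt (real n) ^ 0"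
      using D eventually_gt_at_top[of 0]
    proof eventually_elim
      case (elim n)
      have d: "0 \<le> D n B" "D n B \<le> 1" "1 - D n B \<le> K / sqrt (real n)" using elim that by auto
      have "damped_norm n (fps_const (of_real (1 - D n B)) * geo (D n A)) \<le> norm (complex_of_real (1 - D n B)) * damped_norm n (geo (D n A))"
        using damped_norm_mult[of n "fps_const (of_real (1 - D n B))" "geo (D n A)"] by (simp only: damped_norm_const)
      also have "\<dots> \<le> (K / sqrt (real n)) * (2 * sqrt (real n))"
        using elim that damped_norm_geo[of n "D n A"] d damped_norm_nonneg[of n "geo (D n A)"]
        by (intro mult_mono) (auto simp only: norm_of_real abs_le_iff)
      also have "\<dots> = 2 * K" using elim(2) by simp
      finally show ?case by simp
    qed
    then show ?thesis unfolding damped_bound_def by blast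
  qed
  let ?T = "{B. i \<in> B \<and> B \<subset> I}"
  have fT: "finite ?T" by (rule finite_subset[of _ "Pow I"]) (use fI in auto)
  have T: "{B. i \<in> B \<and> B \<subseteq> I} = insert I ?T" using i by auto
  have sol: "sk n I = geo (D n I) * (sk n (I - {i}) + (\<Sum>B\<in>?T. fps_const (of_real (D n B)) * sk n B * sk n (I - B)))" for n
  proof -
    let ?R = "sk n (I - {i}) + (\<Sum>B\<in>?T. fps_const (of_real (D n B)) * sk n B * sk n (I - B))"
    have "sk n I = ?R + fps_const (of_real (D n I)) * sk n I * fps_X"
      using rec[OF less.prems(1) i, of n] fT unfolding T by (simp add: sk0 add_ac)
    then have "(1 - fps_const (of_real (D n I)) * fps_X) * sk n I = ?R"
      by (simp add: algebra_simps)
    then have "geo (D n I) * ?R = geo (D n I) * ((1 - fps_const (of_real (D n I)) * fps_X) * sk n I)" by (simp only:)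
    also have "\<dots> = ((1 - fps_const (of_real (D n I)) * fps_X) * geo (D n I)) * sk n I" by (simp only: mult_ac)
    also have "\<dots> = sk n I" by (simp only: geo_inverse mult_1)
    finally show ?thesis by (rule sym)
  qed
  show ?case
  proof (cases "2 \<le> card I")
    case False
    then have "card I = 1" using less.prems fI by (metis One_nat_def Suc_1 card_gt_0_iff less_2_cases_iff neq0_conv not_le)
    then have I: "I = {i}" using i by (auto simp: card_1_singleton_iff)
    have e: "?T = {}" using I by auto
    have S: "S n I = geo (D n I)" for n unfolding S_def I by (simp add: clade_families_singleton)
    \<comment> \<open>For a single leaf the skeleton is \<open>geo D\<close> times
      \<open>fps_X\<close>. By \<open>geo_eq\<close>, replacing this \<open>fps_X\<close> by
      \<open>1\<close> changes it by \<open>(1 - D) * geo D * fps_X - 1\<close>, which is bounded in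
      the damped norm.\<close>
    have "sk n I - S n I = fps_const (of_real (1 - D n I)) * geo (D n I) * fps_X - 1" for n
    proof -
      have g: "geo (D n I) = 1 + fps_const (of_real (D n I)) * fps_X * geo (D n I)" by (rule geo_eq)
      have "sk n I - S n I = geo (D n I) * fps_X - geo (D n I)"
        unfolding sol[of n] e by (simp add: I sk0 S[unfolded I])
      also have "\<dots> = geo (D n I) * fps_X - (1 + fps_const (of_real (D n I)) * fps_X * geo (D n I))"
        using g by simp
      also have "\<dots> = (1 - fps_const (of_real (D n I))) * geo (D n I) * fps_X - 1"
        by (simp add: algebra_simps)
      also have "1 - fps_const (complex_of_real (D n I)) = fps_const (of_real (1 - D n I))"
        by (simp flip: fps_const_sub)
      finally show ?thesis .
    qed
    moreover have "damped_bound 0 (\<lambda>n. fps_const (of_real (1 - D n I)) * geo (D n I) * fps_X - 1)"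
      using damped_bound_diff[OF damped_bound_mult[OF D1[OF less.prems(1) less.prems(1)] damped_bound_X] ] damped_bound_1 by auto
    ultimately show ?thesis using geo1[OF less.prems(1)] by (simp add: \<open>card I = 1\<close> S)
  next
    case True
    have IH: "damped_bound (2 * card B - 2) (\<lambda>n. sk n B - S n B)" "damped_bound (2 * card B - 1) (\<lambda>n. S n B)" "damped_bound (2 * card B - 1) (\<lambda>n. sk n B)"
      if "B \<subset> I" "B \<noteq> {}" for B
    proof -
      have "card B < card I" using that fI by (simp add: psubset_card_mono)
      from less.hyps[OF this] that less.prems
      show 1: "damped_bound (2 * card B - 2) (\<lambda>n. sk n B - S n B)" "damped_bound (2 * card B - 1) (\<lambda>n. S n B)" by auto
      show "damped_bound (2 * card B - 1) (\<lambda>n. sk n B)" using damped_bound_add[OF damped_bound_mono[OF 1(1), of "2 * card B - 1"] 1(2)] by simp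
    qed
    have cards: "card I = card B + card (I - B)" "card B > 0" "card (I - B) > 0" "B \<noteq> {}" "I - B \<noteq> {}" "I - B \<subset> I" "B \<subset> I" "B \<subseteq> J"
      if "B \<in> ?T" for B
    proof -
      have fB: "finite B" using that fI finite_subset[of B I] by auto
      show "B \<noteq> {}" "I - B \<noteq> {}" "I - B \<subset> I" "B \<subset> I" "B \<subseteq> J" using that less.prems by auto
      then show "card B > 0" "card (I - B) > 0" using fB fI by (auto simp only: card_gt_0_iff finite_Diff)
      show "card I = card B + card (I - B)"
        using that fB fI card_mono[of I B] by (simp add: card_Diff_subset psubset_imp_subset)
    qed
    have SI: "S n I = geo (D n I) * (\<Sum>B\<in>?T. S n B * S n (I - B))" for n
      unfolding S_def by (rule sum_clades[OF fI i True])
    \<comment> \<open>One factor is exchanged at a time: first \<open>sk n B\<close> for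
      \<open>S n B\<close>, then \<open>sk n (I - B)\<close> for \<open>S n (I - B)\<close>, and
      last the step factor \<open>D n B\<close> for \<open>1\<close>. Each exchange loses one power
      of \<open>sqrt n\<close>.\<close>
    have "sk n I - S n I = geo (D n I) * sk n (I - {i}) +
      (\<Sum>B\<in>?T. geo (D n I) * fps_const (of_real (D n B)) * ((sk n B - S n B) * sk n (I - B)) +
               geo (D n I) * fps_const (of_real (D n B)) * (S n B * (sk n (I - B) - S n (I - B))) -
               (fps_const (of_real (1 - D n B)) * geo (D n I)) * (S n B * S n (I - B)))" for n
    proof -
      have c: "fps_const (complex_of_real (1 - D n B)) = 1 - fps_const (complex_of_real (D n B))" for B
        by (simp flip: fps_const_sub)
      have "geo (D n I) * fps_const (of_real (D n B)) * ((sk n B - S n B) * sk n (I - B)) +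
               geo (D n I) * fps_const (of_real (D n B)) * (S n B * (sk n (I - B) - S n (I - B))) -
               (fps_const (of_real (1 - D n B)) * geo (D n I)) * (S n B * S n (I - B))
         = geo (D n I) * (fps_const (of_real (D n B)) * sk n B * sk n (I - B)) - geo (D n I) * (S n B * S n (I - B))" for B
        unfolding c by (simp add: algebra_simps)
      then show ?thesis
        unfolding sol[of n] SI[of n] by (simp only: sum_subtractf sum_distrib_left[symmetric] distrib_left add_diff_eq)
    qed
    \<comment> \<open>The mark \<open>i\<close> sits on the path to the other marks. The order is
      only \<open>1 + (2 * (card I - 1) - 1)\<close>, one less than that of the leading
      term.\<close>
    moreover have "damped_bound (2 * card I - 2) (\<lambda>n. geo (D n I) * sk n (I - {i}))"
    proof -
      have "I - {i} \<subset> I" "I - {i} \<noteq> {}" using i True by (auto dest: card_mono[of "{i}", rotated])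
      from IH(3)[OF this] have "damped_bound (1 + (2 * card (I - {i}) - 1)) (\<lambda>n. geo (D n I) * sk n (I - {i}))"
        using geo1 less.prems by (intro damped_bound_mult) auto
      then show ?thesis by (rule damped_bound_mono) (use i fI True in auto)
    qed
    moreover have "damped_bound (2 * card I - 2) (\<lambda>n. geo (D n I) * fps_const (of_real (D n B)) * ((sk n B - S n B) * sk n (I - B)) +
               geo (D n I) * fps_const (of_real (D n B)) * (S n B * (sk n (I - B) - S n (I - B))) -
               (fps_const (of_real (1 - D n B)) * geo (D n I)) * (S n B * S n (I - B)))" if B: "B \<in> ?T" for B
    proof -
      note c = cards[OF B]
      note b = IH[OF c(7) c(4)] and b' = IH[OF c(6) c(5)]
      have g: "damped_bound (1 + 0) (\<lambda>n. geo (D n I) * fps_const (of_real (D n B)))"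
        using geo1 D0 less.prems c by (intro damped_bound_mult) auto
      show ?thesis
        using c by (intro damped_bound_diff damped_bound_add damped_bound_mono[OF damped_bound_mult[OF g damped_bound_mult[OF b(1) b'(3)]]]
          damped_bound_mono[OF damped_bound_mult[OF g damped_bound_mult[OF b(2) b'(1)]]]
          damped_bound_mono[OF damped_bound_mult[OF D1[OF c(8) less.prems(1)] damped_bound_mult[OF b(2) b'(2)]]]) auto
    qed
    ultimately have 1: "damped_bound (2 * card I - 2) (\<lambda>n. sk n I - S n I)"
      by (simp only:) (intro damped_bound_add damped_bound_sum fT)
    have "damped_bound (2 * card I - 2) (\<lambda>n. \<Sum>B\<in>?T. S n B * S n (I - B))"
    proof (rule damped_bound_sum[OF fT])
      fix B assume B: "B \<in> ?T"
      note c = cards[OF B]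
      show "damped_bound (2 * card I - 2) (\<lambda>n. S n B * S n (I - B))"
        using c by (intro damped_bound_mono[OF damped_bound_mult[OF IH(2)[OF c(7) c(4)] IH(2)[OF c(6) c(5)]]]) auto
    qed
    from damped_bound_mult[OF geo1[OF less.prems(1)] this] have "damped_bound (2 * card I - 1) (\<lambda>n. S n I)"
      unfolding SI by (rule damped_bound_mono) (use True in auto)
    with 1 show ?thesis by blast
  qed
qed


section \<open>Riemann sums over edge lengths\<close>

abbreviation half_line :: "real measure" where "half_line \<equiv> restrict_space lborel {0..}"

lemma sigma_finite_half_line: "sigma_finite_measure half_line"
  by (rule sigma_finite_measure_restrict_space) (auto intro: sigma_finite_lborel)

interpretation half_line: product_sigma_finite "\<lambda>_::'i. half_line"
  unfolding product_sigma_finite_def using sigma_finite_half_line by simp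

text \<open>Edge lengths are measured in units of \<open>sqrt n\<close>: the half line is cut into
  cells of length \<open>1 / sqrt n\<close>, and cell \<open>a\<close> stands for a path of
  \<open>a\<close> steps.\<close>

definition cellnum :: "nat \<Rightarrow> real \<Rightarrow> nat" where
  "cellnum n t = nat \<lfloor>sqrt (real n) * t\<rfloor>"

lemma cellnum_measurable [measurable]: "cellnum n \<in> measurable half_line (count_space UNIV)"
  unfolding cellnum_def by (intro measurable_restrict_space1) measurable

lemma cellnum_bounds:
  assumes "t \<ge> 0"
  shows "real (cellnum n t) \<le> sqrt n * t" "sqrt n * t - 1 < real (cellnum n t)"
  using assms by (auto simp: cellnum_def of_nat_nat)

lemma nn_integral_cellnum:
  fixes f :: "nat \<Rightarrow> ennreal"
  assumes n: "n > 0" and f: "\<And>a. a > N \<Longrightarrow> f a = 0"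
  shows "(\<integral>\<^sup>+t. f (cellnum n t) \<partial>half_line) = ennreal (1 / sqrt n) * (\<Sum>a\<le>N. f a)"
proof -
  let ?s = "sqrt (real n)"
  have s: "?s > 0" using n by simp
  have cell: "emeasure half_line {t \<in> space half_line. cellnum n t = a} = ennreal (1 / ?s)" for a
  proof -
    have e: "{t \<in> space half_line. cellnum n t = a} = {a / ?s ..< (a + 1) / ?s}"
    proof (intro set_eqI)
      fix t
      have "cellnum n t = a \<longleftrightarrow> a / ?s \<le> t \<and> t < (a + 1) / ?s" if "t \<ge> 0"
      proof -
        have "0 \<le> ?s * t" using that s by simp
        then have "cellnum n t = a \<longleftrightarrow> \<lfloor>?s * t\<rfloor> = int a" unfolding cellnum_def by (auto simp: nat_eq_iff)
        also have "\<dots> \<longleftrightarrow> real a \<le> ?s * t \<and> ?s * t < real a + 1" by (simp add: floor_eq_iff)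
        finally show ?thesis using s by (simp add: pos_divide_le_eq pos_less_divide_eq mult.commute add.commute)
      qed
      moreover have "t \<ge> 0" if "a / ?s \<le> t" using that s by (meson divide_nonneg_pos of_nat_0_le_iff order_trans)
      ultimately show "t \<in> {t \<in> space half_line. cellnum n t = a} \<longleftrightarrow> t \<in> {a / ?s ..< (a + 1) / ?s}"
        by (auto simp: space_restrict_space)
    qed
    have "{a / ?s ..< (a + 1) / ?s} \<subseteq> {0..}" using s by (auto intro: order_trans[rotated])
    then have "emeasure half_line {a / ?s ..< (a + 1) / ?s} = emeasure lborel {a / ?s ..< (a + 1) / ?s}"
      by (intro emeasure_restrict_space) auto
    also have "\<dots> = ennreal (1 / ?s)" using s by (simp add: divide_right_mono diff_divide_distrib[symmetric])
    finally show ?thesis using e by simp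
  qed
  have "(\<integral>\<^sup>+t. f (cellnum n t) \<partial>half_line) = (\<integral>\<^sup>+t. (\<Sum>a\<le>N. f a * indicator {t \<in> space half_line. cellnum n t = a} t) \<partial>half_line)"
  proof (rule nn_integral_cong)
    fix t assume t: "t \<in> space half_line"
    have "(\<Sum>a\<le>N. f a * indicator {t \<in> space half_line. cellnum n t = a} t) = (\<Sum>a\<le>N. if a = cellnum n t then f a else 0)"
      using t by (intro sum.cong) (auto simp: indicator_def)
    also have "\<dots> = f (cellnum n t)" using f by (auto simp: not_le)
    finally show "f (cellnum n t) = (\<Sum>a\<le>N. f a * indicator {t \<in> space half_line. cellnum n t = a} t)" by simp
  qed
  also have "\<dots> = (\<Sum>a\<le>N. f a * ennreal (1 / ?s))"
  proof -
    have m: "{t \<in> space half_line. cellnum n t = a} \<in> sets half_line" for a by measurable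
    have "(\<lambda>t. f a * indicator {t \<in> space half_line. cellnum n t = a} t) \<in> borel_measurable half_line" for a
      using m by (intro borel_measurable_times_ennreal borel_measurable_indicator) auto
    then show ?thesis using m by (simp only: nn_integral_sum nn_integral_cmult_indicator cell)
  qed
  also have "\<dots> = ennreal (1 / ?s) * (\<Sum>a\<le>N. f a)"
    by (rule trans[OF sum_distrib_right[symmetric] mult.commute])
  finally show ?thesis .
qed

text \<open>A real copy of \<open>geo\<close>: for \<open>D\<close> at least \<open>0\<close> its
  coefficients are nonnegative, so the sums can be handled as integrals of extended nonnegative
  functions.\<close>

definition rgeo :: "real \<Rightarrow> real fps" where "rgeo D = Abs_fps (\<lambda>m. D ^ m)"

lemma prod_geo_nth: "finite H \<Longrightarrow> (\<Prod>A\<in>H. geo (D A)) $$ m = of_real ((\<Prod>A\<in>H. rgeo (D A)) $$ m)"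
proof (induction H arbitrary: m rule: finite_induct)
  case empty then show ?case by simp
next
  case (insert A H)
  then show ?case by (simp add: fps_mult_nth geo_def rgeo_def)
qed

lemma prod_rgeo_nonneg: "finite H \<Longrightarrow> (\<And>A. A \<in> H \<Longrightarrow> 0 \<le> D A) \<Longrightarrow> 0 \<le> (\<Prod>A\<in>H. rgeo (D A)) $$ m"
proof (induction H arbitrary: m rule: finite_induct)
  case (insert A H)
  then show ?case by (auto simp: fps_mult_nth rgeo_def intro!: sum_nonneg mult_nonneg_nonneg)
qed simp

text \<open>The integrand is constant on the cells of the grid, so the integral is exactly a sum
  over cell numbers. Collecting the cells with total \<open>m\<close> produces the coefficient of
  \<open>x^m\<close> in the product of geometric series, by adding one edge at a time. The passage
  from sum to integral is therefore free of error, and all of the limit sits in the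
  integrand.\<close>

lemma riemann_sum_exact:
  fixes g :: "nat \<Rightarrow> ennreal"
  assumes n: "n > 0" and H: "finite H" and D: "\<And>A. A \<in> H \<Longrightarrow> 0 \<le> D A"
    and g: "\<And>a. a > N \<Longrightarrow> g a = 0"
  shows "(\<integral>\<^sup>+t. g (\<Sum>A\<in>H. cellnum n (t A)) * (\<Prod>A\<in>H. ennreal (D A ^ cellnum n (t A))) \<partial>PiM H (\<lambda>_. half_line))
     = ennreal (1 / sqrt n) ^ card H * (\<Sum>m\<le>N. ennreal ((\<Prod>A\<in>H. rgeo (D A)) $$ m) * g m)"
  using H D g
proof (induction H arbitrary: g rule: finite_induct)
  case empty
  have "(\<Sum>m\<le>N. ennreal ((1 :: real fps) $$ m) * g m) = (\<Sum>m\<le>N. if m = 0 then g 0 else 0)"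
    by (intro sum.cong) auto
  then show ?case by (simp add: PiM_empty nn_integral_count_space_finite)
next
  case (insert A H)
  let ?c = "\<lambda>m. (\<Prod>A\<in>H. rgeo (D A)) $$ m" and ?s = "ennreal (1 / sqrt n)"
  have c: "?c m \<ge> 0" for m using insert by (intro prod_rgeo_nonneg) auto
  have DA: "D A \<ge> 0" using insert by simp
  have [measurable]: "(\<lambda>t. cellnum n (t B)) \<in> measurable (PiM (insert A H) (\<lambda>_. half_line)) (count_space UNIV)" if "B \<in> insert A H" for B
    by (rule measurable_compose[OF measurable_component_singleton[OF that] cellnum_measurable])
  have [measurable]: "(\<lambda>t. g (\<Sum>B\<in>insert A H. cellnum n (t B)) * (\<Prod>B\<in>insert A H. ennreal (D B ^ cellnum n (t B))))
      \<in> borel_measurable (PiM (insert A H) (\<lambda>_. half_line))"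
  proof -
    have "(\<lambda>t. \<Sum>B\<in>insert A H. cellnum n (t B)) \<in> measurable (PiM (insert A H) (\<lambda>_. half_line)) (count_space UNIV)"
      by (rule measurable_sum_nat) simp
    then have "(\<lambda>t. g (\<Sum>B\<in>insert A H. cellnum n (t B))) \<in> borel_measurable (PiM (insert A H) (\<lambda>_. half_line))"
      by measurable
    moreover have "(\<lambda>t. \<Prod>B\<in>insert A H. ennreal (D B ^ cellnum n (t B))) \<in> borel_measurable (PiM (insert A H) (\<lambda>_. half_line))"
      by (intro borel_measurable_prod_ennreal) measurable
    ultimately show ?thesis by (rule borel_measurable_times_ennreal)
  qed
  have "(\<integral>\<^sup>+t. g (\<Sum>B\<in>insert A H. cellnum n (t B)) * (\<Prod>B\<in>insert A H. ennreal (D B ^ cellnum n (t B))) \<partial>PiM (insert A H) (\<lambda>_. half_line))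
    = (\<integral>\<^sup>+y. \<integral>\<^sup>+t. ennreal (D A ^ cellnum n y) *
        (g (cellnum n y + (\<Sum>B\<in>H. cellnum n (t B))) * (\<Prod>B\<in>H. ennreal (D B ^ cellnum n (t B)))) \<partial>PiM H (\<lambda>_. half_line) \<partial>half_line)"
  proof (subst half_line.product_nn_integral_insert_rev)
    have "(\<Sum>B\<in>insert A H. cellnum n ((t(A := y)) B)) = cellnum n y + (\<Sum>B\<in>H. cellnum n (t B))"
      "(\<Prod>B\<in>insert A H. ennreal (D B ^ cellnum n ((t(A := y)) B))) = ennreal (D A ^ cellnum n y) * (\<Prod>B\<in>H. ennreal (D B ^ cellnum n (t B)))" for t y
      using insert by (auto intro!: sum.cong arg_cong2[where f = "(*)"] prod.cong)
    then show "(\<integral>\<^sup>+y. \<integral>\<^sup>+t. g (\<Sum>B\<in>insert A H. cellnum n ((t(A := y)) B)) * (\<Prod>B\<in>insert A H. ennreal (D B ^ cellnum n ((t(A := y)) B))) \<partial>PiM H (\<lambda>_. half_line) \<partial>half_line)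
     = (\<integral>\<^sup>+y. \<integral>\<^sup>+t. ennreal (D A ^ cellnum n y) *
        (g (cellnum n y + (\<Sum>B\<in>H. cellnum n (t B))) * (\<Prod>B\<in>H. ennreal (D B ^ cellnum n (t B)))) \<partial>PiM H (\<lambda>_. half_line) \<partial>half_line)"
      by (simp only: mult_ac)
  qed (use insert in auto)
  also have "\<dots> = (\<integral>\<^sup>+y. ennreal (D A ^ cellnum n y) *
        (?s ^ card H * (\<Sum>m\<le>N. ennreal (?c m) * g (cellnum n y + m))) \<partial>half_line)"
  proof (rule nn_integral_cong)
    fix y
    have [measurable]: "(\<lambda>t. cellnum n (t B)) \<in> measurable (PiM H (\<lambda>_. half_line)) (count_space UNIV)" if "B \<in> H" for B
      by (rule measurable_compose[OF measurable_component_singleton[OF that] cellnum_measurable])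
    have "(\<lambda>t. \<Sum>B\<in>H. cellnum n (t B)) \<in> measurable (PiM H (\<lambda>_. half_line)) (count_space UNIV)"
      by (rule measurable_sum_nat) simp
    then have 1: "(\<lambda>t. g (cellnum n y + (\<Sum>B\<in>H. cellnum n (t B)))) \<in> borel_measurable (PiM H (\<lambda>_. half_line))"
      by measurable
    moreover have "(\<lambda>t. \<Prod>B\<in>H. ennreal (D B ^ cellnum n (t B))) \<in> borel_measurable (PiM H (\<lambda>_. half_line))"
      by (intro borel_measurable_prod_ennreal) measurable
    ultimately have "(\<lambda>t. g (cellnum n y + (\<Sum>B\<in>H. cellnum n (t B))) * (\<Prod>B\<in>H. ennreal (D B ^ cellnum n (t B)))) \<in> borel_measurable (PiM H (\<lambda>_. half_line))"
      by (rule borel_measurable_times_ennreal)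
    then show "(\<integral>\<^sup>+t. ennreal (D A ^ cellnum n y) *
        (g (cellnum n y + (\<Sum>B\<in>H. cellnum n (t B))) * (\<Prod>B\<in>H. ennreal (D B ^ cellnum n (t B)))) \<partial>PiM H (\<lambda>_. half_line))
      = ennreal (D A ^ cellnum n y) * (?s ^ card H * (\<Sum>m\<le>N. ennreal (?c m) * g (cellnum n y + m)))"
      by (subst nn_integral_cmult) (use insert.IH[of "\<lambda>m. g (cellnum n y + m)"] insert.prems in auto)
  qed
  also have "\<dots> = ?s * (\<Sum>a\<le>N. ennreal (D A ^ a) * (?s ^ card H * (\<Sum>m\<le>N. ennreal (?c m) * g (a + m))))"
    by (rule nn_integral_cellnum[OF n, where f = "\<lambda>a. ennreal (D A ^ a) * (?s ^ card H * (\<Sum>m\<le>N. ennreal (?c m) * g (a + m)))"])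
      (use insert.prems(2) in auto)
  also have "\<dots> = ?s ^ card (insert A H) * (\<Sum>a\<le>N. \<Sum>m\<le>N. ennreal (D A ^ a * ?c m) * g (a + m))"
    using insert.hyps DA c by (simp add: sum_distrib_left mult_ac ennreal_mult)
  also have "(\<Sum>a\<le>N. \<Sum>m\<le>N. ennreal (D A ^ a * ?c m) * g (a + m))
      = (\<Sum>(a,m)\<in>{..N} \<times> {..N}. ennreal (D A ^ a * ?c m) * g (a + m))"
    by (rule sum.cartesian_product)
  \<comment> \<open>The remaining pairs of the square have \<open>a + m > N\<close>, where
    \<open>g\<close> vanishes. On the triangle the sum becomes a Cauchy product.\<close>
  also have "\<dots> = (\<Sum>(a,m)\<in>{(a,m). a + m \<le> N}. ennreal (D A ^ a * ?c m) * g (a + m))"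
    by (rule sum.mono_neutral_right) (auto, meson insert.prems(2) not_le)
  also have "\<dots> = (\<Sum>m\<le>N. \<Sum>a\<le>m. ennreal (D A ^ a * ?c (m - a)) * g (a + (m - a)))"
    by (rule sum.triangle_reindex_eq)
  also have "\<dots> = (\<Sum>m\<le>N. ennreal ((\<Prod>A\<in>insert A H. rgeo (D A)) $$ m) * g m)"
  proof (rule sum.cong)
    fix m
    have "(\<Prod>A\<in>insert A H. rgeo (D A)) $$ m = (\<Sum>a\<le>m. D A ^ a * ?c (m - a))"
      using insert.hyps by (simp add: fps_mult_nth rgeo_def atMost_atLeast0)
    then show "(\<Sum>a\<le>m. ennreal (D A ^ a * ?c (m - a)) * g (a + (m - a))) = ennreal ((\<Prod>A\<in>insert A H. rgeo (D A)) $$ m) * g m"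
      using c DA by (simp add: sum_ennreal[symmetric] sum_distrib_right del: sum_ennreal)
  qed simp
  finally show ?case .
qed

lemma one_minus_ge_exp: "0 \<le> x \<Longrightarrow> x \<le> 1 / 2 \<Longrightarrow> exp (- x - 2 * x\<^sup>2) \<le> 1 - (x :: real)"
  using ln_one_minus_pos_lower_bound[of x] by (simp add: ln_ge_iff)

text \<open>With \<open>x = 1 - D\<close>, the power lies between
  \<open>exp (- x a - 2 x (x a))\<close> and \<open>exp (- x a)\<close>. Here \<open>x a\<close>
  tends to \<open>lam * t\<close> and \<open>x\<close> to \<open>0\<close>, so both bounds have the
  same limit.\<close>

lemma power_limit:
  fixes D :: "nat \<Rightarrow> real" and a :: "nat \<Rightarrow> nat"
  assumes D: "(\<lambda>n. sqrt n * (1 - D n)) \<longlonglongrightarrow> lam" and D1: "\<forall>\<^sub>F n in sequentially. 0 \<le> D n \<and> D n \<le> 1"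
    and a: "(\<lambda>n. real (a n) / sqrt n) \<longlonglongrightarrow> t"
  shows "(\<lambda>n. D n ^ a n) \<longlonglongrightarrow> exp (- lam * t)"
proof -
  let ?x = "\<lambda>n. 1 - D n"
  have inv: "(\<lambda>n. 1 / sqrt (real n)) \<longlonglongrightarrow> 0" by real_asymp
  have eq: "\<forall>\<^sub>F n in sequentially. sqrt (real n) > 0" using eventually_gt_at_top[of 0] by eventually_elim simp
  have xa: "(\<lambda>n. ?x n * a n) \<longlonglongrightarrow> lam * t"
    by (rule Lim_transform_eventually[OF tendsto_mult[OF D a]]) (use eq in eventually_elim, simp)
  have x0: "?x \<longlonglongrightarrow> 0"
  proof -
    have "(\<lambda>n. sqrt n * (1 - D n) * (1 / sqrt n)) \<longlonglongrightarrow> lam * 0" by (rule tendsto_mult[OF D inv])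
    then have "(\<lambda>n. sqrt n * (1 - D n) * (1 / sqrt n)) \<longlonglongrightarrow> 0" by simp
    then show ?thesis by (rule Lim_transform_eventually) (use eq in eventually_elim, simp)
  qed
  have up: "(\<lambda>n. exp (- (?x n * a n))) \<longlonglongrightarrow> exp (- (lam * t))" by (intro tendsto_intros xa)
  have "(\<lambda>n. exp (- (?x n * a n) - 2 * (?x n * (?x n * a n)))) \<longlonglongrightarrow> exp (- (lam * t) - 2 * (0 * (lam * t)))"
    by (intro tendsto_intros xa x0)
  then have lo: "(\<lambda>n. exp (- (?x n * a n) - 2 * (?x n * (?x n * a n)))) \<longlonglongrightarrow> exp (- (lam * t))" by simp
  have xs: "\<forall>\<^sub>F n in sequentially. ?x n \<le> 1 / 2"
    using order_tendstoD(2)[OF x0, of "1/2"] by (auto elim: eventually_mono)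
  have "(\<lambda>n. D n ^ a n) \<longlonglongrightarrow> exp (- (lam * t))"
  proof (rule tendsto_sandwich[OF _ _ lo up])
    show "\<forall>\<^sub>F n in sequentially. exp (- (?x n * a n) - 2 * (?x n * (?x n * a n))) \<le> D n ^ a n"
      using D1 xs
    proof eventually_elim
      case (elim n)
      have "exp (- ?x n - 2 * (?x n)\<^sup>2) ^ a n \<le> (1 - ?x n) ^ a n"
        using one_minus_ge_exp[of "?x n"] elim by (intro power_mono) auto
      then show ?case by (simp add: exp_of_nat_mult[symmetric] algebra_simps power2_eq_square)
    qed
    show "\<forall>\<^sub>F n in sequentially. D n ^ a n \<le> exp (- (?x n * a n))"
      using D1
    proof eventually_elim
      case (elim n)
      have "D n ^ a n \<le> exp (- ?x n) ^ a n"
        using exp_ge_add_one_self[of "- ?x n"] elim by (intro power_mono) auto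
      then show ?case by (simp add: exp_of_nat_mult[symmetric] algebra_simps)
    qed
  qed
  then show ?thesis by simp
qed

lemma path_ratio_limit:
  fixes a :: "nat \<Rightarrow> nat"
  assumes a: "(\<lambda>n. real (a n) / sqrt n) \<longlonglongrightarrow> S"
  shows "(\<lambda>n. path_ratio n (a n) / sqrt n) \<longlonglongrightarrow> S * exp (- S\<^sup>2 / 2)"
proof -
  define u :: "nat \<Rightarrow> real" where "u = (\<lambda>n. real (a n) / sqrt n)"
  have u: "u \<longlonglongrightarrow> S" using a by (simp add: u_def)
  have inv: "(\<lambda>n. 1 / sqrt (real n)) \<longlonglongrightarrow> 0" by real_asymp
  have n0: "\<forall>\<^sub>F n in sequentially. n > (0::nat)" by (rule eventually_gt_at_top)
  have au: "real (a n) = u n * sqrt n" if "n > 0" for n using that by (simp add: u_def)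
  have small: "\<forall>\<^sub>F n in sequentially. u n * (1 / sqrt n) < 1 / 2"
    using order_tendstoD(2)[OF tendsto_mult[OF u inv], of "1/2"] by simp
  let ?U = "\<lambda>n. u n * exp (- (u n * u n) / 2 + u n * (1 / sqrt n) / 2)"
  let ?L = "\<lambda>n. u n * exp (- (u n * u n) / 2 + u n * (1 / sqrt n) / 2 - 2 * (u n * u n * u n * (1 / sqrt n)))"
  have "?U \<longlonglongrightarrow> S * exp (- (S * S) / 2 + S * 0 / 2)" by (intro tendsto_intros u inv) auto
  then have up: "?U \<longlonglongrightarrow> S * exp (- S\<^sup>2 / 2)" by (simp add: power2_eq_square)
  have "?L \<longlonglongrightarrow> S * exp (- (S * S) / 2 + S * 0 / 2 - 2 * (S * S * S * 0))" by (intro tendsto_intros u inv) auto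
  then have lo: "?L \<longlonglongrightarrow> S * exp (- S\<^sup>2 / 2)" by (simp add: power2_eq_square)
  \<comment> \<open>This puts every \<open>j / n\<close> below \<open>1 / 2\<close>, the range in
    which \<open>one_minus_ge_exp\<close> bounds \<open>1 - j / n\<close> from below.\<close>
  have half: "\<forall>\<^sub>F n in sequentially. real (a n) \<le> real n / 2"
    using small n0
  proof eventually_elim
    case (elim n)
    have "u n * s = (u n * (1 / s)) * (s * s)" if "s > 0" for s using that by simp
    from this[of "sqrt n"] have "real (a n) = (u n * (1 / sqrt n)) * (sqrt n * sqrt n)"
      using elim(2) au[OF elim(2)] by (simp only: real_sqrt_gt_0_iff of_nat_0_less_iff)
    also have "\<dots> \<le> 1 / 2 * (sqrt n * sqrt n)" using elim by (intro mult_right_mono) auto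
    finally show ?case by simp
  qed
  have key: "u n = 0 \<or> n > 0" for n by (cases n) (auto simp: u_def)
  have expo: "- (real (a n) * (real (a n) - 1)) / (2 * real n) = - (u n * u n) / 2 + u n * (1 / sqrt n) / 2" if "n > 0" for n
  proof -
    have "real n = sqrt n * sqrt n" by simp
    then show ?thesis unfolding au[OF that] using that by (subst \<open>real n = _\<close>) (simp add: field_simps)
  qed
  show ?thesis
  proof (rule tendsto_sandwich[OF _ _ lo up])
    show "\<forall>\<^sub>F n in sequentially. path_ratio n (a n) / sqrt n \<le> ?U n"
      using half n0
    proof eventually_elim
      case (elim n)
      then have "path_ratio n (a n) \<le> real (a n) * exp (- (real (a n) * (real (a n) - 1)) / (2 * real n))"
        by (intro path_ratio_le_exp) auto
      then show ?case unfolding expo[OF elim(2)] using elim(2) by (simp add: u_def field_simps)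
    qed
    show "\<forall>\<^sub>F n in sequentially. ?L n \<le> path_ratio n (a n) / sqrt n"
      using half n0
    proof eventually_elim
      case (elim n)
      let ?m = "a n"
      \<comment> \<open>The quadratic error of each factor is bounded by that of the index
        \<open>m\<close>. The total is at most \<open>2 * m^3 / n^2\<close>, which is
        \<open>2 * u^3 / sqrt n\<close> for \<open>m = u * sqrt n\<close> and vanishes in the
        limit.\<close>
      have "(\<Prod>j\<in>{1..<?m}. exp (- (real j / n) - 2 * (real ?m / n)\<^sup>2)) \<le> (\<Prod>j\<in>{1..<?m}. 1 - real j / real n)"
      proof (rule prod_mono, safe)
        fix j assume j: "j \<in> {1..<?m}"
        have "real j / n \<le> 1 / 2" using j elim by (simp add: field_simps)
        then have "exp (- (real j / n) - 2 * (real j / n)\<^sup>2) \<le> 1 - real j / real n"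
          by (intro one_minus_ge_exp) auto
        moreover have "(real j / n)\<^sup>2 \<le> (real ?m / n)\<^sup>2"
          using j by (intro power_mono divide_right_mono) auto
        ultimately show "exp (- (real j / n) - 2 * (real ?m / n)\<^sup>2) \<le> 1 - real j / real n"
          by (smt (verit) exp_le_cancel_iff)
      qed simp
      moreover have "(\<Prod>j\<in>{1..<?m}. exp (- (real j / n) - 2 * (real ?m / n)\<^sup>2))
          = exp (\<Sum>j\<in>{1..<?m}. - (real j / n) - 2 * (real ?m / n)\<^sup>2)" by (simp add: exp_sum)
      moreover have "(\<Sum>j\<in>{1..<?m}. - (real j / n) - 2 * (real ?m / n)\<^sup>2) \<ge>
          - (real ?m * (real ?m - 1)) / (2 * real n) - 2 * (u n * u n * u n * (1 / sqrt n))"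
      proof -
        have "(\<Sum>j\<in>{1..<k}. real j) = real k * (real k - 1) / 2" for k
          by (induction k) (auto simp: algebra_simps)
        from this[of ?m] have 1: "(\<Sum>j\<in>{1..<?m}. - (real j / n)) = - (real ?m * (real ?m - 1)) / (2 * real n)"
          by (simp only: sum_negf sum_divide_distrib[symmetric] divide_divide_eq_left minus_divide_left)
        have "(\<Sum>j\<in>{1..<?m}. 2 * (real ?m / n)\<^sup>2) \<le> real ?m * (2 * (real ?m / n)\<^sup>2)"
          by (simp add: mult_right_mono)
        also have "\<dots> = 2 * (u n * u n * u n * (1 / sqrt n))"
        proof -
          have "real n = sqrt n * sqrt n" by simp
          then show ?thesis unfolding au[OF elim(2)] using elim(2)
            by (subst \<open>real n = _\<close>) (simp add: field_simps power2_eq_square)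
        qed
        finally show ?thesis unfolding sum_subtractf 1 by simp
      qed
      ultimately have "exp (- (real ?m * (real ?m - 1)) / (2 * real n) - 2 * (u n * u n * u n * (1 / sqrt n)))
           \<le> (\<Prod>j\<in>{1..<?m}. 1 - real j / real n)" by (smt (verit) exp_le_cancel_iff)
      then have "real ?m * exp (- (u n * u n) / 2 + u n * (1 / sqrt n) / 2 - 2 * (u n * u n * u n * (1 / sqrt n))) \<le> path_ratio n ?m"
        unfolding path_ratio_def expo[OF elim(2)] by (intro mult_left_mono) auto
      then show ?case using elim(2) by (simp add: u_def field_simps)
    qed
  qed
qed

lemma cellnum_limit: "t \<ge> 0 \<Longrightarrow> (\<lambda>n. real (cellnum n t) / sqrt n) \<longlonglongrightarrow> t"
proof -
  assume t: "t \<ge> 0"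
  have "(\<lambda>n. 1 / sqrt (real n)) \<longlonglongrightarrow> 0" by real_asymp
  then have "(\<lambda>n. t - 1 / sqrt (real n)) \<longlonglongrightarrow> t - 0" by (intro tendsto_intros)
  then have lo: "(\<lambda>n. t - 1 / sqrt (real n)) \<longlonglongrightarrow> t" by simp
  show ?thesis
  proof (rule tendsto_sandwich[OF _ _ lo tendsto_const])
    show "\<forall>\<^sub>F n in sequentially. t - 1 / sqrt n \<le> real (cellnum n t) / sqrt n"
      using eventually_gt_at_top[of 0]
    proof eventually_elim
      case (elim n)
      have "t - 1 / sqrt n = (sqrt n * t - 1) / sqrt n" using elim by (simp add: field_simps)
      also have "\<dots> \<le> real (cellnum n t) / sqrt n"
        using cellnum_bounds(2)[OF t, of n] by (intro divide_right_mono) auto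
      finally show ?case .
    qed
    show "\<forall>\<^sub>F n in sequentially. real (cellnum n t) / sqrt n \<le> t"
      using eventually_gt_at_top[of 0]
    proof eventually_elim
      case (elim n) then show ?case using cellnum_bounds(1)[OF t, of n] by (simp add: field_simps)
    qed
  qed
qed


lemma nn_integral_exp_half_line: "(\<integral>\<^sup>+t. ennreal (exp (- t)) \<partial>half_line) = 1"
proof -
  have "(\<integral>\<^sup>+t. ennreal (exp (- t)) \<partial>half_line) = (\<integral>\<^sup>+t. ennreal (exp (- t)) * indicator {0..} t \<partial>lborel)"
    by (rule nn_integral_restrict_space) auto
  also have "\<dots> = ennreal (0 - (- exp (- 0)))"
  proof (rule nn_integral_FTC_atLeast)
    show "((\<lambda>t :: real. - exp (- t)) \<longlongrightarrow> 0) at_top" by real_asymp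
  qed (auto intro!: derivative_eq_intros)
  finally show ?thesis by simp
qed

text \<open>By \<open>riemann_sum_exact\<close> the normalised functional is an integral over edge
  lengths: \<open>card H\<close> powers of \<open>1 / sqrt n\<close> come from the cells and one
  from scaling \<open>path_ratio\<close>. Dominated convergence then gives the limit.\<close>

lemma riemann_limit:
  fixes D :: "nat \<Rightarrow> 'a \<Rightarrow> real"
  assumes H: "finite H"
    and D1: "\<forall>\<^sub>F n in sequentially. \<forall>A\<in>H. 0 \<le> D n A \<and> D n A \<le> 1"
    and D: "\<And>A. A \<in> H \<Longrightarrow> (\<lambda>n. sqrt n * (1 - D n A)) \<longlonglongrightarrow> lam A"
  shows "(\<lambda>n. path_functional n (\<Prod>A\<in>H. geo (D n A)) / of_real (sqrt n ^ (card H + 1))) \<longlonglongrightarrow>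
     of_real (\<integral>t. (\<Sum>A\<in>H. t A) * exp (- ((\<Sum>A\<in>H. t A)\<^sup>2) / 2) * (\<Prod>A\<in>H. exp (- lam A * t A)) \<partial>PiM H (\<lambda>_. half_line))"
proof -
  let ?P = "PiM H (\<lambda>_. half_line)"
  \<comment> \<open>\<open>max 0\<close> changes nothing once \<open>D n A \<ge> 0\<close>, which
    holds for all large \<open>n\<close>.\<close>
  define f where "f n t = path_ratio n (\<Sum>A\<in>H. cellnum n (t A)) / sqrt n * (\<Prod>A\<in>H. max 0 (D n A) ^ cellnum n (t A))" for n t
  define h where "h t = (\<Sum>A\<in>H. t A) * exp (- ((\<Sum>A\<in>H. t A)\<^sup>2) / 2) * (\<Prod>A\<in>H. exp (- lam A * t A))" for t
  \<comment> \<open>The \<open>4\<close> comes from \<open>path_ratio_le\<close>; rounding each edge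
    length down to its cell costs at most one further factor \<open>exp 1\<close> per edge.\<close>
  define w where "w t = exp (4 + real (card H)) * (\<Prod>A\<in>H. exp (- t A))" for t :: "'a \<Rightarrow> real"
  have cm [measurable]: "(\<lambda>t. cellnum n (t A)) \<in> measurable ?P (count_space UNIV)" if "A \<in> H" for A n
    by (rule measurable_compose[OF measurable_component_singleton[OF that] cellnum_measurable])
  have tm [measurable]: "(\<lambda>t. t A) \<in> borel_measurable ?P" if "A \<in> H" for A
    by (rule measurable_compose[OF measurable_component_singleton[OF that]]) (auto intro: measurable_restrict_space1)
  have fm [measurable]: "f n \<in> borel_measurable ?P" for n
  proof -
    have "(\<lambda>t. \<Sum>A\<in>H. cellnum n (t A)) \<in> measurable ?P (count_space UNIV)"
      by (rule measurable_sum_nat) simp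
    then have "(\<lambda>t. path_ratio n (\<Sum>A\<in>H. cellnum n (t A)) / sqrt n) \<in> borel_measurable ?P"
      by (rule measurable_compose[where g = "\<lambda>m. path_ratio n m / sqrt n"]) simp
    moreover have "(\<lambda>t. \<Prod>A\<in>H. max 0 (D n A) ^ cellnum n (t A)) \<in> borel_measurable ?P"
      by (intro borel_measurable_prod measurable_compose[OF cm, where g = "\<lambda>m. max 0 (D n _) ^ m"]) auto
    ultimately show ?thesis unfolding f_def by (rule borel_measurable_times)
  qed
  have hm [measurable]: "h \<in> borel_measurable ?P" unfolding h_def by measurable
  have wm [measurable]: "w \<in> borel_measurable ?P" unfolding w_def by measurable
  have nn: "0 \<le> t A" if "t \<in> space ?P" "A \<in> H" for t A
    using that by (auto simp: space_PiM space_restrict_space PiE_def Pi_def)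
  have lim: "(\<lambda>n. f n t) \<longlonglongrightarrow> h t" if t: "t \<in> space ?P" for t
  proof -
    have "(\<lambda>n. \<Sum>A\<in>H. real (cellnum n (t A)) / sqrt n) \<longlonglongrightarrow> (\<Sum>A\<in>H. t A)"
      using nn[OF t] by (intro tendsto_sum cellnum_limit)
    then have "(\<lambda>n. real (\<Sum>A\<in>H. cellnum n (t A)) / sqrt n) \<longlonglongrightarrow> (\<Sum>A\<in>H. t A)"
      by (simp add: sum_divide_distrib)
    from path_ratio_limit[OF this] have 1: "(\<lambda>n. path_ratio n (\<Sum>A\<in>H. cellnum n (t A)) / sqrt n) \<longlonglongrightarrow> (\<Sum>A\<in>H. t A) * exp (- (\<Sum>A\<in>H. t A)\<^sup>2 / 2)" .
    have 2: "(\<lambda>n. max 0 (D n A) ^ cellnum n (t A)) \<longlonglongrightarrow> exp (- lam A * t A)" if A: "A \<in> H" for A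
    proof (rule Lim_transform_eventually)
      show "(\<lambda>n. D n A ^ cellnum n (t A)) \<longlonglongrightarrow> exp (- lam A * t A)"
        using D1 by (intro power_limit[OF D[OF A] _ cellnum_limit[OF nn[OF t A]]]) (use A in \<open>auto elim: eventually_mono\<close>)
      show "\<forall>\<^sub>F n in sequentially. D n A ^ cellnum n (t A) = max 0 (D n A) ^ cellnum n (t A)"
        using D1 by eventually_elim (use A in auto)
    qed
    show ?thesis unfolding f_def h_def by (intro tendsto_mult 1 tendsto_prod 2)
  qed
  obtain N where N: "N > 0" "\<And>n. n \<ge> N \<Longrightarrow> \<forall>A\<in>H. 0 \<le> D n A \<and> D n A \<le> 1"
      using eventually_conj[OF D1 eventually_gt_at_top[of 0]] unfolding eventually_sequentially
      by (metis order_refl)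
  have bd: "f (n + N) t \<le> w t" if t: "t \<in> space ?P" for n t
  proof -
        let ?n = "n + N"
        let ?s = "sqrt (real ?n)"
        have s: "?s \<ge> 1" using N(1) by simp
        let ?m = "\<Sum>A\<in>H. cellnum ?n (t A)"
        have "path_ratio ?n ?m / ?s \<le> exp 4 * exp (- real ?m / ?s)"
          using path_ratio_le[of ?n ?m] N(1) s by (simp add: field_simps)
        also have "exp (- real ?m / ?s) = (\<Prod>A\<in>H. exp (- (real (cellnum ?n (t A)) / ?s)))"
          by (simp add: exp_sum[OF H, symmetric] sum_negf sum_divide_distrib)
        also have "\<dots> \<le> (\<Prod>A\<in>H. exp 1 * exp (- t A))"
        proof (rule prod_mono, safe)
          fix A assume A: "A \<in> H"
          have "t A - 1 \<le> t A - 1 / ?s" using s by simp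
          also have "\<dots> = (?s * t A - 1) / ?s" using s by (simp add: field_simps)
          also have "\<dots> \<le> real (cellnum ?n (t A)) / ?s"
            using cellnum_bounds(2)[OF nn[OF t A], of ?n] s by (intro divide_right_mono) auto
          finally show "exp (- (real (cellnum ?n (t A)) / ?s)) \<le> exp 1 * exp (- t A)"
            by (simp add: exp_add[symmetric])
        qed simp
        also have "\<dots> = exp (real (card H)) * (\<Prod>A\<in>H. exp (- t A))"
          by (simp add: prod.distrib exp_of_nat_mult[symmetric])
        finally have 1: "path_ratio ?n ?m / ?s \<le> w t" by (simp add: w_def exp_add)
        have "(\<Prod>A\<in>H. max 0 (D ?n A) ^ cellnum ?n (t A)) \<le> 1"
          using N(2)[of ?n] by (intro prod_le_1) (auto intro!: power_le_one)
        moreover have "0 \<le> (\<Prod>A\<in>H. max 0 (D ?n A) ^ cellnum ?n (t A))" by (intro prod_nonneg) auto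
        moreover have "0 \<le> w t" unfolding w_def by (intro mult_nonneg_nonneg prod_nonneg) auto
        ultimately have "f ?n t \<le> w t * 1"
          unfolding f_def using 1 by (intro mult_mono) auto
        then show ?thesis by simp
  qed
  have wfin: "(\<integral>\<^sup>+t. ennreal (w t) \<partial>?P) < \<infinity>"
  proof -
      have "(\<integral>\<^sup>+t. ennreal (w t) \<partial>?P) = ennreal (exp (4 + real (card H))) * (\<integral>\<^sup>+t. (\<Prod>A\<in>H. ennreal (exp (- t A))) \<partial>?P)"
        unfolding w_def by (subst nn_integral_cmult[symmetric]) (auto simp: ennreal_mult prod_ennreal prod_nonneg)
      also have "(\<integral>\<^sup>+t. (\<Prod>A\<in>H. ennreal (exp (- t A))) \<partial>?P) = 1"
        by (subst half_line.product_nn_integral_prod[OF H]) (auto simp: nn_integral_exp_half_line intro!: measurable_restrict_space1)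
      finally show ?thesis by simp
  qed
  have hw: "h t \<le> w t" if t: "t \<in> space ?P" for t
    using LIMSEQ_ignore_initial_segment[OF lim[OF t], of N] bd[OF t] by (intro LIMSEQ_le_const2) auto
  have "(\<lambda>n. \<integral>\<^sup>+t. ennreal (f n t) \<partial>?P) \<longlonglongrightarrow> (\<integral>\<^sup>+t. ennreal (h t) \<partial>?P)"
  proof -
    have "(\<lambda>n. \<integral>\<^sup>+t. ennreal (f (n + N) t) \<partial>?P) \<longlonglongrightarrow> (\<integral>\<^sup>+t. ennreal (h t) \<partial>?P)"
    proof (rule nn_integral_dominated_convergence[where w = "\<lambda>t. ennreal (w t)"])
      show "AE t in ?P. ennreal (f (n + N) t) \<le> ennreal (w t)" for n
        by (intro AE_I2 ennreal_leI bd)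
      show "(\<integral>\<^sup>+t. ennreal (w t) \<partial>?P) < \<infinity>" by (rule wfin)
      show "AE t in ?P. (\<lambda>n. ennreal (f (n + N) t)) \<longlonglongrightarrow> ennreal (h t)"
      proof (rule AE_I2)
        fix t assume "t \<in> space ?P"
        then show "(\<lambda>n. ennreal (f (n + N) t)) \<longlonglongrightarrow> ennreal (h t)"
          by (intro tendsto_ennrealI LIMSEQ_ignore_initial_segment lim)
      qed
    qed auto
    then show ?thesis by (rule LIMSEQ_offset)
  qed
  moreover have "(\<integral>\<^sup>+t. ennreal (h t) \<partial>?P) < \<infinity>"
  proof -
    have "(\<integral>\<^sup>+t. ennreal (h t) \<partial>?P) \<le> (\<integral>\<^sup>+t. ennreal (w t) \<partial>?P)"
      by (intro nn_integral_mono ennreal_leI hw)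
    then show ?thesis using wfin by (rule order.strict_trans1)
  qed
  ultimately have "(\<lambda>n. enn2real (\<integral>\<^sup>+t. ennreal (f n t) \<partial>?P)) \<longlonglongrightarrow> enn2real (\<integral>\<^sup>+t. ennreal (h t) \<partial>?P)"
    by (intro tendsto_enn2real) auto
  also have "enn2real (\<integral>\<^sup>+t. ennreal (h t) \<partial>?P) = (\<integral>t. h t \<partial>?P)"
  proof (rule integral_eq_nn_integral[symmetric, OF hm AE_I2])
    fix t assume t: "t \<in> space ?P"
    have "0 \<le> (\<Sum>A\<in>H. t A)" using nn[OF t] by (rule sum_nonneg)
    then show "0 \<le> h t" unfolding h_def by (intro mult_nonneg_nonneg prod_nonneg) auto
  qed
  finally have "(\<lambda>n. complex_of_real (enn2real (\<integral>\<^sup>+t. ennreal (f n t) \<partial>?P))) \<longlonglongrightarrow> of_real (\<integral>t. h t \<partial>?P)"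
    by (rule tendsto_of_real)
  moreover have "\<forall>\<^sub>F n in sequentially. of_real (enn2real (\<integral>\<^sup>+t. ennreal (f n t) \<partial>?P)) =
      path_functional n (\<Prod>A\<in>H. geo (D n A)) / of_real (sqrt n ^ (card H + 1))"
    using D1 eventually_gt_at_top[of 0]
  proof eventually_elim
    case (elim n)
    let ?c = "\<lambda>m. (\<Prod>A\<in>H. rgeo (D n A)) $$ m"
    have c: "?c m \<ge> 0" for m using elim by (intro prod_rgeo_nonneg H) auto
    have "(\<integral>\<^sup>+t. ennreal (f n t) \<partial>?P) = (\<integral>\<^sup>+t. ennreal (path_ratio n (\<Sum>A\<in>H. cellnum n (t A)) / sqrt n) * (\<Prod>A\<in>H. ennreal (D n A ^ cellnum n (t A))) \<partial>?P)"
    proof (rule nn_integral_cong)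
      fix t
      have "(\<Prod>A\<in>H. max 0 (D n A) ^ cellnum n (t A)) = (\<Prod>A\<in>H. D n A ^ cellnum n (t A))"
        using elim by (intro prod.cong) auto
      then show "ennreal (f n t) = ennreal (path_ratio n (\<Sum>A\<in>H. cellnum n (t A)) / sqrt n) * (\<Prod>A\<in>H. ennreal (D n A ^ cellnum n (t A)))"
        unfolding f_def using elim by (simp only:, subst ennreal_mult'') (auto simp: prod_ennreal intro!: prod_nonneg)
    qed
    also have "\<dots> = ennreal (1 / sqrt n) ^ card H * (\<Sum>m\<le>n. ennreal (?c m) * ennreal (path_ratio n m / sqrt n))"
      by (rule riemann_sum_exact[OF elim(2) H]) (use elim path_ratio_eq_0 in auto)
    also have "\<dots> = ennreal ((1 / sqrt n) ^ card H * (\<Sum>m\<le>n. ?c m * (path_ratio n m / sqrt n)))"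
    proof -
      have "(\<Sum>m\<le>n. ennreal (?c m) * ennreal (path_ratio n m / sqrt n)) = (\<Sum>m\<le>n. ennreal (?c m * (path_ratio n m / sqrt n)))"
        using c path_ratio_nonneg by (intro sum.cong refl ennreal_mult[symmetric]) auto
      also have "\<dots> = ennreal (\<Sum>m\<le>n. ?c m * (path_ratio n m / sqrt n))"
        using c path_ratio_nonneg by (intro sum_ennreal mult_nonneg_nonneg divide_nonneg_nonneg) auto
      finally show ?thesis
        using c path_ratio_nonneg
        by (simp only: ennreal_power[OF divide_nonneg_nonneg[OF zero_le_one real_sqrt_ge_zero[OF of_nat_0_le_iff]]])
          (intro ennreal_mult[symmetric] sum_nonneg mult_nonneg_nonneg divide_nonneg_nonneg, auto)
    qed
    finally have "enn2real (\<integral>\<^sup>+t. ennreal (f n t) \<partial>?P) = (1 / sqrt n) ^ card H * (\<Sum>m\<le>n. ?c m * (path_ratio n m / sqrt n))"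
      using c path_ratio_nonneg by (simp only:)
        (intro enn2real_ennreal sum_nonneg mult_nonneg_nonneg zero_le_power divide_nonneg_nonneg, auto)
    also have "\<dots> = (\<Sum>m\<le>n. ?c m * path_ratio n m) / sqrt n ^ (card H + 1)"
      by (simp add: sum_divide_distrib power_divide)
    also have "complex_of_real \<dots> = path_functional n (\<Prod>A\<in>H. geo (D n A)) / of_real (sqrt n ^ (card H + 1))"
      unfolding path_functional_def prod_geo_nth[OF H] by (simp add: atMost_atLeast0)
    finally show ?case .
  qed
  ultimately show ?thesis unfolding h_def by (rule Lim_transform_eventually)
qed


section \<open>Convergence of the moments\<close>

lemma path_functional_add: "path_functional n (f + g) = path_functional n f + path_functional n g"
  by (simp add: path_functional_def ring_distribs sum.distrib)

lemma path_functional_sum: "path_functional n (\<Sum>a\<in>A. f a) = (\<Sum>a\<in>A. path_functional n (f a))"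
  unfolding path_functional_def fps_sum_nth sum_distrib_right by (rule sum.swap)

lemma one_minus_cos_limit: "(\<lambda>n. sqrt (real n) * (1 - cos (c * real n powr (-1/4)))) \<longlonglongrightarrow> c\<^sup>2 / 2"
proof -
  have "(\<lambda>n. sqrt (real n) * (1 - cos (c * real n powr (-1/4)))) \<longlonglongrightarrow> c * c / 2" if "c > 0" for c
    using that by real_asymp
  then have pos: "(\<lambda>n. sqrt (real n) * (1 - cos (c * real n powr (-1/4)))) \<longlonglongrightarrow> c\<^sup>2 / 2" if "c > 0" for c
    using that by (simp only: power2_eq_square)
  consider "c = 0" | "c > 0" | "- c > 0" by linarith
  then show ?thesis
  proof cases
    case 1 then show ?thesis by simp
  next
    case 2 then show ?thesis by (rule pos)
  next
    case 3 then show ?thesis using pos[of "- c"] by simp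
  qed
qed

text \<open>The characteristic function of one rescaled uniform step. The factor
  \<open>sqrt d\<close> of the rescaling puts \<open>d\<close> into each squared frequency and
  cancels the average over the \<open>d\<close> directions, so \<open>1 - stepcos\<close> is
  asymptotic to \<open>(norm K)^2 / (2 * sqrt n)\<close>, as in the exponents of
  \<open>Ahat\<close>.\<close>

definition stepcos :: "nat \<Rightarrow> real^'d::finite \<Rightarrow> real" where
  "stepcos n K = (\<Sum>j\<in>UNIV. cos (sqrt (real CARD('d)) * K $ j * real n powr (-1/4))) / real CARD('d)"

lemma stepcos_limit: "(\<lambda>n. sqrt (real n) * (1 - stepcos n K)) \<longlonglongrightarrow> (norm (K :: real^'d::finite))\<^sup>2 / 2"
proof -
  let ?d = "real CARD('d)"
  have "(\<lambda>n. (\<Sum>j\<in>UNIV. sqrt (real n) * (1 - cos (sqrt ?d * K $ j * real n powr (-1/4)))) / ?d)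
      \<longlonglongrightarrow> (\<Sum>j\<in>UNIV. (sqrt ?d * K $ j)\<^sup>2 / 2) / ?d"
    by (intro tendsto_intros one_minus_cos_limit) auto
  also have "(\<Sum>j\<in>UNIV. (sqrt ?d * K $ j)\<^sup>2 / 2) / ?d = (norm K)\<^sup>2 / 2"
    unfolding power2_norm_eq_inner inner_vec_def
    by (simp add: power_mult_distrib sum_divide_distrib inner_real_def flip: power2_eq_square)
  also have "(\<lambda>n. (\<Sum>j\<in>UNIV. sqrt (real n) * (1 - cos (sqrt ?d * K $ j * real n powr (-1/4)))) / ?d)
     = (\<lambda>n. sqrt (real n) * (1 - stepcos n K))"
    unfolding stepcos_def by (simp add: sum_distrib_left[symmetric] sum_subtractf field_simps)
  finally show ?thesis .
qed

lemma stepcos_le_1: "stepcos n (K :: real^'d::finite) \<le> 1"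
proof -
  have "(\<Sum>j\<in>UNIV. cos (sqrt (real CARD('d)) * K $ j * real n powr (-1/4))) \<le> (\<Sum>j\<in>(UNIV :: 'd set). 1)"
    by (rule sum_mono) simp
  then show ?thesis by (simp add: stepcos_def)
qed

lemma stepcos_eventually:
  "\<forall>\<^sub>F n in sequentially. 0 \<le> stepcos n K \<and> stepcos n K \<le> 1 \<and> 1 - stepcos n K \<le> ((norm K)\<^sup>2 / 2 + 1) / sqrt (real n)"
proof -
  let ?C = "(norm K)\<^sup>2 / 2 + 1"
  have "\<forall>\<^sub>F n in sequentially. sqrt (real n) * (1 - stepcos n K) < ?C"
    by (rule order_tendstoD(2)[OF stepcos_limit]) simp
  moreover have "\<forall>\<^sub>F n in sequentially. ?C / sqrt (real n) < 1"
    by real_asymp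
  ultimately show ?thesis using eventually_gt_at_top[of 0]
  proof eventually_elim
    case (elim n)
    have "1 - stepcos n K \<le> ?C / sqrt n" using elim by (simp add: field_simps)
    moreover have "?C / sqrt n < 1" by (rule elim(2))
    ultimately show ?case using stepcos_le_1[of n K] by linarith
  qed
qed

lemma rescale_add: "rescale n (x + y) = rescale n x + rescale n y"
  by (simp add: rescale_def vec_eq_iff ring_distribs)

lemma rescale_0: "rescale n 0 = 0"
  by (simp add: rescale_def vec_eq_iff)

lemma inner_rescale_step_vec:
  "(K :: real^'d::finite) \<bullet> rescale n (step_vec (j, b)) = (if b then 1 else -1) * (sqrt (real CARD('d)) * K $ j * real n powr (-1/4))"
proof -
  have "K \<bullet> (\<chi> i. real_of_int (step_vec (j, b) $ i)) = (\<Sum>i\<in>UNIV. if i = j then K $ i * (if b then 1 else -1) else 0)"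
    unfolding inner_vec_def by (intro sum.cong) (auto simp: step_vec_def axis_def)
  then show ?thesis by (auto simp: rescale_def)
qed

text \<open>The characters multiply to the character of the sum of the frequencies, and opposite
  steps pair up to a real cosine.\<close>

lemma stepsum_rescale:
  fixes k :: "'i \<Rightarrow> real^'d::finite"
  assumes "finite B"
  shows "stepsum (\<lambda>i x. cis (k i \<bullet> rescale n x)) B = of_real (stepcos n (\<Sum>i\<in>B. k i))"
proof -
  let ?K = "\<Sum>i\<in>B. k i"
  have p: "(\<Prod>i\<in>B. cis (k i \<bullet> x)) = cis (?K \<bullet> x)" for x
    using assms by (induction B rule: finite_induct) (auto simp: cis_mult inner_add_left)
  have "(\<Sum>s\<in>(UNIV :: ('d \<times> bool) set). cis (?K \<bullet> rescale n (step_vec s)))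
     = (\<Sum>j\<in>UNIV. \<Sum>b\<in>UNIV. cis (?K \<bullet> rescale n (step_vec (j, b))))"
    unfolding sum.cartesian_product UNIV_Times_UNIV by (simp add: split_def)
  also have "\<dots> = (\<Sum>j\<in>UNIV. of_real (2 * cos (sqrt (real CARD('d)) * ?K $ j * real n powr (-1/4))))"
    by (intro sum.cong refl) (simp add: UNIV_bool inner_rescale_step_vec complex_eq_iff)
  finally show ?thesis unfolding stepsum_def p stepcos_def
    by (simp add: sum_distrib_left[symmetric])
qed

text \<open>The error has order at most \<open>sqrt n * sqrt n ^ (2 * l - 2)\<close>, that is
  \<open>n ^ l / sqrt n\<close>. Each shape has \<open>2 * l - 1\<close> edges, so the normalisation
  in \<open>riemann_limit\<close> is exactly \<open>n ^ l\<close>, and its limit is the integral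
  \<open>Ahat\<close>.\<close>

lemma tree_moment_limit:
  fixes k :: "nat \<Rightarrow> real^'d::finite"
  assumes l: "l \<ge> 1"
  shows "(\<lambda>n. path_functional n (skeleton_gf (\<lambda>i x. cis (k i \<bullet> rescale n x)) {1..l}) / of_nat n ^ l) \<longlonglongrightarrow> of_real (\<Sum>H\<in>shapes l. Ahat H k)"
proof -
  let ?J = "{1..l}"
  define e where "e n = (\<lambda>i (x :: int^'d). cis (k i \<bullet> rescale n x))" for n
  define D where "D n B = stepcos n (\<Sum>i\<in>B. k i)" for n B
  define S where "S n I = (\<Sum>H\<in>clade_families I. \<Prod>A\<in>H. geo (D n A))" for n and I :: "nat set"
  \<comment> \<open>A single constant for all subsets of the marks: each summand is nonnegative, so
    the sum bounds every one of them.\<close>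
  define C where "C = (\<Sum>B\<in>Pow ?J. (norm (\<Sum>i\<in>B. k i))\<^sup>2 / 2 + 1)"
  have ev: "\<forall>\<^sub>F n in sequentially. \<forall>B\<in>Pow ?J. 0 \<le> D n B \<and> D n B \<le> 1 \<and> 1 - D n B \<le> ((norm (\<Sum>i\<in>B. k i))\<^sup>2 / 2 + 1) / sqrt (real n)"
    unfolding D_def by (intro eventually_ball_finite ballI stepcos_eventually) auto
  have Dev: "\<forall>\<^sub>F n in sequentially. \<forall>B\<subseteq>?J. 0 \<le> D n B \<and> D n B \<le> 1 \<and> 1 - D n B \<le> C / sqrt (real n)"
    using ev
  proof eventually_elim
    case (elim n)
    show ?case
    proof (intro allI impI)
      fix B assume B: "B \<subseteq> ?J"
      have "(norm (\<Sum>i\<in>B. k i))\<^sup>2 / 2 + 1 \<le> C"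
        unfolding C_def by (rule member_le_sum) (use B in auto)
      then have "((norm (\<Sum>i\<in>B. k i))\<^sup>2 / 2 + 1) / sqrt (real n) \<le> C / sqrt (real n)"
        by (intro divide_right_mono) auto
      moreover have "0 \<le> D n B \<and> D n B \<le> 1 \<and> 1 - D n B \<le> ((norm (\<Sum>i\<in>B. k i))\<^sup>2 / 2 + 1) / sqrt (real n)"
        using bspec[OF elim, of B] B by blast
      ultimately show "0 \<le> D n B \<and> D n B \<le> 1 \<and> 1 - D n B \<le> C / sqrt (real n)" by linarith
    qed
  qed
  have rec: "skeleton_gf (e n) I = skeleton_gf (e n) (I - {i}) + (\<Sum>B\<in>{B. i \<in> B \<and> B \<subseteq> I}. fps_const (of_real (D n B)) * skeleton_gf (e n) B * skeleton_gf (e n) (I - B))"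
    if I: "I \<subseteq> ?J" "i \<in> I" for n I i
  proof -
    have fI: "finite I" using I finite_subset by auto
    have "stepsum (e n) B = of_real (D n B)" if "B \<subseteq> I" for B
      unfolding e_def D_def using finite_subset[OF that fI] by (rule stepsum_rescale)
    then show ?thesis using skeleton_gf_rec[OF fI I(2), of "e n"] by simp
  qed
  have asy: "damped_bound (2 * card ?J - 2) (\<lambda>n. skeleton_gf (e n) ?J - S n ?J)"
    unfolding S_def using skeleton_gf_asymp[where D = D and sk = "\<lambda>n. skeleton_gf (e n)" and J = ?J and I = ?J and K = C] skeleton_gf_empty rec Dev l by auto
  then obtain K where K: "\<forall>\<^sub>F n in sequentially. damped_norm n (skeleton_gf (e n) ?J - S n ?J) \<le> K * sqrt (real n) ^ (2 * l - 2)"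
    by (auto simp: damped_bound_def)
  have err: "(\<lambda>n. path_functional n (skeleton_gf (e n) ?J - S n ?J) / of_nat n ^ l) \<longlonglongrightarrow> 0"
  proof (rule Lim_null_comparison)
    show "\<forall>\<^sub>F n in sequentially. norm (path_functional n (skeleton_gf (e n) ?J - S n ?J) / of_nat n ^ l) \<le> exp 4 * K * (1 / sqrt (real n))"
      using K eventually_gt_at_top[of 0]
    proof eventually_elim
      case (elim n)
      have n: "real n = sqrt n * sqrt n" by simp
      have s: "sqrt (real n) > 0" using elim by simp
      have pw: "real n ^ l = sqrt n ^ (2 * l - 2) * sqrt n * sqrt n"
      proof -
        obtain m where "l = Suc m" using l by (cases l) auto
        then show ?thesis by (subst n) (simp add: power_mult power2_eq_square)
      qed
      have "norm (path_functional n (skeleton_gf (e n) ?J - S n ?J)) \<le> exp 4 * sqrt n * damped_norm n (skeleton_gf (e n) ?J - S n ?J)"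
        by (rule norm_path_functional_le[OF elim(2)])
      also have "\<dots> \<le> exp 4 * sqrt n * (K * sqrt n ^ (2 * l - 2))"
        using elim by (intro mult_left_mono) auto
      finally have "norm (path_functional n (skeleton_gf (e n) ?J - S n ?J)) / real n ^ l \<le> exp 4 * sqrt n * (K * sqrt n ^ (2 * l - 2)) / real n ^ l"
        by (rule divide_right_mono) simp
      also have "exp 4 * sqrt n * (K * sqrt n ^ (2 * l - 2)) / real n ^ l = exp 4 * K * (1 / sqrt n)"
        unfolding pw using s by (simp add: divide_simps del: real_sqrt_mult_self)
      finally show ?case by (simp add: norm_divide norm_power)
    qed
    show "(\<lambda>n. exp 4 * K * (1 / sqrt (real n))) \<longlonglongrightarrow> 0"
      by (rule tendsto_mult_right_zero) real_asymp
  qed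
  have main: "(\<lambda>n. path_functional n (\<Prod>A\<in>H. geo (D n A)) / of_nat n ^ l) \<longlonglongrightarrow> of_real (Ahat H k)" if H: "H \<in> clade_families ?J" for H
  proof -
    have fH: "finite H" and cH: "card H + 1 = 2 * l" and sub: "H \<subseteq> Pow ?J"
      using finite_clade[OF _ H] card_clade[OF _ _ H] clade_families_subset(1)[OF H] l by auto
    have "(\<lambda>n. path_functional n (\<Prod>A\<in>H. geo (D n A)) / of_real (sqrt n ^ (card H + 1))) \<longlonglongrightarrow>
      of_real (\<integral>t. (\<Sum>A\<in>H. t A) * exp (- ((\<Sum>A\<in>H. t A)\<^sup>2) / 2) * (\<Prod>A\<in>H. exp (- ((norm (\<Sum>i\<in>A. k i))\<^sup>2 / 2) * t A)) \<partial>PiM H (\<lambda>_. half_line))"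
    proof (rule riemann_limit[OF fH])
      show "\<forall>\<^sub>F n in sequentially. \<forall>A\<in>H. 0 \<le> D n A \<and> D n A \<le> 1"
        using ev by eventually_elim (use sub in blast)
      show "(\<lambda>n. sqrt n * (1 - D n A)) \<longlonglongrightarrow> (norm (\<Sum>i\<in>A. k i))\<^sup>2 / 2" for A
        unfolding D_def by (rule stepcos_limit)
    qed
    also have "(\<integral>t. (\<Sum>A\<in>H. t A) * exp (- ((\<Sum>A\<in>H. t A)\<^sup>2) / 2) * (\<Prod>A\<in>H. exp (- ((norm (\<Sum>i\<in>A. k i))\<^sup>2 / 2) * t A)) \<partial>PiM H (\<lambda>_. half_line)) = Ahat H k"
      unfolding Ahat_def by simp
    also have "(\<lambda>n. path_functional n (\<Prod>A\<in>H. geo (D n A)) / of_real (sqrt n ^ (card H + 1))) = (\<lambda>n. path_functional n (\<Prod>A\<in>H. geo (D n A)) / of_nat n ^ l)"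
    proof -
      have "complex_of_real (sqrt (real n) ^ (2 * l)) = of_nat n ^ l" for n
        by (simp only: power_mult real_sqrt_pow2 of_nat_0_le_iff of_real_power of_real_of_nat_eq)
      then show ?thesis unfolding cH by (simp only:)
    qed
    finally show ?thesis .
  qed
  have "(\<lambda>n. path_functional n (skeleton_gf (e n) ?J - S n ?J) / of_nat n ^ l + (\<Sum>H\<in>clade_families ?J. path_functional n (\<Prod>A\<in>H. geo (D n A)) / of_nat n ^ l))
      \<longlonglongrightarrow> 0 + (\<Sum>H\<in>clade_families ?J. of_real (Ahat H k))"
    by (intro tendsto_add err tendsto_sum main)
  moreover have "path_functional n (skeleton_gf (e n) ?J - S n ?J) / of_nat n ^ l + (\<Sum>H\<in>clade_families ?J. path_functional n (\<Prod>A\<in>H. geo (D n A)) / of_nat n ^ l)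
     = path_functional n (skeleton_gf (e n) ?J) / of_nat n ^ l" for n
  proof -
    have "path_functional n (skeleton_gf (e n) ?J) = path_functional n (skeleton_gf (e n) ?J - S n ?J) + path_functional n (S n ?J)"
      using path_functional_add[of n "skeleton_gf (e n) ?J - S n ?J" "S n ?J"] by simp
    then show ?thesis by (simp add: S_def path_functional_sum sum_divide_distrib add_divide_distrib)
  qed
  ultimately show ?thesis unfolding shapes_eq_clades e_def by simp
qed

text \<open>Dividing the coefficient of \<open>gf\<close> by \<open>tree_mass\<close> is
  conditioning on the number of vertices; the expectation of the product is therefore the normalised
  \<open>path_functional\<close>.\<close>

lemma moment_limit:
  fixes k :: "nat \<Rightarrow> real^'d::finite"
  assumes l: "l \<ge> 1"
  shows "(\<lambda>n. \<Sum>(T,\<phi>)\<in>(pairs n :: (nat list set \<times> (nat list \<Rightarrow> int^'d)) set).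
      complex_of_real (P_tree_emb T \<phi> / (\<Sum>(T',\<phi>')\<in>(pairs n :: (nat list set \<times> (nat list \<Rightarrow> int^'d)) set). P_tree_emb T' \<phi>'))
      * (\<Prod>i\<in>{1..l}. (\<Sum>w\<in>T. cis (k i \<bullet> rescale n (\<phi> w))) / of_nat n))
     \<longlonglongrightarrow> of_real (\<Sum>H\<in>shapes l. Ahat H k)"
proof (rule Lim_transform_eventually[OF tree_moment_limit[OF l, of k]])
  show "\<forall>\<^sub>F n in sequentially. path_functional n (skeleton_gf (\<lambda>i x. cis (k i \<bullet> rescale n x)) {1..l}) / of_nat n ^ l =
     (\<Sum>(T,\<phi>)\<in>(pairs n :: (nat list set \<times> (nat list \<Rightarrow> int^'d)) set).
      complex_of_real (P_tree_emb T \<phi> / (\<Sum>(T',\<phi>')\<in>(pairs n :: (nat list set \<times> (nat list \<Rightarrow> int^'d)) set). P_tree_emb T' \<phi>'))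
      * (\<Prod>i\<in>{1..l}. (\<Sum>w\<in>T. cis (k i \<bullet> rescale n (\<phi> w))) / of_nat n))"
    using eventually_gt_at_top[of 0]
  proof eventually_elim
    case (elim n)
    let ?e = "\<lambda>i x. cis (k i \<bullet> rescale n x)"
    have Z: "(\<Sum>(T',\<phi>')\<in>(pairs n :: (nat list set \<times> (nat list \<Rightarrow> int^'d)) set). P_tree_emb T' \<phi>') = tree_mass TYPE('d) n"
      unfolding sum_pairs tree_mass_def by (simp add: tree_weight_eq)
    have Z0: "tree_mass TYPE('d) n > 0" by (rule tree_mass_pos[OF elim])
    have t: "(\<Sum>w\<in>dom (pos t). cis (k i \<bullet> rescale n (tree_embedding t w))) = char_sum (?e i) t" for t :: "('d \<times> bool) btree" and i
      by (rule char_sum_eq) (simp_all add: rescale_0 rescale_add inner_add_right cis_mult)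
    have "(\<Sum>(T,\<phi>)\<in>(pairs n :: (nat list set \<times> (nat list \<Rightarrow> int^'d)) set).
      complex_of_real (P_tree_emb T \<phi> / tree_mass TYPE('d) n)
      * (\<Prod>i\<in>{1..l}. (\<Sum>w\<in>T. cis (k i \<bullet> rescale n (\<phi> w))) / of_nat n))
      = (\<Sum>t | num_vertices t = n. marked_weight ?e {1..l} t) / (of_real (tree_mass TYPE('d) n) * of_nat n ^ l)"
      unfolding sum_pairs
      by (subst sum_divide_distrib, intro sum.cong refl) (simp add: tree_weight_eq t marked_weight_def prod_dividef)
    also have "(\<Sum>t | num_vertices t = n. marked_weight ?e {1..l} t) = of_real (tree_mass TYPE('d) n) * path_functional n (skeleton_gf ?e {1..l})"
      using gf_nth_eq_path_functional[OF elim, of ?e "{1..l}"] by (simp add: gf_def)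
    finally show ?case unfolding Z using Z0 by simp
  qed
qed


section \<open>Measures on the one-point compactification\<close>

lemma open_vimage_component: "open W \<Longrightarrow> open {h :: 'a \<Rightarrow> 'b::topological_space. h i \<in> W}"
  using open_vimage[OF _ continuous_on_product_coordinates, of W i] by (simp add: vimage_def)

text \<open>
  The library only has the instances for countable index types. The smaller classes have to come first,
  as otherwise the arities would conflict.
\<close>

instance "fun" :: (type, t0_space) t0_space
proof
  fix f g :: "'a \<Rightarrow> 'b" assume "f \<noteq> g"
  then obtain i where i: "f i \<noteq> g i" by blast
  obtain U where "open U" "\<not> (f i \<in> U \<longleftrightarrow> g i \<in> U)"
    using t0_space_class.t0_space[OF i] by auto
  then show "\<exists>U. open U \<and> \<not> (f \<in> U \<longleftrightarrow> g \<in> U)"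
    using open_vimage_component[of U i] by (intro exI[of _ "{h. h i \<in> U}"]) auto
qed

instance "fun" :: (type, t1_space) t1_space
proof
  fix f g :: "'a \<Rightarrow> 'b" assume "f \<noteq> g"
  then obtain i where i: "f i \<noteq> g i" by blast
  obtain U where "open U" "f i \<in> U" "g i \<notin> U" using t1_space_class.t1_space[OF i] by auto
  then show "\<exists>U. open U \<and> f \<in> U \<and> g \<notin> U"
    using open_vimage_component[of U i] by (intro exI[of _ "{h. h i \<in> U}"]) auto
qed

instance "fun" :: (type, t2_space) t2_space
proof
  fix f g :: "'a \<Rightarrow> 'b" assume "f \<noteq> g"
  then obtain i where i: "f i \<noteq> g i" by blast
  obtain U V where "open U" "open V" "f i \<in> U" "g i \<in> V" "U \<inter> V = {}"
    using hausdorff[OF i] by auto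
  then show "\<exists>U V. open U \<and> open V \<and> f \<in> U \<and> g \<in> V \<and> U \<inter> V = {}"
    using open_vimage_component[of U i] open_vimage_component[of V i]
    by (intro exI[of _ "{h. h i \<in> U}"] exI[of _ "{h. h i \<in> V}"]) auto
qed

section \<open>The Stone-Weierstrass theorem for compact topological spaces\<close>

lemma Hausdorff_euclidean_t2: "Hausdorff_space (euclidean :: 'a::t2_space topology)"
  unfolding Hausdorff_space_def disjnt_def using hausdorff by simp blast

text \<open>The members of \<open>R\<close> serve as coordinates: evaluating all of them maps
  \<open>X\<close> injectively onto a compact set in a product of real lines, where the version for
  compact sets applies.\<close>

lemma stone_weierstrass_compact_space:
  fixes X :: "'a topology" and R :: "('a \<Rightarrow> real) set"
  assumes X: "compact_space X"
    and cont: "\<And>g. g \<in> R \<Longrightarrow> continuous_map X euclideanreal g"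
    and add: "\<And>g h. g \<in> R \<Longrightarrow> h \<in> R \<Longrightarrow> (\<lambda>x. g x + h x) \<in> R"
    and mult: "\<And>g h. g \<in> R \<Longrightarrow> h \<in> R \<Longrightarrow> (\<lambda>x. g x * h x) \<in> R"
    and const: "\<And>c. (\<lambda>_. c) \<in> R"
    and sep: "\<And>x y. x \<in> topspace X \<Longrightarrow> y \<in> topspace X \<Longrightarrow> x \<noteq> y \<Longrightarrow> \<exists>g\<in>R. g x \<noteq> g y"
    and f: "continuous_map X euclideanreal f" and e: "e > 0"
  shows "\<exists>g\<in>R. \<forall>x\<in>topspace X. \<bar>f x - g x\<bar> < e"
proof -
  \<comment> \<open>The coordinates are indexed by all functions, and those outside \<open>R\<close>
    are frozen at \<open>0\<close>.\<close>
  define \<Phi> where "\<Phi> x = (\<lambda>g. if g \<in> R then g x else (0::real))" for x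
  define S where "S = \<Phi> ` topspace X"
  have c\<Phi>: "continuous_map X euclidean \<Phi>"
    unfolding euclidean_product_topology[symmetric] continuous_map_componentwise_UNIV \<Phi>_def
    using cont by auto
  have cS: "compact S"
    using image_compactin[OF _ c\<Phi>, of "topspace X"] X unfolding S_def compact_space_def by simp
  \<comment> \<open>A continuous map from a compact space onto a Hausdorff space is a quotient map,
    so \<open>f\<close> factors continuously through the injective map
    \<open>\<Phi>\<close>.\<close>
  have q: "quotient_map X (top_of_set S) \<Phi>"
  proof (rule continuous_imp_quotient_map)
    show "continuous_map X (top_of_set S) \<Phi>"
      using c\<Phi> by (auto simp: continuous_map_in_subtopology S_def)
    show "Hausdorff_space (top_of_set S)"
      by (intro Hausdorff_space_subtopology Hausdorff_euclidean_t2)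
  qed (use X S_def in auto)
  have inj: "x = y" if xy: "x \<in> topspace X" "y \<in> topspace X" "\<Phi> x = \<Phi> y" for x y
  proof (rule ccontr)
    assume "x \<noteq> y"
    then obtain g where "g \<in> R" "g x \<noteq> g y" using sep[OF xy(1,2)] by blast
    then show False using fun_cong[OF xy(3), of g] by (simp add: \<Phi>_def)
  qed
  obtain h where h: "continuous_map (top_of_set S) euclideanreal h" "\<And>x. x \<in> topspace X \<Longrightarrow> h (\<Phi> x) = f x"
    using quotient_map_lift_exists[OF q f] inj by metis
  \<comment> \<open>Only the values on the image \<open>S\<close> are prescribed; this makes the
    algebra contain every coordinate projection for \<open>g\<close> in \<open>R\<close>, and these
    separate points.\<close>
  define R' where "R' = {h. continuous_on S h \<and> (\<exists>g\<in>R. \<forall>x\<in>topspace X. h (\<Phi> x) = g x)}"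
  interpret function_ring_on R' S
  proof
    show "compact S" by (rule cS)
    show "continuous_on S k" if "k \<in> R'" for k using that by (simp add: R'_def)
    show "(\<lambda>x. k x + k' x) \<in> R'" if kk: "k \<in> R'" "k' \<in> R'" for k k'
    proof -
      obtain g g' where "g \<in> R" "g' \<in> R" "\<forall>x\<in>topspace X. k (\<Phi> x) = g x" "\<forall>x\<in>topspace X. k' (\<Phi> x) = g' x"
        using kk by (auto simp: R'_def)
      then show ?thesis using kk add[of g g'] unfolding R'_def
        by (auto intro!: continuous_intros bexI[of _ "\<lambda>x. g x + g' x"])
    qed
    show "(\<lambda>x. k x * k' x) \<in> R'" if kk: "k \<in> R'" "k' \<in> R'" for k k'
    proof -
      obtain g g' where "g \<in> R" "g' \<in> R" "\<forall>x\<in>topspace X. k (\<Phi> x) = g x" "\<forall>x\<in>topspace X. k' (\<Phi> x) = g' x"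
        using kk by (auto simp: R'_def)
      then show ?thesis using kk mult[of g g'] unfolding R'_def
        by (auto intro!: continuous_intros bexI[of _ "\<lambda>x. g x * g' x"])
    qed
    show "(\<lambda>_. c) \<in> R'" for c
      unfolding R'_def using const[of c] by (auto intro!: bexI[of _ "\<lambda>_. c"])
    fix p p' assume p: "p \<in> S" "p' \<in> S" "p \<noteq> p'"
    then obtain g where "p g \<noteq> p' g" by blast
    then have g: "g \<in> R" using p by (auto simp: S_def \<Phi>_def)
    have "(\<lambda>p. p g) \<in> R'"
      unfolding R'_def using g
      by (auto simp: \<Phi>_def intro!: bexI[of _ g] continuous_on_subset[OF continuous_on_product_coordinates])
    then show "\<exists>k\<in>R'. k p \<noteq> k p'" using \<open>p g \<noteq> p' g\<close> by (intro bexI[of _ "\<lambda>p. p g"])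
  qed
  have "continuous_on S h" using h(1) by simp
  from Stone_Weierstrass_basic[OF this e] obtain k where k: "k \<in> R'" "\<forall>p\<in>S. \<bar>h p - k p\<bar> < e" by blast
  then obtain g where "g \<in> R" "\<forall>x\<in>topspace X. k (\<Phi> x) = g x" by (auto simp: R'_def)
  then show ?thesis using k(2) h(2) by (intro bexI[of _ g]) (auto simp: S_def)
qed

section \<open>Topology and Borel sets of the compactification\<close>

lemma openin_cpt_top: "openin cpt_top U \<longleftrightarrow> cpt_open U"
  by (simp add: cpt_top_def istopology_cpt_open)

lemma topspace_cpt_top [simp]: "topspace cpt_top = UNIV"
proof -
  have "openin cpt_top UNIV" by (simp add: openin_cpt_top cpt_open_def)
  then show ?thesis using openin_subset by blast
qed

lemma continuous_map_case_option:
  fixes g :: "real^'d::finite \<Rightarrow> real"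
  assumes g: "continuous_on UNIV g" and lim: "(g \<longlongrightarrow> c) at_infinity"
  shows "continuous_map cpt_top euclideanreal (case_option c g)"
  unfolding continuous_map_def
proof (intro conjI allI impI)
  show "case_option c g \<in> topspace cpt_top \<rightarrow> topspace euclideanreal" by simp
  fix U :: "real set" assume "openin euclideanreal U"
  then have U: "open U" by simp
  have e: "Some -` {x \<in> topspace cpt_top. case_option c g x \<in> U} = g -` U" by auto
  have o: "open (g -` U)" using U g by (simp add: continuous_on_open_vimage)
  have "compact (- (g -` U))" if "c \<in> U"
  proof -
    have "eventually (\<lambda>x. g x \<in> U) at_infinity" using topological_tendstoD[OF lim U that] .
    then obtain b where b: "\<And>x. norm x \<ge> b \<Longrightarrow> g x \<in> U" unfolding eventually_at_infinity by blast
    have "bounded (- (g -` U))"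
      unfolding bounded_iff using b by (metis ComplD linear vimageI)
    then show ?thesis using o by (simp add: compact_eq_bounded_closed closed_def)
  qed
  then show "openin cpt_top {x \<in> topspace cpt_top. case_option c g x \<in> U}"
    unfolding openin_cpt_top cpt_open_def e using o by auto
qed

lemma sets_borel_of: "sets (borel_of X) = sigma_sets (topspace X) {U. openin X U}"
  unfolding borel_of_def by (rule sets_measure_of) (auto dest: openin_subset)

lemma space_borel_of: "space (borel_of X) = topspace X"
  unfolding borel_of_def by (rule space_measure_of) (auto dest: openin_subset)

lemma borel_of_measurable:
  assumes "continuous_map X euclideanreal f"
  shows "f \<in> borel_measurable (borel_of X)"
proof (rule borel_measurableI)
  fix S :: "real set" assume "open S"
  then have "openin X {x \<in> topspace X. f x \<in> S}" using assms by (auto simp: continuous_map_def)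
  moreover have "f -` S \<inter> space (borel_of X) = {x \<in> topspace X. f x \<in> S}" by (auto simp: space_borel_of)
  ultimately show "f -` S \<inter> space (borel_of X) \<in> sets (borel_of X)"
    unfolding sets_borel_of by auto
qed

abbreviation borel_cpt :: "'d::finite cpt measure" where "borel_cpt \<equiv> borel_of cpt_top"

text \<open>An intersection-stable generator whose masses can be recovered from integrals of
  continuous functions. The whole space is added to provide the exhaustion in the uniqueness theorem
  for measures.\<close>

definition compact_gens :: "'d::finite cpt set set" where
  "compact_gens = insert UNIV ((`) Some ` {C. compact C})"

text \<open>An open set that contains infinity is the complement of a compact set; any other open
  set is a countable union of compact sets.\<close>

lemma sets_borel_cpt_gens: "sets (borel_cpt :: 'd::finite cpt measure) = sigma_sets UNIV compact_gens"
proof -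
  let ?\<S> = "sigma_sets UNIV compact_gens :: 'd cpt set set"
  interpret sigma_algebra "UNIV :: 'd cpt set" ?\<S> by (rule sigma_algebra_sigma_sets) simp
  have C: "Some ` C \<in> ?\<S>" if "compact C" for C :: "(real^'d) set"
    using that by (auto simp: compact_gens_def)
  have "U \<in> ?\<S>" if "openin cpt_top U" for U
  proof (cases "None \<in> U")
    case True
    then have "compact (- (Some -` U))" using that by (simp add: openin_cpt_top cpt_open_def)
    from compl_sets[OF C[OF this]] have "UNIV - Some ` (- (Some -` U)) \<in> ?\<S>" .
    moreover have "UNIV - Some ` (- (Some -` U)) = U"
    proof (rule set_eqI)
      fix z show "z \<in> UNIV - Some ` (- (Some -` U)) \<longleftrightarrow> z \<in> U" using True by (cases z) auto
    qed
    ultimately show ?thesis by simp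
  next
    case False
    have "open (Some -` U)" using that by (simp add: openin_cpt_top cpt_open_def)
    then obtain K :: "nat \<Rightarrow> (real^'d) set" where K: "\<And>n. compact (K n)" "\<Union>(range K) = Some -` U"
      using open_Union_compact_subsets by metis
    have "U = (\<Union>n::nat. Some ` K n)"
    proof -
      have "U = Some ` (Some -` U)"
      proof (rule set_eqI)
        fix z show "z \<in> U \<longleftrightarrow> z \<in> Some ` (Some -` U)" using False by (cases z) auto
      qed
      then show ?thesis unfolding K(2)[symmetric] by auto
    qed
    then show ?thesis using C[OF K(1)] by (simp only:) (rule countable_UN, auto)
  qed
  moreover have "G \<in> sets borel_cpt" if "G \<in> compact_gens" for G :: "'d cpt set"
  proof -
    have "UNIV - U \<in> sets (borel_cpt :: 'd cpt measure)" if "openin cpt_top U" for U :: "'d cpt set"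
      using that unfolding sets_borel_of by (auto intro: sigma_sets.intros)
    moreover have "openin cpt_top (UNIV - Some ` C)" if "compact C" for C :: "(real^'d) set"
    proof -
      have "Some -` (UNIV - Some ` C) = - C" by auto
      then show ?thesis using that compact_imp_closed[OF that] by (auto simp: openin_cpt_top cpt_open_def)
    qed
    moreover have "UNIV - (UNIV - Some ` C) = Some ` C" for C :: "(real^'d) set" by auto
    ultimately have "Some ` C \<in> sets borel_cpt" if "compact C" for C :: "(real^'d) set"
      using that by metis
    moreover have "UNIV \<in> sets (borel_cpt :: 'd cpt measure)" using sets.top[of "borel_cpt :: 'd cpt measure"] by (simp add: space_borel_of)
    ultimately show ?thesis using that by (auto simp: compact_gens_def)
  qed
  ultimately have "{U. openin cpt_top U} \<subseteq> ?\<S>" "compact_gens \<subseteq> sigma_sets UNIV {U :: 'd cpt set. openin cpt_top U}"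
    unfolding sets_borel_of topspace_cpt_top by auto
  then show ?thesis
    unfolding sets_borel_of topspace_cpt_top using sigma_sets_mono by (metis subset_antisym)
qed

lemma Int_stable_gens: "Int_stable (compact_gens :: 'd::finite cpt set set)"
proof (rule Int_stableI)
  fix A B :: "'d cpt set" assume "A \<in> compact_gens" "B \<in> compact_gens"
  moreover have "Some ` C \<inter> Some ` D = Some ` (C \<inter> D)" for C D :: "(real^'d) set" by auto
  ultimately show "A \<inter> B \<in> compact_gens" by (auto simp: compact_gens_def compact_Int)
qed

text \<open>Continuous functions that decrease to the indicator of the compact set \<open>C\<close>
  and vanish near infinity.\<close>

definition bump :: "(real^'d::finite) set \<Rightarrow> nat \<Rightarrow> 'd cpt \<Rightarrow> real" where
  "bump C n = case_option 0 (\<lambda>x. max 0 (1 - real n * infdist x C))"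

lemma bump_continuous:
  assumes "compact C" "C \<noteq> {}"  "n > 0"
  shows "continuous_map cpt_top euclideanreal (bump C n)"
  unfolding bump_def
proof (rule continuous_map_case_option)
  show "continuous_on UNIV (\<lambda>x. max 0 (1 - real n * infdist x C))"
    by (intro continuous_intros)
  obtain b where b: "\<And>y. y \<in> C \<Longrightarrow> norm y \<le> b"
    using compact_imp_bounded[OF assms(1)] bounded_iff by blast
  have "max 0 (1 - real n * infdist x C) = 0" if "norm x \<ge> b + 1" for x
  proof -
    have "1 \<le> dist x y" if "y \<in> C" for y
      using b[OF that] \<open>norm x \<ge> b + 1\<close> norm_triangle_ineq2[of x y] by (simp add: dist_norm)
    then have "1 \<le> infdist x C" using assms(2) by (simp add: infdist_notempty cINF_greatest)
    then have "1 * 1 \<le> real n * infdist x C" using assms(3) by (intro mult_mono) auto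
    then show ?thesis by simp
  qed
  then show "((\<lambda>x. max 0 (1 - real n * infdist x C)) \<longlongrightarrow> 0) at_infinity"
    by (intro tendsto_eventually) (auto simp: eventually_at_infinity)
qed

lemma bump_limit:
  assumes "compact C" "C \<noteq> {}"
  shows "(\<lambda>n. bump C (Suc n) z) \<longlonglongrightarrow> indicator (Some ` C) z"
proof (cases z)
  case (Some x)
  show ?thesis
  proof (cases "x \<in> C")
    case True then show ?thesis by (simp add: Some bump_def)
  next
    case False
    then have d: "infdist x C > 0"
      using assms by (metis compact_imp_closed in_closed_iff_infdist_zero infdist_nonneg less_eq_real_def)
    have "\<forall>\<^sub>F n in sequentially. max 0 (1 - real (Suc n) * infdist x C) = 0"
    proof -
      obtain N where N: "real N > 1 / infdist x C" using reals_Archimedean2 by blast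
      have "1 \<le> real (Suc n) * infdist x C" if "n \<ge> N" for n
        using N that d by (simp add: field_simps) (smt (verit) mult_right_mono of_nat_mono)
      then show ?thesis unfolding eventually_sequentially by (intro exI[of _ N]) auto
    qed
    then have "\<forall>\<^sub>F n in sequentially. bump C (Suc n) z = 0" by (simp only: bump_def Some option.case)
    moreover have "indicator (Some ` C) z = (0 :: real)" using False Some by (auto simp: indicator_def)
    ultimately show ?thesis by (simp only: tendsto_eventually)
  qed
qed (auto simp: bump_def)

lemma bump_bounds: "0 \<le> bump C n z" "bump C n z \<le> 1"
  by (auto simp: bump_def infdist_nonneg split: option.splits)

lemma M1_D:
  assumes "\<nu> \<in> (M1 :: 'd::finite cpt measure set)"
  shows "sets \<nu> = sets borel_cpt" "space \<nu> = UNIV" "prob_space \<nu>"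
  using assms sets_eq_imp_space_eq[of \<nu> borel_cpt] by (auto simp: M1_def space_borel_of)

lemma M1_measurable: "\<nu> \<in> M1 \<Longrightarrow> borel_measurable \<nu> = borel_measurable borel_cpt"
  using M1_D(1) by (intro measurable_cong_sets) auto

lemma M1_bump_limit:
  assumes \<nu>: "\<nu> \<in> M1" and "compact C" "C \<noteq> {}"
  shows "(\<lambda>n. \<integral>z. bump C (Suc n) z \<partial>\<nu>) \<longlonglongrightarrow> measure \<nu> (Some ` C)"
proof -
  interpret prob_space \<nu> by (rule M1_D(3)[OF \<nu>])
  have S: "Some ` C \<in> sets \<nu>"
    unfolding M1_D(1)[OF \<nu>] sets_borel_cpt_gens using assms by (auto simp: compact_gens_def)
  have "(\<lambda>n. \<integral>z. bump C (Suc n) z \<partial>\<nu>) \<longlonglongrightarrow> (\<integral>z. indicator (Some ` C) z \<partial>\<nu>)"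
  proof (rule integral_dominated_convergence[where w = "\<lambda>_. 1"])
    show "bump C (Suc n) \<in> borel_measurable \<nu>" for n
      unfolding M1_measurable[OF \<nu>] using assms by (intro borel_of_measurable bump_continuous) auto
    show "AE z in \<nu>. (\<lambda>n. bump C (Suc n) z) \<longlonglongrightarrow> indicator (Some ` C) z"
      using bump_limit[OF assms(2,3)] by simp
    show "AE z in \<nu>. norm (bump C (Suc n) z) \<le> 1" for n
      by (intro AE_I2) (simp add: bump_bounds)
  qed (use S in auto)
  then show ?thesis using S by simp
qed

text \<open>The bumps determine the masses of all compact sets, and these sets form an
  intersection-stable generator.\<close>

lemma M1_eqI:
  assumes "\<nu> \<in> (M1 :: 'd::finite cpt measure set)" "\<nu>' \<in> M1"
    and eq: "\<And>f. continuous_map cpt_top euclideanreal f \<Longrightarrow> (\<integral>z. f z \<partial>\<nu>) = (\<integral>z. f z \<partial>\<nu>')"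
  shows "\<nu> = \<nu>'"
proof -
  interpret \<nu>: prob_space \<nu> by (rule M1_D(3)[OF assms(1)])
  interpret \<nu>': prob_space \<nu>' by (rule M1_D(3)[OF assms(2)])
  show ?thesis
  proof (rule measure_eqI_generator_eq[OF Int_stable_gens, of UNIV _ _ "\<lambda>_. UNIV"])
    show "sets \<nu> = sigma_sets UNIV compact_gens" "sets \<nu>' = sigma_sets UNIV compact_gens"
      using M1_D(1)[OF assms(1)] M1_D(1)[OF assms(2)] sets_borel_cpt_gens by auto
    show "emeasure \<nu> X = emeasure \<nu>' X" if X: "X \<in> compact_gens" for X
    proof -
      consider "X = UNIV" | "X = {}" | C where "X = Some ` C" "compact C" "C \<noteq> {}"
        using X unfolding compact_gens_def by blast
      then show ?thesis
      proof cases
        case 1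
        then show ?thesis using \<nu>.emeasure_space_1 \<nu>'.emeasure_space_1 M1_D(2)[OF assms(1)] M1_D(2)[OF assms(2)] by simp
      next
        case 3
        have "(\<lambda>n. \<integral>z. bump C (Suc n) z \<partial>\<nu>) = (\<lambda>n. \<integral>z. bump C (Suc n) z \<partial>\<nu>')"
          using 3 by (intro ext eq bump_continuous) auto
        then have "measure \<nu> (Some ` C) = measure \<nu>' (Some ` C)"
          using M1_bump_limit[OF assms(1) 3(2,3)] M1_bump_limit[OF assms(2) 3(2,3)] LIMSEQ_unique by metis
        then show ?thesis by (simp add: 3 \<nu>.emeasure_eq_measure \<nu>'.emeasure_eq_measure)
      qed simp
    qed
    show "emeasure \<nu> UNIV \<noteq> \<infinity>" using \<nu>.emeasure_finite by simp
  qed (auto simp: compact_gens_def)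
qed

section \<open>The weak topology and Gaussian test functions\<close>

lemma topspace_weak_top: "topspace weak_top = (M1 :: 'd::finite cpt measure set)"
proof -
  have "M1 \<in> {{\<nu> \<in> M1. (\<integral>x. f x \<partial>\<nu>) \<in> U} | f U. continuous_map cpt_top euclideanreal f \<and> open U}"
    by (intro CollectI exI[of _ "\<lambda>_. 0"] exI[of _ UNIV]) auto
  then show ?thesis unfolding weak_top_def topology_generated_by_topspace by blast
qed

lemma weak_top_integral:
  assumes "continuous_map cpt_top euclideanreal f"
  shows "continuous_map weak_top euclideanreal (\<lambda>\<nu>. \<integral>x. f x \<partial>\<nu>)"
  unfolding continuous_map_def
proof (intro conjI allI impI)
  fix U :: "real set" assume "openin euclideanreal U"
  then have "{\<nu> \<in> M1. (\<integral>x. f x \<partial>\<nu>) \<in> U} \<in> {{\<nu> \<in> M1. (\<integral>x. f x \<partial>\<nu>) \<in> U} | f U. continuous_map cpt_top euclideanreal f \<and> open U}"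
    using assms by auto
  then show "openin weak_top {x \<in> topspace weak_top. integral\<^sup>L x f \<in> U}"
    unfolding topspace_weak_top unfolding weak_top_def by (rule topology_generated_by_Basis)
qed simp

text \<open>These functions meet three demands at once: they extend continuously by \<open>0\<close>
  to infinity, products stay in the class up to a constant, and each is an average of
  characters.\<close>

definition gaussian :: "real \<Rightarrow> real^'d::finite \<Rightarrow> 'd cpt \<Rightarrow> real" where
  "gaussian a b = case_option 0 (\<lambda>x. exp (- a * (norm (x - b))\<^sup>2))"

lemma gaussian_continuous:
  assumes "a > 0" shows "continuous_map cpt_top euclideanreal (gaussian a b)"
  unfolding gaussian_def
proof (rule continuous_map_case_option)
  show "continuous_on UNIV (\<lambda>x. exp (- a * (norm (x - b))\<^sup>2))" by (intro continuous_intros)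
  have "filterlim (\<lambda>x. norm (x - b)) at_top at_infinity"
  proof (rule filterlim_at_top_mono)
    show "filterlim (\<lambda>x :: real^'d. - norm b + norm x) at_top at_infinity"
      by (intro filterlim_tendsto_add_at_top[OF tendsto_const] filterlim_at_infinity_imp_norm_at_top filterlim_ident)
    show "\<forall>\<^sub>F x in at_infinity. - norm b + norm x \<le> norm (x - b)"
      by (intro always_eventually allI) (simp add: norm_triangle_ineq2)
  qed
  then have "filterlim (\<lambda>x. a * (norm (x - b))\<^sup>2) at_top at_infinity"
    using assms by (intro filterlim_tendsto_pos_mult_at_top[OF tendsto_const] filterlim_pow_at_top) auto
  then have "filterlim (\<lambda>x. - (a * (norm (x - b))\<^sup>2)) at_bot at_infinity"
    by (simp add: filterlim_uminus_at_bot)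
  from filterlim_compose[OF exp_at_bot this] show "((\<lambda>x. exp (- a * (norm (x - b))\<^sup>2)) \<longlongrightarrow> 0) at_infinity" by simp
qed

lemma gaussian_mult:
  fixes b b' :: "real^'d::finite"
  assumes "a > 0" "a' > 0"
  shows "\<exists>c b''. \<forall>z. gaussian a b z * gaussian a' b' z = c * gaussian (a + a') b'' z"
proof -
  have s: "a + a' > 0" using assms by simp
  \<comment> \<open>The weighted mean of the two centres, which completes the square in the sum of
    the exponents.\<close>
  define m where "m = (1 / (a + a')) *\<^sub>R (a *\<^sub>R b + a' *\<^sub>R b')"
  have m: "(a + a') * (x \<bullet> m) = a * (x \<bullet> b) + a' * (x \<bullet> b')" for x
    using s by (simp add: m_def inner_add_right)
  let ?K = "a * (norm b)\<^sup>2 + a' * (norm b')\<^sup>2 - (a + a') * (norm m)\<^sup>2"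
  have sq: "a * (norm (x - b))\<^sup>2 + a' * (norm (x - b'))\<^sup>2 = (a + a') * (norm (x - m))\<^sup>2 + ?K" for x :: "real^'d"
  proof -
    have n: "(norm (x - y))\<^sup>2 = (norm x)\<^sup>2 - 2 * (x \<bullet> y) + (norm y)\<^sup>2" for y :: "real^'d"
      by (simp add: power2_norm_eq_inner inner_diff inner_commute)
    show ?thesis using m[of x] unfolding n by (simp add: algebra_simps)
  qed
  then have "gaussian a b z * gaussian a' b' z = exp (- ?K) * gaussian (a + a') m z" for z
  proof (cases z)
    case (Some x)
    then show ?thesis using sq[of x]
      by (simp add: gaussian_def exp_add[symmetric]) argo
  qed (simp add: gaussian_def)
  then show ?thesis by blast
qed

inductive_set gaussian_span :: "('d::finite cpt \<Rightarrow> real) set" where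
  const: "(\<lambda>_. c) \<in> gaussian_span"
| gauss: "a > 0 \<Longrightarrow> (\<lambda>z. c * gaussian a b z) \<in> gaussian_span"
| add: "f \<in> gaussian_span \<Longrightarrow> g \<in> gaussian_span \<Longrightarrow> (\<lambda>z. f z + g z) \<in> gaussian_span"

lemma gaussian_span_cmult: "f \<in> gaussian_span \<Longrightarrow> (\<lambda>z. k * f z) \<in> gaussian_span"
proof (induction rule: gaussian_span.induct)
  case (gauss a c b)
  then show ?case using gaussian_span.gauss[of a "k * c" b] by (simp add: mult.assoc)
next
  case (add f g)
  then show ?case using gaussian_span.add[OF add.IH] by (simp add: ring_distribs)
qed (auto intro: gaussian_span.const)

lemma gaussian_span_mult: "f \<in> gaussian_span \<Longrightarrow> g \<in> gaussian_span \<Longrightarrow> (\<lambda>z. f z * g z) \<in> gaussian_span"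
proof (induction arbitrary: g rule: gaussian_span.induct)
  case (const c)
  then show ?case by (rule gaussian_span_cmult)
next
  case (gauss a c b)
  note a = gauss.hyps
  from gauss.prems show ?case
  proof (induction rule: gaussian_span.induct)
    case (const k)
    then show ?case using gaussian_span.gauss[OF a, of "c * k" b] by (simp add: mult_ac)
  next
    case (gauss a' c' b')
    obtain k b'' where k: "\<And>z. gaussian a b z * gaussian a' b' z = k * gaussian (a + a') b'' z"
      using gaussian_mult[OF a gauss, of b b'] by blast
    have "c * gaussian a b z * (c' * gaussian a' b' z) = (c * c') * (k * gaussian (a + a') b'' z)" for z
      unfolding k[symmetric, of z] by (simp only: mult_ac)
    then show ?case using gaussian_span.gauss[of "a + a'" "c * c' * k" b''] a gauss
      by (simp only: add_pos_pos mult.assoc)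
  next
    case (add f g)
    then show ?case using gaussian_span.add[OF add.IH] by (simp add: ring_distribs)
  qed
next
  case (add f1 f2)
  then show ?case using gaussian_span.add[OF add.IH(1)[OF add.prems] add.IH(2)[OF add.prems]] by (simp add: ring_distribs)
qed

lemma gaussian_span_continuous: "f \<in> gaussian_span \<Longrightarrow> continuous_map cpt_top euclideanreal f"
proof (induction rule: gaussian_span.induct)
  case (gauss a c b)
  then show ?case by (intro continuous_map_real_mult gaussian_continuous) auto
next
  case (add f g)
  then show ?case by (intro continuous_map_add)
qed simp

lemma gaussian_span_separates:
  assumes "x \<noteq> (y :: 'd::finite cpt)" shows "\<exists>g\<in>gaussian_span. g x \<noteq> g y"
proof -
  have *: "\<exists>g\<in>gaussian_span. g (Some u) \<noteq> g y" if "Some u \<noteq> y" for u :: "real^'d" and y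
  proof
    show "(\<lambda>z. 1 * gaussian 1 u z) \<in> gaussian_span" by (rule gaussian_span.gauss) simp
    show "1 * gaussian 1 u (Some u) \<noteq> 1 * gaussian 1 u y"
      using that by (cases y) (auto simp: gaussian_def)
  qed
  show ?thesis
  proof (cases x)
    case None
    then obtain v where v: "y = Some v" using assms by (cases y) auto
    from *[of v x] assms obtain g where "g \<in> gaussian_span" "g y \<noteq> g x" unfolding v by auto
    then show ?thesis by (intro bexI[of _ g]) auto
  next
    case (Some u) then show ?thesis using *[of u y] assms by simp
  qed
qed


text \<open>Extending \<open>g\<close> by \<open>0\<close> need not be continuous at infinity.
  Multiplied by the cutoffs \<open>?k n\<close>, which vanish outside a ball, it is, and the cutoffs
  tend to \<open>1\<close> at every finite point.\<close>

lemma case_option_measurable: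
  fixes g :: "real^'d::finite \<Rightarrow> real"
  assumes g: "continuous_on UNIV g"
  shows "case_option 0 g \<in> borel_measurable borel_cpt"
proof (rule borel_measurable_LIMSEQ_real)
  let ?k = "\<lambda>n x. max 0 (min 1 (real n - norm (x :: real^'d)))"
  show "case_option 0 (\<lambda>x. g x * ?k n x) \<in> borel_measurable borel_cpt" for n
  proof (rule borel_of_measurable, rule continuous_map_case_option)
    show "continuous_on UNIV (\<lambda>x. g x * ?k n x)" by (intro continuous_intros g)
    show "((\<lambda>x. g x * ?k n x) \<longlongrightarrow> 0) at_infinity"
      by (rule tendsto_eventually) (auto simp: eventually_at_infinity intro!: exI[of _ "real n"])
  qed
  show "(\<lambda>n. case z of None \<Rightarrow> 0 | Some x \<Rightarrow> g x * ?k n x) \<longlonglongrightarrow> (case z of None \<Rightarrow> 0 | Some x \<Rightarrow> g x)" for z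
  proof (cases z)
    case (Some x)
    obtain N where N: "norm x + 1 < real N" using reals_Archimedean2 by blast
    have "\<forall>\<^sub>F n in sequentially. g x * ?k n x = g x"
      unfolding eventually_sequentially by (intro exI[of _ N]) (use N in auto)
    then show ?thesis unfolding Some by (auto intro: tendsto_eventually)
  qed simp
qed


section \<open>Compactness of the space of probability measures\<close>

text \<open>
  Compactness is obtained without the Riesz representation theorem. A mass tree prescribes the masses
  of the cells of a nested dyadic partition (the newest bit of a word is its head). The mass trees form
  a compact set in the product topology, and cutting the unit interval into pieces of the prescribed
  lengths realises each of them as the law of a function of a uniform variable.
\<close>

definition mass_tree :: "(bool list \<Rightarrow> real) \<Rightarrow> bool" where
  "mass_tree p \<longleftrightarrow> p [] = 1 \<and> (\<forall>w. 0 \<le> p w) \<and> (\<forall>w. p w = p (False # w) + p (True # w))"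

lemma mass_treeD:
  assumes "mass_tree p"
  shows "p [] = 1" "0 \<le> p w" "p w = p (False # w) + p (True # w)"
proof -
  note p = assms[unfolded mass_tree_def]
  show "p [] = 1" by (rule conjunct1[OF p])
  show "0 \<le> p w" by (rule spec[OF conjunct1[OF conjunct2[OF p]]])
  show "p w = p (False # w) + p (True # w)" by (rule spec[OF conjunct2[OF conjunct2[OF p]]])
qed

lemma mass_tree_le_1: "mass_tree p \<Longrightarrow> p w \<le> 1"
proof (induction w)
  case (Cons b w)
  have p: "p v = p (False # v) + p (True # v)" "0 \<le> p v" for v
    by (rule mass_treeD[OF Cons.prems])+
  have "p (b # w) \<le> p w" using p(1)[of w] p(2)[of "False # w"] p(2)[of "True # w"] by (cases b) auto
  also have "\<dots> \<le> 1" by (rule Cons.IH[OF Cons.prems])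
  finally show ?case .
qed (simp add: mass_treeD(1))

text \<open>A closed subset of a cube: each condition involves finitely many coordinates, and all
  masses lie between \<open>0\<close> and \<open>1\<close>.\<close>

lemma compact_mass_tree: "compact {p. mass_tree p}"
proof -
  have K: "compact (PiE UNIV (\<lambda>_ :: bool list. {0..1::real}))"
    using compactin_PiE[of "\<lambda>_. euclideanreal" UNIV "\<lambda>_ :: bool list. {0..1}"]
    by (simp add: euclidean_product_topology)
  have c: "continuous_on UNIV (\<lambda>p. p w :: real)" for w :: "bool list"
    by (rule continuous_on_product_coordinates)
  have "closed {p :: bool list \<Rightarrow> real. mass_tree p}"
    unfolding mass_tree_def
    by (intro closed_Collect_conj closed_Collect_all closed_Collect_eq closed_Collect_le
        continuous_on_add c continuous_on_const)
  moreover have "{p. mass_tree p} \<subseteq> PiE UNIV (\<lambda>_ :: bool list. {0..1::real})"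
    using mass_tree_le_1 mass_treeD(2) by auto
  ultimately show ?thesis using K compact_Int_closed[OF K, of "{p. mass_tree p}"]
    by (simp add: Int_absorb1)
qed

abbreviation words :: "nat \<Rightarrow> bool list set" where "words m \<equiv> {w. length w = m}"

lemma finite_words: "finite (words m)"
  using finite_lists_length_eq[of "UNIV :: bool set" m] by simp

text \<open>The cell of a word \<open>w\<close> in the unit interval starts here and has length
  \<open>p w\<close>; its \<open>True\<close> half lies to the right of its \<open>False\<close>
  half.\<close>

fun left_end :: "(bool list \<Rightarrow> real) \<Rightarrow> bool list \<Rightarrow> real" where
  "left_end p [] = 0"
| "left_end p (b # w) = left_end p w + (if b then p (False # w) else 0)"

fun interval_word :: "(bool list \<Rightarrow> real) \<Rightarrow> nat \<Rightarrow> real \<Rightarrow> bool list" where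
  "interval_word p 0 u = []"
| "interval_word p (Suc m) u = (left_end p (interval_word p m u) + p (False # interval_word p m u) \<le> u) # interval_word p m u"

text \<open>The cells are half-open, so one of mass zero is empty and reached by no
  \<open>u\<close>; degenerate mass trees fit in without a separate case.\<close>

lemma interval_word_eq_iff:
  assumes p: "mass_tree p" and u: "u \<in> {0..<1}"
  shows "interval_word p m u = w \<longleftrightarrow> length w = m \<and> left_end p w \<le> u \<and> u < left_end p w + p w"
proof (induction m arbitrary: w)
  case 0
  then show ?case using mass_treeD(1)[OF p] u by auto
next
  case (Suc m)
  show ?case
  proof (cases w)
    case (Cons b v)
    have s: "p v = p (False # v) + p (True # v)" and nn: "0 \<le> p (False # v)" "0 \<le> p (True # v)"
      by (rule mass_treeD[OF p])+
    have "interval_word p (Suc m) u = w \<longleftrightarrow> interval_word p m u = v \<and> b = (left_end p v + p (False # v) \<le> u)"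
      using Cons by auto
    also have "\<dots> \<longleftrightarrow> length v = m \<and> left_end p v \<le> u \<and> u < left_end p v + p v \<and> b = (left_end p v + p (False # v) \<le> u)"
      using Suc[of v] by auto
    also have "\<dots> \<longleftrightarrow> length w = Suc m \<and> left_end p w \<le> u \<and> u < left_end p w + p w"
      using s nn by (cases b) (auto simp: Cons)
    finally show ?thesis .
  qed auto
qed

lemma length_interval_word: "length (interval_word p m u) = m" by (induction m) auto

abbreviation unit_interval :: "real measure" where "unit_interval \<equiv> restrict_space lborel {0..<1}"

lemma prob_space_unit_interval: "prob_space unit_interval"
  by (rule prob_spaceI) (simp add: emeasure_restrict_space space_restrict_space)

lemma left_end_bounds:
  assumes p: "mass_tree p"
  shows "0 \<le> left_end p w" "left_end p w + p w \<le> 1"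
proof (induction w)
  case (Cons b w)
  { case 1 then show ?case using Cons mass_treeD(2)[OF p] by auto }
  { case 2
    have "p w = p (False # w) + p (True # w)" "0 \<le> p (False # w)" "0 \<le> p (True # w)" by (rule mass_treeD[OF p])+
    then show ?case using Cons(2) by (cases b) auto }
qed (use mass_treeD(1)[OF p] in auto)

lemma interval_word_vimage:
  assumes p: "mass_tree p"
  shows "interval_word p m -` {w} \<inter> {0..<1} = (if length w = m then {left_end p w ..< left_end p w + p w} else {})"
proof (intro set_eqI)
  fix u
  have "u \<in> {0..<1}" if "u \<in> {left_end p w ..< left_end p w + p w}"
    using that left_end_bounds[OF p, of w] by auto
  then show "u \<in> interval_word p m -` {w} \<inter> {0..<1} \<longleftrightarrow> u \<in> (if length w = m then {left_end p w ..< left_end p w + p w} else {})"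
    using interval_word_eq_iff[OF p, of u m w] by auto
qed

lemma interval_word_measurable:
  assumes p: "mass_tree p"
  shows "interval_word p m \<in> measurable unit_interval (count_space UNIV)"
proof -
  have "interval_word p m -` {w} \<inter> space unit_interval \<in> sets unit_interval" for w
  proof -
    have "interval_word p m -` {w} \<inter> {0..<1} \<in> sets lborel" unfolding interval_word_vimage[OF p] by simp
    then show ?thesis by (simp add: sets_restrict_space_iff space_restrict_space)
  qed
  then show ?thesis by (simp add: measurable_count_space_eq2_countable)
qed

lemma measure_interval_word:
  assumes p: "mass_tree p"
  shows "measure unit_interval (interval_word p m -` {w} \<inter> space unit_interval) = (if length w = m then p w else 0)"
proof -
  have "measure unit_interval (interval_word p m -` {w} \<inter> space unit_interval) = measure lborel (interval_word p m -` {w} \<inter> {0..<1})"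
    by (simp add: space_restrict_space measure_restrict_space)
  also have "\<dots> = (if length w = m then p w else 0)"
    unfolding interval_word_vimage[OF p] using mass_treeD(2)[OF p] by auto
  finally show ?thesis .
qed

lemma integral_words:
  fixes g :: "bool list \<Rightarrow> real"
  assumes "prob_space M" and X: "X \<in> measurable M (count_space UNIV)" and len: "\<And>u. length (X u) = m"
  shows "(\<integral>u. g (X u) \<partial>M) = (\<Sum>w\<in>words m. measure M (X -` {w} \<inter> space M) * g w)"
    and "integrable M (\<lambda>u. g (X u))"
proof -
  interpret prob_space M by fact
  have S: "X -` {w} \<inter> space M \<in> sets M" for w using X by (rule measurable_sets) auto
  have e: "g (X u) = (\<Sum>w\<in>words m. g w * indicator (X -` {w} \<inter> space M) u)" if "u \<in> space M" for u
  proof -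
    have "(\<Sum>w\<in>words m. g w * indicator (X -` {w} \<inter> space M) u) = (\<Sum>w\<in>words m. if w = X u then g w else 0)"
      using that by (intro sum.cong) (auto simp: indicator_def)
    then show ?thesis using len by (simp add: finite_words)
  qed
  have i: "integrable M (\<lambda>u. \<Sum>w\<in>words m. g w * indicator (X -` {w} \<inter> space M) u)"
    using S by (intro Bochner_Integration.integrable_sum integrable_mult_right integrable_real_indicator) (auto simp: less_top[symmetric])
  then show "integrable M (\<lambda>u. g (X u))"
    by (rule iffD2[OF Bochner_Integration.integrable_cong[OF refl], rotated]) (rule e)
  have "(\<integral>u. g (X u) \<partial>M) = (\<integral>u. (\<Sum>w\<in>words m. g w * indicator (X -` {w} \<inter> space M) u) \<partial>M)"
    by (rule Bochner_Integration.integral_cong) (auto simp: e)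
  also have "\<dots> = (\<Sum>w\<in>words m. g w * measure M (X -` {w} \<inter> space M))"
    using S by (subst Bochner_Integration.integral_sum) (auto simp: less_top[symmetric])
  finally show "(\<integral>u. g (X u) \<partial>M) = (\<Sum>w\<in>words m. measure M (X -` {w} \<inter> space M) * g w)"
    by (simp add: mult.commute)
qed

text \<open>The partial sum of digit vectors selected by the bits of a word. The head is the newest
  bit, hence its digit vector has index \<open>length w\<close>.\<close>

fun digit_point :: "(nat \<Rightarrow> 'e::real_normed_vector) \<Rightarrow> bool list \<Rightarrow> 'e" where
  "digit_point v [] = 0"
| "digit_point v (b # w) = digit_point v w + (if b then v (length w) else 0)"

definition interval_bits :: "(bool list \<Rightarrow> real) \<Rightarrow> real \<Rightarrow> nat \<Rightarrow> bool" where
  "interval_bits p u k = hd (interval_word p (Suc k) u)"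

lemma digit_point_interval_word: "digit_point v (interval_word p m u) = (\<Sum>k<m. if interval_bits p u k then v k else 0)"
  by (induction m) (auto simp: interval_bits_def length_interval_word)

definition digit_limit :: "(nat \<Rightarrow> 'e::euclidean_space) \<Rightarrow> (bool list \<Rightarrow> real) \<Rightarrow> real \<Rightarrow> 'e" where
  "digit_limit v p u = (\<Sum>k. if interval_bits p u k then v k else 0)"

context
  fixes v :: "nat \<Rightarrow> 'e::euclidean_space"
  assumes v: "summable (\<lambda>k. norm (v k))"
begin

lemma digit_limit_approx: "norm (digit_limit v p u - digit_point v (interval_word p m u)) \<le> (\<Sum>k. norm (v (k + m)))"
proof -
  let ?f = "\<lambda>k. if interval_bits p u k then v k else 0"
  have s: "summable (\<lambda>k. norm (?f k))" by (rule summable_comparison_test'[OF v, of 0]) auto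
  have s': "summable (\<lambda>k. norm (?f (k + m)))" by (rule summable_ignore_initial_segment[OF s])
  have "digit_limit v p u - digit_point v (interval_word p m u) = (\<Sum>k. ?f (k + m))"
    unfolding digit_limit_def digit_point_interval_word using suminf_split_initial_segment[OF summable_norm_cancel[OF s], of m] by simp
  also have "norm \<dots> \<le> (\<Sum>k. norm (?f (k + m)))"
    by (rule summable_norm[OF s'])
  also have "\<dots> \<le> (\<Sum>k. norm (v (k + m)))"
    by (rule suminf_le[OF _ s' summable_ignore_initial_segment[OF v]]) auto
  finally show ?thesis .
qed

lemma tail_limit: "(\<lambda>m. \<Sum>k. norm (v (k + m))) \<longlonglongrightarrow> 0"
proof -
  have "(\<lambda>m. (\<Sum>k. norm (v k)) - (\<Sum>k<m. norm (v k))) \<longlonglongrightarrow> (\<Sum>k. norm (v k)) - (\<Sum>k. norm (v k))"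
    by (intro tendsto_diff tendsto_const summable_LIMSEQ v)
  then show ?thesis by (simp add: suminf_minus_initial_segment[OF v])
qed

lemma digit_limit_limit: "(\<lambda>m. digit_point v (interval_word p m u)) \<longlonglongrightarrow> digit_limit v p u"
proof (rule tendstoI)
  fix e :: real assume "e > 0"
  have "\<forall>\<^sub>F m in sequentially. (\<Sum>k. norm (v (k + m))) < e"
    using order_tendstoD(2)[OF tail_limit \<open>e > 0\<close>] .
  then show "\<forall>\<^sub>F m in sequentially. dist (digit_point v (interval_word p m u)) (digit_limit v p u) < e"
    by eventually_elim (use digit_limit_approx in \<open>auto simp: dist_norm norm_minus_commute intro: le_less_trans\<close>)
qed

lemma digit_limit_measurable: "mass_tree p \<Longrightarrow> digit_limit v p \<in> borel_measurable unit_interval"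
proof (rule borel_measurable_LIMSEQ_metric)
  assume p: "mass_tree p"
  show "(\<lambda>u. digit_point v (interval_word p m u)) \<in> borel_measurable unit_interval" for m
    by (rule measurable_compose[OF interval_word_measurable[OF p]]) simp
qed (rule digit_limit_limit)

lemma norm_digit_point: "norm (digit_point v w) \<le> (\<Sum>k. norm (v k))"
proof -
  have "norm (digit_point v w) \<le> (\<Sum>k<length w. norm (v k))"
    by (induction w) (auto intro: order_trans[OF norm_triangle_ineq] add_mono add_increasing2)
  also have "\<dots> \<le> (\<Sum>k. norm (v k))" by (rule sum_le_suminf[OF v]) auto
  finally show ?thesis .
qed

lemma norm_limpt: "norm (digit_limit v p u) \<le> (\<Sum>k. norm (v k))"
  using digit_limit_approx[of p u 0] by simp

text \<open>The error at depth \<open>m\<close> is governed by the tail of the digit vectors,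
  whatever the mass tree, and \<open>\<phi>\<close> is uniformly continuous on a ball that contains
  all points. This uniformity in \<open>p\<close> is what yields continuity of the limit.\<close>

lemma law_approx:
  fixes \<phi> :: "'e \<Rightarrow> real"
  assumes \<phi>: "continuous_on UNIV \<phi>" and e: "e > 0"
  shows "\<forall>\<^sub>F m in sequentially. \<forall>p\<in>{p. mass_tree p}.
    dist (\<Sum>w\<in>words m. p w * \<phi> (digit_point v w)) (\<integral>u. \<phi> (digit_limit v p u) \<partial>unit_interval) < e"
proof -
  interpret unit_interval: prob_space unit_interval by (rule prob_space_unit_interval)
  let ?K = "cball (0 :: 'e) (\<Sum>k. norm (v k))"
  have "uniformly_continuous_on ?K \<phi>"
    by (rule compact_uniformly_continuous[OF continuous_on_subset[OF \<phi>]]) auto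
  then obtain d where d: "d > 0" "\<And>x y. x \<in> ?K \<Longrightarrow> y \<in> ?K \<Longrightarrow> dist y x < d \<Longrightarrow> dist (\<phi> y) (\<phi> x) < e / 2"
    using e unfolding uniformly_continuous_on_def by (metis half_gt_zero)
  have "compact (\<phi> ` ?K)"
    by (rule compact_continuous_image[OF continuous_on_subset[OF \<phi>]]) auto
  then obtain B where B: "\<And>x. x \<in> ?K \<Longrightarrow> norm (\<phi> x) \<le> B"
    using compact_imp_bounded bounded_iff by (metis imageI)
  have "\<forall>\<^sub>F m in sequentially. (\<Sum>k. norm (v (k + m))) < d"
    using order_tendstoD(2)[OF tail_limit d(1)] .
  then show ?thesis
  proof eventually_elim
    case (elim m)
    show ?case
    proof safe
      fix p assume p: "mass_tree p"
      have \<phi>m: "\<phi> \<in> borel_measurable borel" using \<phi> by (rule borel_measurable_continuous_onI)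
      have i1: "integrable unit_interval (\<lambda>u. \<phi> (digit_limit v p u))"
        using B norm_limpt by (intro unit_interval.integrable_const_bound[where B = B] measurable_compose[OF digit_limit_measurable[OF p] \<phi>m]) auto
      note w = integral_words[OF prob_space_unit_interval interval_word_measurable[OF p] length_interval_word, of "\<lambda>w. \<phi> (digit_point v w)" m]
      have "(\<Sum>w\<in>words m. p w * \<phi> (digit_point v w)) = (\<integral>u. \<phi> (digit_point v (interval_word p m u)) \<partial>unit_interval)"
        unfolding w(1)
      proof (intro sum.cong refl)
        fix w assume "w \<in> words m"
        then show "p w * \<phi> (digit_point v w) = measure unit_interval (interval_word p m -` {w} \<inter> space unit_interval) * \<phi> (digit_point v w)"
          using measure_interval_word[OF p, of m w] by (simp only: mem_Collect_eq if_True simp_thms)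
      qed
      then have "dist (\<Sum>w\<in>words m. p w * \<phi> (digit_point v w)) (\<integral>u. \<phi> (digit_limit v p u) \<partial>unit_interval)
         = \<bar>\<integral>u. \<phi> (digit_point v (interval_word p m u)) - \<phi> (digit_limit v p u) \<partial>unit_interval\<bar>"
        using i1 w(2) by (simp add: dist_real_def)
      also have "\<dots> \<le> (\<integral>u. \<bar>\<phi> (digit_point v (interval_word p m u)) - \<phi> (digit_limit v p u)\<bar> \<partial>unit_interval)"
        by (rule integral_abs_bound)
      also have "\<dots> \<le> (\<integral>u. e / 2 \<partial>unit_interval)"
      proof (rule integral_mono)
        show "integrable unit_interval (\<lambda>u. \<bar>\<phi> (digit_point v (interval_word p m u)) - \<phi> (digit_limit v p u)\<bar>)" using i1 w(2) by auto
        fix u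
        have "dist (digit_point v (interval_word p m u)) (digit_limit v p u) < d"
          using digit_limit_approx[of p u m] elim by (simp add: dist_norm norm_minus_commute)
        then show "\<bar>\<phi> (digit_point v (interval_word p m u)) - \<phi> (digit_limit v p u)\<bar> \<le> e / 2"
          using d(2)[of "digit_limit v p u" "digit_point v (interval_word p m u)"] norm_digit_point norm_limpt by (simp add: dist_real_def)
      qed simp
      also have "\<dots> = e / 2" using unit_interval.prob_space by simp
      finally show "dist (\<Sum>w\<in>words m. p w * \<phi> (digit_point v w)) (\<integral>u. \<phi> (digit_limit v p u) \<partial>unit_interval) < e" using e by simp
    qed
  qed
qed

text \<open>The sums over words of fixed length depend on finitely many coordinates of
  \<open>p\<close>, hence are continuous, and a uniform limit of them is continuous.\<close>

lemma law_continuous: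
  fixes \<phi> :: "'e \<Rightarrow> real"
  assumes \<phi>: "continuous_on UNIV \<phi>"
  shows "continuous_on {p. mass_tree p} (\<lambda>p. \<integral>u. \<phi> (digit_limit v p u) \<partial>unit_interval)"
proof (rule uniform_limit_theorem)
  show "uniform_limit {p. mass_tree p} (\<lambda>m p. \<Sum>w\<in>words m. p w * \<phi> (digit_point v w)) (\<lambda>p. \<integral>u. \<phi> (digit_limit v p u) \<partial>unit_interval) sequentially"
    unfolding uniform_limit_iff using law_approx[OF \<phi>] by simp
  show "\<forall>\<^sub>F m in sequentially. continuous_on {p. mass_tree p} (\<lambda>p. \<Sum>w\<in>words m. p w * \<phi> (digit_point v w))"
    by (intro always_eventually allI continuous_intros continuous_on_subset[OF continuous_on_product_coordinates]) auto
qed simp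

end

text \<open>The open unit cube is mapped onto \<open>\<real>\<^sup>d\<close>, everything else to the point at infinity.\<close>

definition chart :: "real^'d::finite \<Rightarrow> 'd cpt" where
  "chart y = (if \<forall>i. 0 < y $ i \<and> y $ i < 1 then Some (\<chi> i. tan (pi * (y $ i - 1 / 2))) else None)"

text \<open>A measurable right inverse of \<open>chart\<close>. Infinity is sent to the corner
  \<open>0\<close>, a boundary point of the cube.\<close>

definition unchart :: "'d::finite cpt \<Rightarrow> real^'d" where
  "unchart z = (case z of None \<Rightarrow> 0 | Some x \<Rightarrow> (\<chi> i. 1 / 2 + arctan (x $ i) / pi))"

lemma unchart_bounds: "0 < unchart (Some x) $ i" "unchart (Some x) $ i < 1"
proof -
  have "- (pi / 2) < arctan (x $ i)" "arctan (x $ i) < pi / 2" using arctan_bounded[of "x $ i"] by auto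
  then show "0 < unchart (Some x) $ i" "unchart (Some x) $ i < 1"
    unfolding unchart_def by (auto simp: field_simps)
qed

lemma unchart_range: "0 \<le> unchart z $ i" "unchart z $ i < 1"
  using unchart_bounds[of _ i] by (cases z; simp add: unchart_def less_imp_le)+

lemma chart_unchart: "chart (unchart z) = z"
proof (cases z)
  case None then show ?thesis by (simp add: unchart_def chart_def)
next
  case (Some x)
  have "tan (pi * (unchart (Some x) $ i - 1 / 2)) = x $ i" for i
    by (simp add: unchart_def tan_arctan)
  then show ?thesis using unchart_bounds[of x] by (simp add: Some chart_def)
qed

lemma unchart_chart:
  assumes "\<forall>i. 0 < y $ i \<and> y $ i < 1" shows "unchart (chart y) = y"
proof -
  have "arctan (tan (pi * (y $ i - 1 / 2))) = pi * (y $ i - 1 / 2)" for i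
  proof (rule arctan_tan)
    have "0 < y $ i" "y $ i < 1" using assms by auto
    then show "- (pi / 2) < pi * (y $ i - 1 / 2)" "pi * (y $ i - 1 / 2) < pi / 2" by (auto simp: field_simps)
  qed
  then show ?thesis using assms by (simp add: chart_def unchart_def vec_eq_iff)
qed

text \<open>If \<open>U\<close> misses infinity, its preimage lies in the open cube, where the
  tangents are continuous. If \<open>U\<close> contains infinity, the complement of its preimage is
  the image of a compact set under the continuous finite part of \<open>unchart\<close>, hence
  closed.\<close>

lemma chart_continuous: "continuous_map euclidean cpt_top (chart :: real^'d::finite \<Rightarrow> _)"
  unfolding continuous_map_def
proof (intro conjI allI impI)
  show "chart \<in> topspace euclidean \<rightarrow> topspace cpt_top" by simp
  fix U :: "'d cpt set" assume "openin cpt_top U"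
  then have U: "open (Some -` U)" "None \<in> U \<Longrightarrow> compact (- (Some -` U))" by (auto simp: openin_cpt_top cpt_open_def)
  let ?B = "{y :: real^'d. \<forall>i. 0 < y $ i \<and> y $ i < 1}" and ?\<psi> = "\<lambda>y :: real^'d. (\<chi> i. tan (pi * (y $ i - 1 / 2)))"
  have "open (chart -` U)"
  proof (cases "None \<in> U")
    case False
    have "?B = (\<Inter>i. {y. 0 < y $ i \<and> y $ i < 1})" by auto
    moreover have "open {y :: real^'d. 0 < y $ i \<and> y $ i < 1}" for i
      by (intro open_Collect_conj open_Collect_less continuous_intros)
    ultimately have oB: "open ?B" by (simp add: open_INT)
    have "continuous_on ?B (\<lambda>y. tan (pi * (y $ i - 1 / 2)))" for i
      unfolding tan_def
    proof (intro continuous_on_divide continuous_intros)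
      show "\<forall>y\<in>?B. cos (pi * (y $ i - 1 / 2)) \<noteq> 0"
      proof
        fix y :: "real^'d" assume "y \<in> ?B"
        then have "0 < y $ i" "y $ i < 1" by auto
        then have "cos (pi * (y $ i - 1 / 2)) > 0" by (intro cos_gt_zero_pi) (auto simp: field_simps)
        then show "cos (pi * (y $ i - 1 / 2)) \<noteq> 0" by simp
      qed
    qed auto
    then have c: "continuous_on ?B ?\<psi>" by (intro continuous_on_vec_lambda)
    have "chart -` U = ?\<psi> -` (Some -` U) \<inter> ?B"
      using False by (auto simp: chart_def split: if_splits)
    then show ?thesis using c oB U(1) by (simp add: continuous_on_open_vimage)
  next
    case True
    let ?C = "- (Some -` U)"
    have "continuous_on ?C (\<lambda>x :: real^'d. unchart (Some x))"
      unfolding unchart_def by (auto intro!: continuous_intros continuous_on_vec_lambda)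
    then have "compact ((\<lambda>x. unchart (Some x)) ` ?C)" using U(2)[OF True] by (rule compact_continuous_image)
    moreover have "- (chart -` U) = (\<lambda>x. unchart (Some x)) ` ?C"
    proof (intro set_eqI iffI)
      fix y assume "y \<in> - (chart -` U)"
      then have y: "chart y \<notin> U" by simp
      then obtain x where x: "chart y = Some x" using True by (cases "chart y") auto
      then have "y = unchart (Some x)" using unchart_chart[of y] by (auto simp: chart_def split: if_splits)
      then show "y \<in> (\<lambda>x. unchart (Some x)) ` ?C" using x y by auto
    qed (auto simp: chart_unchart)
    ultimately show ?thesis by (metis compact_imp_closed closed_Compl double_complement closed_def)
  qed
  then show "openin euclidean {x \<in> topspace euclidean. chart x \<in> U}" by (simp add: vimage_def)
qed

lemma compact_space_cpt_top: "compact_space (cpt_top :: 'd::finite cpt topology)"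
proof -
  let ?K = "cbox 0 (\<chi> i. 1) :: (real^'d) set"
  have "chart ` ?K = UNIV"
  proof -
    have "unchart z \<in> ?K" for z :: "'d cpt"
      using unchart_range[of z] by (auto simp: mem_box_cart less_imp_le)
    then show ?thesis by (metis UNIV_eq_I chart_unchart image_eqI)
  qed
  then show ?thesis
    using image_compactin[OF _ chart_continuous, of ?K] unfolding compact_space_def by simp
qed

lemma unchart_measurable: "unchart \<in> borel_measurable (borel_cpt :: 'd::finite cpt measure)"
proof (subst borel_measurable_euclidean_space, rule ballI)
  fix b :: "real^'d" assume "b \<in> Basis"
  then obtain i where b: "b = axis i 1" by (auto simp: Basis_vec_def)
  have "(\<lambda>z. unchart z \<bullet> b) = case_option 0 (\<lambda>x. 1 / 2 + arctan (x $ i) / pi)"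
    by (rule ext) (simp add: unchart_def b inner_axis split: option.split)
  moreover have "\<dots> \<in> borel_measurable (borel_cpt :: 'd cpt measure)"
    by (rule case_option_measurable) (auto intro!: continuous_intros)
  ultimately show "(\<lambda>z. unchart z \<bullet> b) \<in> borel_measurable borel_cpt" by simp
qed


section \<open>Binary digits of points of the compactification\<close>

fun bit_word :: "(nat \<Rightarrow> bool) \<Rightarrow> nat \<Rightarrow> bool list" where
  "bit_word b 0 = []" | "bit_word b (Suc m) = b m # bit_word b m"

lemma length_bit_word: "length (bit_word b m) = m" by (induction m) auto

lemma digit_point_bit_word: "digit_point v (bit_word b m) = (\<Sum>k<m. if b k then v k else 0)"
  by (induction m) (auto simp: length_bit_word)

definition coord_of :: "nat \<Rightarrow> 'd::finite" where
  "coord_of = (SOME h. bij_betw h {0..<CARD('d)} UNIV)"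

lemma bij_coord_of: "bij_betw (coord_of :: nat \<Rightarrow> 'd::finite) {0..<CARD('d)} UNIV"
  unfolding coord_of_def by (rule someI_ex[OF ex_bij_betw_nat_finite[OF finite]])

text \<open>The bits are dealt to the coordinates in turn: \<open>k mod d\<close> selects the
  coordinate and \<open>k div d + 1\<close> the binary place within it.\<close>

definition digit_vec :: "nat \<Rightarrow> real^'d::finite" where
  "digit_vec k = (1 / 2 ^ (k div CARD('d) + 1)) *\<^sub>R axis (coord_of (k mod CARD('d))) 1"

text \<open>The matching binary digit of that coordinate of \<open>unchart z\<close>, read off as
  the parity of a floor.\<close>

definition chart_bits :: "'d::finite cpt \<Rightarrow> nat \<Rightarrow> bool" where
  "chart_bits z k \<longleftrightarrow> odd \<lfloor>2 ^ (k div CARD('d) + 1) * unchart z $ coord_of (k mod CARD('d))\<rfloor>"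

lemma sum_div_mod:
  fixes f :: "nat \<Rightarrow> nat \<Rightarrow> 'a::comm_monoid_add"
  assumes "d > 0"
  shows "(\<Sum>k<r * d. f (k div d) (k mod d)) = (\<Sum>j<r. \<Sum>c\<in>{0..<d}. f j c)"
proof -
  have "(\<Sum>k\<in>{j * d..<j * d + d}. f (k div d) (k mod d)) = (\<Sum>c\<in>{0..<d}. f j c)" for j
  proof (rule sum.reindex_bij_witness[where i = "\<lambda>c. j * d + c" and j = "\<lambda>k. k - j * d"])
    fix k assume k: "k \<in> {j * d..<j * d + d}"
    then obtain c where "k = j * d + c" "c < d" by (auto simp: le_iff_add)
    then show "f j (k - j * d) = f (k div d) (k mod d)" using assms by simp
  qed auto
  then show ?thesis unfolding sum.nat_group[symmetric] by simp
qed

lemma summable_digit_vec: "summable (\<lambda>k. norm (digit_vec k :: real^'d::finite))"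
proof (rule bounded_imp_summable)
  let ?d = "CARD('d)"
  fix n
  have "(\<Sum>k\<le>n. norm (digit_vec k :: real^'d)) \<le> (\<Sum>k<Suc n * ?d. norm (digit_vec k :: real^'d))"
  proof (rule sum_mono2)
    have "1 \<le> ?d" by (simp add: Suc_le_eq)
    then have "Suc n * 1 \<le> Suc n * ?d" by (intro mult_le_mono2)
    then show "{..n} \<subseteq> {..<Suc n * ?d}"
      by (intro subsetI) (simp only: atMost_iff lessThan_iff mult_1_right less_Suc_eq_le[symmetric] less_le_trans)
  qed auto
  also have "\<dots> = (\<Sum>j<Suc n. \<Sum>c\<in>{0..<?d}. 1 / 2 ^ (j + 1))"
    by (subst sum_div_mod[symmetric]) (auto simp: digit_vec_def)
  also have "\<dots> = real ?d * (\<Sum>j<Suc n. 1 / 2 ^ (j + 1))"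
    by (simp add: sum_distrib_left del: sum.lessThan_Suc)
  also have "(\<Sum>j<Suc n. 1 / 2 ^ (j + 1)) \<le> (1 :: real)"
  proof -
    have "(\<Sum>j<m. 1 / 2 ^ (j + 1)) = (1 :: real) - 1 / 2 ^ m" for m
      by (induction m) (auto simp: field_simps)
    then show ?thesis by (simp del: sum.lessThan_Suc)
  qed
  finally show "(\<Sum>k\<le>n. norm (digit_vec k :: real^'d)) \<le> real ?d" by (simp add: mult_left_le)
qed auto

lemma binary_expansion:
  fixes x :: real
  assumes "0 \<le> x" "x < 1"
  shows "(\<Sum>j<r. if odd \<lfloor>2 ^ (j + 1) * x\<rfloor> then 1 / 2 ^ (j + 1) else 0) = real_of_int \<lfloor>2 ^ r * x\<rfloor> / 2 ^ r"
proof (induction r)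
  case 0 then show ?case using assms by (simp add: floor_eq_iff)
next
  case (Suc r)
  let ?y = "2 ^ r * x"
  have "\<lfloor>2 * ?y\<rfloor> = 2 * \<lfloor>?y\<rfloor> \<or> \<lfloor>2 * ?y\<rfloor> = 2 * \<lfloor>?y\<rfloor> + 1" by linarith
  then have "real_of_int \<lfloor>2 * ?y\<rfloor> = 2 * \<lfloor>?y\<rfloor> + (if odd \<lfloor>2 * ?y\<rfloor> then 1 else 0)" by auto
  then show ?case using Suc by (auto simp: mult.assoc add_divide_distrib)
qed

text \<open>At depth \<open>r * d\<close> every coordinate has received exactly \<open>r\<close>
  bits, so the point is \<open>unchart z\<close> truncated to \<open>r\<close> binary
  places.\<close>

lemma digit_point_chart_bits_limit: "(\<lambda>r. digit_point digit_vec (bit_word (chart_bits z) (r * CARD('d)))) \<longlonglongrightarrow> unchart (z :: 'd::finite cpt)"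
proof (rule vec_tendstoI)
  fix i :: 'd
  let ?d = "CARD('d)" and ?x = "unchart z $ i"
  have e: "digit_point digit_vec (bit_word (chart_bits z) (r * ?d)) $ i = real_of_int \<lfloor>2 ^ r * ?x\<rfloor> / 2 ^ r" for r
  proof -
    let ?g = "\<lambda>j c. if odd \<lfloor>2 ^ (j + 1) * unchart z $ coord_of c\<rfloor> then (1 / 2 ^ (j + 1)) * (if coord_of c = i then 1 else 0) else (0 :: real)"
    have "digit_point digit_vec (bit_word (chart_bits z) (r * ?d)) $ i = (\<Sum>k<r * ?d. ?g (k div ?d) (k mod ?d))"
      unfolding digit_point_bit_word by (simp, intro sum.cong refl) (auto simp: chart_bits_def digit_vec_def axis_def)
    also have "\<dots> = (\<Sum>j<r. \<Sum>c\<in>{0..<?d}. ?g j c)"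
      by (rule sum_div_mod) simp
    also have "\<dots> = (\<Sum>j<r. if odd \<lfloor>2 ^ (j + 1) * ?x\<rfloor> then 1 / 2 ^ (j + 1) else 0)"
    proof (rule sum.cong[OF refl])
      fix j
      have "(\<Sum>c\<in>{0..<?d}. ?g j c) = (\<Sum>l\<in>UNIV. if odd \<lfloor>2 ^ (j + 1) * unchart z $ l\<rfloor> then (1 / 2 ^ (j + 1)) * (if l = i then 1 else 0) else 0)"
        by (rule sum.reindex_bij_betw[OF bij_coord_of])
      also have "\<dots> = (\<Sum>l\<in>UNIV. if l = i then (if odd \<lfloor>2 ^ (j + 1) * ?x\<rfloor> then 1 / 2 ^ (j + 1) else 0) else 0)"
        by (intro sum.cong) auto
      finally show "(\<Sum>c\<in>{0..<?d}. ?g j c) = (if odd \<lfloor>2 ^ (j + 1) * ?x\<rfloor> then 1 / 2 ^ (j + 1) else 0)" by simp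
    qed
    also have "\<dots> = real_of_int \<lfloor>2 ^ r * ?x\<rfloor> / 2 ^ r"
      using unchart_range[of z i] by (rule binary_expansion)
    finally show ?thesis .
  qed
  have "(\<lambda>r. real_of_int \<lfloor>2 ^ r * ?x\<rfloor> / 2 ^ r) \<longlonglongrightarrow> ?x"
  proof (rule tendsto_sandwich)
    show "\<forall>\<^sub>F r in sequentially. ?x - 1 / 2 ^ r \<le> real_of_int \<lfloor>2 ^ r * ?x\<rfloor> / 2 ^ r"
    proof (intro always_eventually allI)
      fix r :: nat
      have "2 ^ r * ?x - 1 \<le> real_of_int \<lfloor>2 ^ r * ?x\<rfloor>" by linarith
      then have "(2 ^ r * ?x - 1) / 2 ^ r \<le> real_of_int \<lfloor>2 ^ r * ?x\<rfloor> / 2 ^ r" by (rule divide_right_mono) simp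
      then show "?x - 1 / 2 ^ r \<le> real_of_int \<lfloor>2 ^ r * ?x\<rfloor> / 2 ^ r" by (simp add: diff_divide_distrib)
    qed
    show "\<forall>\<^sub>F r in sequentially. real_of_int \<lfloor>2 ^ r * ?x\<rfloor> / 2 ^ r \<le> ?x"
      by (intro always_eventually allI) (simp add: field_simps)
    have "(\<lambda>r. (1/2 :: real) ^ r) \<longlonglongrightarrow> 0" by (rule LIMSEQ_power_zero) simp
    then show "(\<lambda>r. ?x - 1 / 2 ^ r) \<longlonglongrightarrow> ?x" using tendsto_diff[OF tendsto_const, of _ 0] by (fastforce simp: power_one_over)
  qed simp
  then show "(\<lambda>r. digit_point digit_vec (bit_word (chart_bits z) (r * ?d)) $ i) \<longlonglongrightarrow> ?x" unfolding e .
qed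

lemma chart_bits_measurable: "{z. chart_bits (z :: 'd::finite cpt) k} \<in> sets borel_cpt"
proof -
  have m: "(\<lambda>z :: 'd cpt. unchart z $ i) \<in> borel_measurable borel_cpt" for i
    by (rule measurable_compose[OF unchart_measurable]) (auto intro: borel_measurable_continuous_onI continuous_intros)
  have [measurable]: "(\<lambda>z :: 'd cpt. \<lfloor>2 ^ (k div CARD('d) + 1) * unchart z $ coord_of (k mod CARD('d))\<rfloor>) \<in> measurable borel_cpt (count_space UNIV)"
    using m by measurable
  have "{z \<in> space (borel_cpt :: 'd cpt measure). chart_bits z k} \<in> sets borel_cpt"
    unfolding chart_bits_def by measurable
  then show ?thesis by (simp add: space_borel_of)
qed

lemma bit_word_measurable: "(\<lambda>z :: 'd::finite cpt. bit_word (chart_bits z) m) \<in> measurable borel_cpt (count_space UNIV)"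
proof (induction m)
  case (Suc m)
  have "(\<lambda>z :: 'd cpt. chart_bits z m) \<in> measurable borel_cpt (count_space UNIV)"
    using chart_bits_measurable[of m, where 'd = 'd] by (simp add: pred_def space_borel_of)
  then have "(\<lambda>z :: 'd cpt. (chart_bits z m, bit_word (chart_bits z) m)) \<in> measurable borel_cpt (count_space UNIV \<Otimes>\<^sub>M count_space UNIV)"
    using Suc by (rule measurable_Pair)
  then have "(\<lambda>z :: 'd cpt. (chart_bits z m, bit_word (chart_bits z) m)) \<in> measurable borel_cpt (count_space UNIV)"
    by (simp add: pair_measure_countable)
  then show ?case by (auto dest: measurable_compose[where g = "\<lambda>(a, b). a # b" and L = "count_space UNIV"])
qed simp

definition law_of :: "(bool list \<Rightarrow> real) \<Rightarrow> 'd::finite cpt measure" where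
  "law_of p = distr unit_interval borel_cpt (\<lambda>u. chart (digit_limit digit_vec p u))"

lemma continuous_chart:
  "continuous_map cpt_top euclideanreal f \<Longrightarrow> continuous_on UNIV (\<lambda>y. f (chart y))"
  using continuous_map_compose[OF chart_continuous, of euclideanreal f] by (simp add: o_def)

lemma chart_measurable: "chart \<in> measurable borel (borel_cpt :: 'd::finite cpt measure)"
proof (rule measurable_sigma_sets[OF sets_borel_of])
  fix U :: "'d cpt set" assume "U \<in> {U. openin cpt_top U}"
  then have "openin euclidean {x \<in> topspace euclidean. chart x \<in> U}"
    using chart_continuous unfolding continuous_map_def by blast
  then show "chart -` U \<inter> space borel \<in> sets borel" by (simp add: vimage_def)
qed (auto dest: openin_subset)

lemma law_of_measurable: "mass_tree p \<Longrightarrow> (\<lambda>u. chart (digit_limit digit_vec p u)) \<in> measurable unit_interval borel_cpt"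
  by (rule measurable_compose[OF digit_limit_measurable[OF summable_digit_vec] chart_measurable])

lemma law_of_M1: "mass_tree p \<Longrightarrow> law_of p \<in> M1"
  unfolding M1_def law_of_def
  using prob_space.prob_space_distr[OF prob_space_unit_interval law_of_measurable] by auto

lemma integral_lawof:
  assumes "mass_tree p" "continuous_map cpt_top euclideanreal f"
  shows "(\<integral>z. f z \<partial>law_of p) = (\<integral>u. f (chart (digit_limit digit_vec p u)) \<partial>unit_interval)"
  unfolding law_of_def by (rule integral_distr[OF law_of_measurable[OF assms(1)] borel_of_measurable[OF assms(2)]])

lemma law_of_continuous: "continuous_map (top_of_set {p. mass_tree p}) weak_top law_of"
  unfolding weak_top_def
proof (rule continuous_on_generated_topo)
  fix W :: "'a cpt measure set"
  assume "W \<in> {{\<nu> \<in> M1. (\<integral>x. f x \<partial>\<nu>) \<in> U} | f U. continuous_map cpt_top euclideanreal f \<and> open U}"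
  then obtain f U where W: "W = {\<nu> \<in> M1. (\<integral>x. f x \<partial>\<nu>) \<in> U}" and f: "continuous_map cpt_top euclideanreal f" and U: "open U"
    by blast
  let ?L = "\<lambda>p. \<integral>u. f (chart (digit_limit digit_vec p u)) \<partial>unit_interval"
  have "continuous_on {p. mass_tree p} ?L"
    by (rule law_continuous[OF summable_digit_vec continuous_chart[OF f]])
  then have "openin (top_of_set {p. mass_tree p}) ({p. mass_tree p} \<inter> ?L -` U)"
    using U by (rule continuous_openin_preimage_gen)
  moreover have "law_of -` W \<inter> topspace (top_of_set {p. mass_tree p}) = {p. mass_tree p} \<inter> ?L -` U"
    using law_of_M1 integral_lawof[OF _ f] by (auto simp: W)
  ultimately show "openin (top_of_set {p. mass_tree p}) (law_of -` W \<inter> topspace (top_of_set {p. mass_tree p}))" by simp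
next
  have "(M1 :: 'a cpt measure set) \<in> {{\<nu> \<in> M1. (\<integral>x. f x \<partial>\<nu>) \<in> U} | f (U :: real set). continuous_map cpt_top euclideanreal f \<and> open U}"
    by (intro CollectI exI[of _ "\<lambda>_. 0"] exI[of _ UNIV]) auto
  from Union_upper[OF this]
  show "law_of ` topspace (top_of_set {p. mass_tree p}) \<subseteq> \<Union>{{\<nu> \<in> M1. (\<integral>x. f x \<partial>\<nu>) \<in> U} | f (U :: real set). continuous_map (cpt_top :: 'a cpt topology) euclideanreal f \<and> open U}"
    by (rule order_trans[rotated]) (use law_of_M1 in auto)
qed

text \<open>Let \<open>p w\<close> be the mass under \<open>\<nu>\<close> of the points whose first
  digits form \<open>w\<close>. The same sums over words then have two limits: the integral under
  \<open>law_of p\<close> by \<open>law_approx\<close>, and the integral under \<open>\<nu>\<close>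
  because the digits of \<open>z\<close> converge to \<open>unchart z\<close>.\<close>

lemma law_of_surj:
  assumes \<nu>: "\<nu> \<in> (M1 :: 'd::finite cpt measure set)"
  shows "\<exists>p. mass_tree p \<and> law_of p = \<nu>"
proof -
  interpret prob_space \<nu> by (rule M1_D(3)[OF \<nu>])
  have sp: "space \<nu> = UNIV" by (rule M1_D(2)[OF \<nu>])
  let ?X = "\<lambda>m (z :: 'd cpt). bit_word (chart_bits z) m"
  have X: "?X m \<in> measurable \<nu> (count_space UNIV)" for m
    using bit_word_measurable measurable_cong_sets[OF M1_D(1)[OF \<nu>] refl] by blast
  define p where "p w = measure \<nu> (?X (length w) -` {w})" for w
  have S: "?X m -` {w} \<in> sets \<nu>" for m w using measurable_sets[OF X, of "{w}" m] by (simp add: sp)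
  have mt: "mass_tree p"
    unfolding mass_tree_def
  proof (intro conjI allI)
    have "?X 0 -` {[]} = UNIV" by auto
    then show "p [] = 1" using prob_space sp by (simp add: p_def)
    fix w show "0 \<le> p w" by (simp add: p_def)
    have "?X (length w) -` {w} = ?X (Suc (length w)) -` {False # w} \<union> ?X (Suc (length w)) -` {True # w}" by auto
    moreover have "?X (Suc (length w)) -` {False # w} \<inter> ?X (Suc (length w)) -` {True # w} = {}" by auto
    ultimately show "p w = p (False # w) + p (True # w)"
      unfolding p_def using finite_measure_Union[OF S[of "Suc (length w)" "False # w"] S[of "Suc (length w)" "True # w"]] by simp
  qed
  have "law_of p = \<nu>"
  proof (rule M1_eqI[OF law_of_M1[OF mt] \<nu>])
    fix f :: "'d cpt \<Rightarrow> real" assume f: "continuous_map cpt_top euclideanreal f"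
    let ?\<phi> = "\<lambda>y. f (chart y)"
    note \<phi> = continuous_chart[OF f]
    have \<phi>m: "?\<phi> \<in> borel_measurable borel" using \<phi> by (rule borel_measurable_continuous_onI)
    let ?K = "cball (0 :: real^'d) (\<Sum>k. norm (digit_vec k :: real^'d))"
    have "compact (?\<phi> ` ?K)"
      by (rule compact_continuous_image[OF continuous_on_subset[OF \<phi>]]) auto
    then obtain B where "\<And>x. x \<in> ?K \<Longrightarrow> norm (?\<phi> x) \<le> B"
      using compact_imp_bounded bounded_iff by (metis imageI)
    then have B: "norm (?\<phi> (digit_point digit_vec w)) \<le> B" for w using norm_digit_point[OF summable_digit_vec[where 'd = 'd], of w] by simp
    have 1: "(\<lambda>m. \<Sum>w\<in>words m. p w * ?\<phi> (digit_point digit_vec w)) \<longlonglongrightarrow> (\<integral>z. f z \<partial>law_of p)"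
      unfolding integral_lawof[OF mt f] tendsto_iff
      using law_approx[OF summable_digit_vec \<phi>] mt by (fastforce elim: eventually_mono)
    have "(\<Sum>w\<in>words m. p w * ?\<phi> (digit_point digit_vec w)) = (\<integral>z. ?\<phi> (digit_point digit_vec (?X m z)) \<partial>\<nu>)" for m
      using integral_words(1)[OF prob_space_axioms X length_bit_word, of "\<lambda>w. ?\<phi> (digit_point digit_vec w)" m]
      by (simp add: p_def sp)
    with 1 have 1: "(\<lambda>m. \<integral>z. ?\<phi> (digit_point digit_vec (?X m z)) \<partial>\<nu>) \<longlonglongrightarrow> (\<integral>z. f z \<partial>law_of p)" by simp
    have "(\<lambda>r. \<integral>z. ?\<phi> (digit_point digit_vec (?X (r * CARD('d)) z)) \<partial>\<nu>) \<longlonglongrightarrow> (\<integral>z. ?\<phi> (unchart z) \<partial>\<nu>)"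
    proof (rule integral_dominated_convergence[where w = "\<lambda>_. B"])
      show "(\<lambda>z. ?\<phi> (unchart z)) \<in> borel_measurable \<nu>"
        unfolding M1_measurable[OF \<nu>] by (rule measurable_compose[OF unchart_measurable \<phi>m])
      show "(\<lambda>z. ?\<phi> (digit_point digit_vec (?X (r * CARD('d)) z))) \<in> borel_measurable \<nu>" for r
        by (rule measurable_compose[OF X]) simp
      show "AE z in \<nu>. (\<lambda>r. ?\<phi> (digit_point digit_vec (?X (r * CARD('d)) z))) \<longlonglongrightarrow> ?\<phi> (unchart z)"
        using continuous_on_tendsto_compose[OF \<phi> digit_point_chart_bits_limit] by simp
      show "AE z in \<nu>. norm (?\<phi> (digit_point digit_vec (?X (r * CARD('d)) z))) \<le> B" for r using B by simp
    qed simp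
    \<comment> \<open>The convergence for all depths is restricted to the multiples of the
      dimension, where convergence of the digits is known.\<close>
    moreover have "(\<lambda>r. \<integral>z. ?\<phi> (digit_point digit_vec (?X (r * CARD('d)) z)) \<partial>\<nu>) \<longlonglongrightarrow> (\<integral>z. f z \<partial>law_of p)"
    proof -
      have "strict_mono (\<lambda>r. r * CARD('d))" by (rule strict_monoI) simp
      from LIMSEQ_subseq_LIMSEQ[OF 1 this] show ?thesis by (simp add: o_def)
    qed
    ultimately have "(\<integral>z. ?\<phi> (unchart z) \<partial>\<nu>) = (\<integral>z. f z \<partial>law_of p)" by (rule LIMSEQ_unique)
    then show "(\<integral>z. f z \<partial>law_of p) = (\<integral>z. f z \<partial>\<nu>)" by (simp add: chart_unchart)
  qed
  with mt show ?thesis by blast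
qed

lemma compact_space_weak_top: "compact_space (weak_top :: 'd::finite cpt measure topology)"
proof -
  have "compactin weak_top (law_of ` {p. mass_tree p} :: 'd cpt measure set)"
    using image_compactin[OF _ law_of_continuous, of "{p. mass_tree p}"] compact_mass_tree
    by (simp add: compactin_subtopology)
  moreover have "law_of ` {p. mass_tree p} = (M1 :: 'd cpt measure set)"
    using law_of_M1 law_of_surj by (auto simp: image_iff)
  ultimately show ?thesis by (simp add: compact_space_def topspace_weak_top)
qed


section \<open>From moments to weak convergence\<close>

lemma space_ISE:
  assumes "sets (Q :: 'd::finite cpt measure measure) = sets (borel_of weak_top)"
  shows "space Q = M1"
  using sets_eq_imp_space_eq[OF assms] by (simp add: space_borel_of topspace_weak_top)

lemma weak_top_measurable:
  assumes "sets (Q :: 'd::finite cpt measure measure) = sets (borel_of weak_top)"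
    and "continuous_map weak_top euclideanreal F"
  shows "F \<in> borel_measurable Q"
  using borel_of_measurable[OF assms(2)] measurable_cong_sets[OF assms(1) refl] by blast

text \<open>Measurability of \<open>\<nu>\<close> as a kernel, which the exchange of integrals
  against \<open>Q\<close> relies on. On a generator the mass is a limit of integrals of bumps, and
  these are continuous in \<open>\<nu>\<close>.\<close>

lemma ISE_kernel:
  assumes sQ: "sets (Q :: 'd::finite cpt measure measure) = sets (borel_of weak_top)"
  shows "(\<lambda>\<nu>. \<nu>) \<in> measurable Q (subprob_algebra borel_cpt)"
proof (rule measurable_subprob_algebra_generated[OF sets_borel_cpt_gens Int_stable_gens])
  have sp: "space Q = M1" by (rule space_ISE[OF sQ])
  show "subprob_space \<nu>" if "\<nu> \<in> space Q" for \<nu>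
    using that M1_D(3) unfolding sp by (intro prob_space_imp_subprob_space)
  show "sets \<nu> = sets borel_cpt" if "\<nu> \<in> space Q" for \<nu>
    using that M1_D(1) unfolding sp by blast
  have U: "emeasure \<nu> UNIV = 1" if "\<nu> \<in> space Q" for \<nu> :: "'d cpt measure"
    using that prob_space.emeasure_space_1[OF M1_D(3), of \<nu>] M1_D(2)[of \<nu>] unfolding sp by simp
  show U': "(\<lambda>\<nu>. emeasure \<nu> (UNIV :: 'd cpt set)) \<in> borel_measurable Q"
    by (subst measurable_cong[where g = "\<lambda>_. 1"]) (auto simp: U)
  show "(\<lambda>\<nu>. emeasure \<nu> A) \<in> borel_measurable Q" if A: "A \<in> compact_gens" for A :: "'d cpt set"
  proof -
    consider "A = UNIV" | "A = {}" | C where "A = Some ` C" "compact C" "C \<noteq> {}"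
      using A unfolding compact_gens_def by blast
    then show ?thesis
    proof cases
      case 1 then show ?thesis using U' by simp
    next
      case 3
      have "(\<lambda>\<nu>. measure \<nu> A) \<in> borel_measurable Q"
      proof (rule borel_measurable_LIMSEQ_real)
        show "(\<lambda>n. \<integral>z. bump C (Suc n) z \<partial>\<nu>) \<longlonglongrightarrow> measure \<nu> A" if "\<nu> \<in> space Q" for \<nu>
          using M1_bump_limit[of \<nu> C] that 3 unfolding sp by simp
        show "(\<lambda>\<nu>. \<integral>z. bump C (Suc n) z \<partial>\<nu>) \<in> borel_measurable Q" for n
          using 3 by (intro weak_top_measurable[OF sQ] weak_top_integral bump_continuous) auto
      qed
      then have "(\<lambda>\<nu>. ennreal (measure \<nu> A)) \<in> borel_measurable Q" by measurable
      moreover have "emeasure \<nu> A = ennreal (measure \<nu> A)" if "\<nu> \<in> space Q" for \<nu>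
        using that M1_D(3)[of \<nu>] unfolding sp
        by (simp add: finite_measure.emeasure_eq_measure prob_space.finite_measure)
      ultimately show ?thesis by (subst measurable_cong) auto
    qed simp
  qed
qed simp

section \<open>Measurability of characteristic functions in the measure and the frequency\<close>

definition finite_indicator :: "'d::finite cpt \<Rightarrow> real" where "finite_indicator = case_option 0 (\<lambda>_. 1)"
definition finite_value :: "'d::finite cpt \<Rightarrow> real^'d" where "finite_value = case_option 0 (\<lambda>x. x)"

lemma finite_indicator_measurable [measurable]: "finite_indicator \<in> borel_measurable borel_cpt"
  unfolding finite_indicator_def by (rule case_option_measurable) simp

lemma finite_value_measurable [measurable]: "(finite_value :: 'd::finite cpt \<Rightarrow> _) \<in> borel_measurable borel_cpt"
proof (subst borel_measurable_euclidean_space, rule ballI)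
  fix b :: "real^'d" assume "b \<in> Basis"
  have "(\<lambda>z. finite_value z \<bullet> b) = case_option 0 (\<lambda>x. x \<bullet> b)"
    by (rule ext) (simp add: finite_value_def split: option.split)
  moreover have "\<dots> \<in> borel_measurable (borel_cpt :: 'd cpt measure)"
    by (rule case_option_measurable) (intro continuous_intros)
  ultimately show "(\<lambda>z. finite_value z \<bullet> b) \<in> borel_measurable borel_cpt" by simp
qed

text \<open>The integrand of \<open>charfun_cpt\<close>, written as a composition of measurable
  pieces so that joint measurability in \<open>k\<close> and \<open>z\<close> follows.\<close>

definition cpt_cis :: "real^'d::finite \<Rightarrow> 'd cpt \<Rightarrow> complex" where
  "cpt_cis k z = of_real (finite_indicator z) * cis (k \<bullet> finite_value z)"

lemma charfun_cpt_cis: "charfun_cpt \<nu> k = (\<integral>z. cpt_cis k z \<partial>\<nu>)"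
proof -
  have "(\<lambda>x. case x of None \<Rightarrow> 0 | Some y \<Rightarrow> cis (k \<bullet> y)) = cpt_cis k"
    by (rule ext) (simp add: cpt_cis_def finite_indicator_def finite_value_def split: option.split)
  then show ?thesis by (simp add: charfun_cpt_def)
qed

lemma norm_cpt_cis: "norm (cpt_cis k z) \<le> 1"
  by (simp add: cpt_cis_def finite_indicator_def norm_mult split: option.split)

lemma cis_measurable [measurable]: "cis \<in> borel_measurable borel"
  by (intro borel_measurable_continuous_onI continuous_intros)

lemma cpt_cis_measurable [measurable]:
  "(\<lambda>(k, z). cpt_cis k z) \<in> borel_measurable (borel \<Otimes>\<^sub>M (borel_cpt :: 'd::finite cpt measure))"
  unfolding cpt_cis_def by measurable

lemma cpt_cis_measurable_M1:
  assumes "\<nu> \<in> (M1 :: 'd::finite cpt measure set)"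
  shows "cpt_cis k \<in> borel_measurable \<nu>"
  unfolding measurable_cong_sets[OF M1_D(1)[OF assms] refl] cpt_cis_def by measurable

lemma cpt_cis_integrable: "\<nu> \<in> M1 \<Longrightarrow> integrable \<nu> (cpt_cis k)"
proof -
  assume \<nu>: "\<nu> \<in> M1"
  interpret prob_space \<nu> by (rule M1_D(3)[OF \<nu>])
  show ?thesis
    by (rule integrable_const_bound[where B = 1]) (use norm_cpt_cis cpt_cis_measurable_M1[OF \<nu>] in auto)
qed

lemma norm_charfun: "\<nu> \<in> M1 \<Longrightarrow> norm (charfun_cpt \<nu> k) \<le> 1"
proof -
  assume \<nu>: "\<nu> \<in> M1"
  interpret prob_space \<nu> by (rule M1_D(3)[OF \<nu>])
  have "norm (charfun_cpt \<nu> k) \<le> (\<integral>z. norm (cpt_cis k z) \<partial>\<nu>)"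
    unfolding charfun_cpt_cis by (rule integral_norm_bound)
  also have "\<dots> \<le> (\<integral>z. 1 \<partial>\<nu>)"
    by (rule integral_mono) (use norm_cpt_cis cpt_cis_integrable[OF \<nu>] in auto)
  finally show ?thesis by (simp add: prob_space)
qed

text \<open>Real and imaginary parts are treated separately. Each is bounded by \<open>1\<close>, so
  adding \<open>1\<close> makes it nonnegative, and nonnegative integrals depend measurably on the
  kernel; the \<open>1\<close> is subtracted afterwards.\<close>

lemma charfun_measurable:
  assumes K: "K \<in> measurable M (subprob_algebra (borel_cpt :: 'd::finite cpt measure))"
    and KM1: "\<And>x. x \<in> space M \<Longrightarrow> K x \<in> M1"
    and k: "k \<in> borel_measurable M"
  shows "(\<lambda>x. charfun_cpt (K x) (k x)) \<in> borel_measurable M"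
proof -
  have part: "(\<lambda>x. \<integral>z. f (k x) z \<partial>K x) \<in> borel_measurable M"
    if f: "(\<lambda>(k, z). f k z) \<in> borel_measurable (borel \<Otimes>\<^sub>M (borel_cpt :: 'd cpt measure))" and b: "\<And>k z. \<bar>f k z\<bar> \<le> 1"
    for f :: "real^'d \<Rightarrow> 'd cpt \<Rightarrow> real"
  proof -
    note f[measurable] k[measurable]
    have "(\<lambda>(x, z). ennreal (1 + f (k x) z)) \<in> borel_measurable (M \<Otimes>\<^sub>M borel_cpt)" by measurable
    from nn_integral_measurable_subprob_algebra2[OF this K]
    have "(\<lambda>x. enn2real (\<integral>\<^sup>+z. ennreal (1 + f (k x) z) \<partial>K x) - 1) \<in> borel_measurable M" by measurable
    moreover have "enn2real (\<integral>\<^sup>+z. ennreal (1 + f (k x) z) \<partial>K x) - 1 = (\<integral>z. f (k x) z \<partial>K x)" if "x \<in> space M" for x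
    proof -
      note \<nu> = KM1[OF that]
      interpret prob_space "K x" by (rule M1_D(3)[OF \<nu>])
      have "f (k x) \<in> borel_measurable borel_cpt" by measurable
      then have fm: "f (k x) \<in> borel_measurable (K x)"
        unfolding measurable_cong_sets[OF M1_D(1)[OF \<nu>] refl] .
      then have "integrable (K x) (f (k x))"
        by (intro integrable_const_bound[where B = 1]) (use b in auto)
      moreover have "enn2real (\<integral>\<^sup>+z. ennreal (1 + f (k x) z) \<partial>K x) = (\<integral>z. 1 + f (k x) z \<partial>K x)"
      proof (rule integral_eq_nn_integral[symmetric])
        have "0 \<le> 1 + f (k x) z" for z using b[of "k x" z] by linarith
        then show "AE z in K x. 0 \<le> 1 + f (k x) z" by simp
      qed (use fm in measurable)
      ultimately show ?thesis by (simp add: prob_space)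
    qed
    ultimately show ?thesis by (subst measurable_cong[symmetric]) auto
  qed
  have "charfun_cpt (K x) (k x) = Complex (\<integral>z. Re (cpt_cis (k x) z) \<partial>K x) (\<integral>z. Im (cpt_cis (k x) z) \<partial>K x)" if "x \<in> space M" for x
    unfolding charfun_cpt_cis using cpt_cis_integrable[OF KM1[OF that]] by (simp add: complex_eq_iff)
  moreover have "(\<lambda>x. Complex (\<integral>z. Re (cpt_cis (k x) z) \<partial>K x) (\<integral>z. Im (cpt_cis (k x) z) \<partial>K x)) \<in> borel_measurable M"
  proof -
    have "\<bar>Re (cpt_cis k z)\<bar> \<le> 1" "\<bar>Im (cpt_cis k z)\<bar> \<le> 1" for k :: "real^'d" and z
      using abs_Re_le_cmod[of "cpt_cis k z"] abs_Im_le_cmod[of "cpt_cis k z"] norm_cpt_cis[of k z] by linarith+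
    then have "(\<lambda>x. \<integral>z. Re (cpt_cis (k x) z) \<partial>K x) \<in> borel_measurable M" "(\<lambda>x. \<integral>z. Im (cpt_cis (k x) z) \<partial>K x) \<in> borel_measurable M"
      by (auto intro!: part simp del: measurable_split_conv) measurable
    then show ?thesis unfolding borel_measurable_complex_iff by simp
  qed
  ultimately show ?thesis by (subst measurable_cong) auto
qed

section \<open>Gaussians as averages of characters over random frequencies\<close>

abbreviation gaussM :: "('d::finite \<Rightarrow> real) measure" where
  "gaussM \<equiv> PiM UNIV (\<lambda>_. std_normal_distribution)"

lemma prob_space_std_normal: "prob_space std_normal_distribution"
  using real_dist_normal_dist real_distribution.axioms(1) by blast

lemma prob_space_gaussM: "prob_space (gaussM :: ('d::finite \<Rightarrow> real) measure)"
  by (intro prob_space_PiM prob_space_std_normal)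

text \<open>A normal vector with variance \<open>2 * a\<close> per coordinate, so that its
  characteristic function at \<open>y\<close> is \<open>exp (- a * (norm y)^2)\<close>.\<close>

definition freq :: "real \<Rightarrow> ('d::finite \<Rightarrow> real) \<Rightarrow> real^'d" where
  "freq a \<omega> = sqrt (2 * a) *\<^sub>R (\<chi> i. \<omega> i)"

lemma freq_measurable [measurable]: "freq a \<in> borel_measurable (gaussM :: ('d::finite \<Rightarrow> real) measure)"
proof (subst borel_measurable_euclidean_space, rule ballI)
  fix b :: "real^'d" assume "b \<in> Basis"
  then obtain i where b: "b = axis i 1" by (auto simp: Basis_vec_def)
  have "(\<lambda>\<omega>. \<omega> i) \<in> measurable (gaussM :: ('d \<Rightarrow> real) measure) std_normal_distribution"
    by (rule measurable_component_singleton) simp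
  then have "(\<lambda>\<omega>. sqrt (2 * a) * \<omega> i) \<in> borel_measurable (gaussM :: ('d \<Rightarrow> real) measure)" by measurable
  then show "(\<lambda>\<omega>. freq a \<omega> \<bullet> b) \<in> borel_measurable gaussM" by (simp add: freq_def b inner_axis)
qed

lemma gaussian_fourier:
  fixes y :: "real^'d::finite"
  assumes a: "a > 0"
  shows "(\<integral>\<omega>. cis (freq a \<omega> \<bullet> y) \<partial>gaussM) = of_real (exp (- a * (norm y)\<^sup>2))"
proof -
  interpret product_sigma_finite "\<lambda>_::'d. std_normal_distribution"
    unfolding product_sigma_finite_def using prob_space_std_normal prob_space_imp_sigma_finite by blast
  interpret sn: prob_space std_normal_distribution by (rule prob_space_std_normal)
  have "cis (freq a \<omega> \<bullet> y) = (\<Prod>i\<in>UNIV. cis (sqrt (2 * a) * y $ i * \<omega> i))" for \<omega>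
  proof -
    have p: "(\<Prod>i\<in>I. cis (g i)) = cis (\<Sum>i\<in>I. g i)" if "finite I" for I and g :: "'d \<Rightarrow> real"
      using that by (induction I rule: finite_induct) (auto simp: cis_mult)
    show ?thesis unfolding p[OF finite] by (simp add: freq_def inner_vec_def sum_distrib_left mult_ac)
  qed
  then have "(\<integral>\<omega>. cis (freq a \<omega> \<bullet> y) \<partial>gaussM) = (\<integral>\<omega>. (\<Prod>i\<in>UNIV. cis (sqrt (2 * a) * y $ i * \<omega> i)) \<partial>gaussM)"
    by simp
  also have "\<dots> = (\<Prod>i\<in>UNIV. \<integral>x. cis (sqrt (2 * a) * y $ i * x) \<partial>std_normal_distribution)"
    by (rule product_integral_prod) (auto intro!: sn.integrable_const_bound[where B = 1])
  also have "\<dots> = (\<Prod>i\<in>UNIV. of_real (exp (- ((sqrt (2 * a) * y $ i)\<^sup>2) / 2)))"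
  proof -
    have "(\<integral>x. cis (c * x) \<partial>std_normal_distribution) = of_real (exp (- (c\<^sup>2) / 2))" for c
      using fun_cong[OF char_std_normal_distribution, of c] unfolding char_def by (simp add: cis_conv_exp)
    then show ?thesis by simp
  qed
  also have "\<dots> = of_real (\<Prod>i\<in>UNIV. exp (- a * (y $ i)\<^sup>2))"
    using a by (simp add: power_mult_distrib)
  also have "(\<Prod>i\<in>UNIV. exp (- a * (y $ i)\<^sup>2)) = exp (- a * (norm y)\<^sup>2)"
    by (simp add: exp_sum[symmetric] sum_distrib_left sum_negf power2_norm_eq_inner inner_vec_def flip: power2_eq_square)
  finally show ?thesis .
qed

text \<open>\<open>gaussian_fourier\<close> holds pointwise, and at infinity both sides are
  \<open>0\<close>. The integrand has modulus at most \<open>1\<close>, so Fubini exchanges the two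
  probability measures.\<close>

lemma integral_gaussian:
  fixes \<nu> :: "'d::finite cpt measure"
  assumes a: "a > 0" and \<nu>: "\<nu> \<in> M1"
  shows "complex_of_real (\<integral>z. gaussian a b z \<partial>\<nu>) = (\<integral>\<omega>. cis (- (freq a \<omega> \<bullet> b)) * charfun_cpt \<nu> (freq a \<omega>) \<partial>gaussM)"
proof -
  interpret \<nu>: prob_space \<nu> by (rule M1_D(3)[OF \<nu>])
  interpret G: prob_space "gaussM :: ('d \<Rightarrow> real) measure" by (rule prob_space_gaussM)
  interpret P: pair_prob_space "gaussM :: ('d \<Rightarrow> real) measure" \<nu> ..
  have e: "complex_of_real (gaussian a b z) = (\<integral>\<omega>. cis (- (freq a \<omega> \<bullet> b)) * cpt_cis (freq a \<omega>) z \<partial>gaussM)" for z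
  proof (cases z)
    case (Some x)
    have "cis (- (freq a \<omega> \<bullet> b)) * cpt_cis (freq a \<omega>) z = cis (freq a \<omega> \<bullet> (x - b))" for \<omega>
      by (simp add: Some cpt_cis_def finite_indicator_def finite_value_def cis_mult inner_diff_right)
    then show ?thesis using gaussian_fourier[OF a, of "x - b"] by (simp add: Some gaussian_def)
  qed (simp add: gaussian_def cpt_cis_def finite_indicator_def)
  have m: "(\<lambda>(\<omega>, z). cis (- (freq a \<omega> \<bullet> b)) * cpt_cis (freq a \<omega>) z) \<in> borel_measurable (gaussM \<Otimes>\<^sub>M \<nu>)"
    unfolding measurable_cong_sets[OF sets_pair_measure_cong[OF refl M1_D(1)[OF \<nu>]] refl] by measurable
  have "complex_of_real (\<integral>z. gaussian a b z \<partial>\<nu>) = (\<integral>z. (\<integral>\<omega>. cis (- (freq a \<omega> \<bullet> b)) * cpt_cis (freq a \<omega>) z \<partial>gaussM) \<partial>\<nu>)"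
    unfolding e[symmetric] by (rule integral_complex_of_real[symmetric])
  also have "\<dots> = (\<integral>\<omega>. (\<integral>z. cis (- (freq a \<omega> \<bullet> b)) * cpt_cis (freq a \<omega>) z \<partial>\<nu>) \<partial>gaussM)"
  proof (rule P.Fubini_integral, rule P.integrable_const_bound[where B = 1])
    show "AE x in gaussM \<Otimes>\<^sub>M \<nu>. norm (case x of (\<omega>, z) \<Rightarrow> cis (- (freq a \<omega> \<bullet> b)) * cpt_cis (freq a \<omega>) z) \<le> 1"
      using norm_cpt_cis by (intro AE_I2) (auto simp: norm_mult)
  qed (rule m)
  also have "\<dots> = (\<integral>\<omega>. cis (- (freq a \<omega> \<bullet> b)) * charfun_cpt \<nu> (freq a \<omega>) \<partial>gaussM)"
    by (simp add: charfun_cpt_cis)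
  finally show ?thesis .
qed

text \<open>The centres \<open>b i\<close> enter only through these factors of modulus one.\<close>

definition phase :: "(nat \<Rightarrow> real) \<Rightarrow> (nat \<Rightarrow> real^'d::finite) \<Rightarrow> nat \<Rightarrow> (nat \<Rightarrow> 'd \<Rightarrow> real) \<Rightarrow> complex" where
  "phase a b l \<Omega> = (\<Prod>i\<in>{1..l}. cis (- (freq (a i) (\<Omega> i) \<bullet> b i)))"

abbreviation gaussMM :: "nat \<Rightarrow> (nat \<Rightarrow> 'd::finite \<Rightarrow> real) measure" where
  "gaussMM l \<equiv> PiM {1..l} (\<lambda>_. gaussM)"

lemma prob_space_gaussMM: "prob_space (gaussMM l)"
  by (intro prob_space_PiM prob_space_gaussM)

lemma freq_component_measurable:
  "i \<in> {1..l} \<Longrightarrow> (\<lambda>\<Omega>. freq (a i) (\<Omega> i)) \<in> borel_measurable (gaussMM l :: (nat \<Rightarrow> 'd::finite \<Rightarrow> real) measure)"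
  by (erule measurable_compose[OF measurable_component_singleton]) (rule freq_measurable)

lemma phase_measurable: "phase a b l \<in> borel_measurable (gaussMM l)"
  unfolding phase_def
  by (intro borel_measurable_prod measurable_compose[OF _ cis_measurable] borel_measurable_uminus borel_measurable_inner
     borel_measurable_const freq_component_measurable)

lemma norm_phase: "norm (phase a b l \<Omega>) = 1"
  by (simp add: phase_def prod_norm[symmetric])

lemma M1_kernel: "\<nu> \<in> M1 \<Longrightarrow> (\<lambda>_. \<nu>) \<in> measurable M (subprob_algebra borel_cpt)"
  by (intro measurable_const) (simp add: space_subprob_algebra M1_D(1) prob_space_imp_subprob_space[OF M1_D(3)])

lemma norm_prod_charfun: "\<nu> \<in> M1 \<Longrightarrow> norm (\<Prod>i\<in>I. charfun_cpt \<nu> (k i)) \<le> 1"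
  unfolding prod_norm[symmetric] using norm_charfun by (intro prod_le_1) auto

lemma prod_integral_gaussian:
  fixes \<nu> :: "'d::finite cpt measure"
  assumes a: "\<And>i. i \<in> {1..l} \<Longrightarrow> a i > 0" and \<nu>: "\<nu> \<in> M1"
  shows "complex_of_real (\<Prod>i\<in>{1..l}. \<integral>z. gaussian (a i) (b i) z \<partial>\<nu>)
    = (\<integral>\<Omega>. phase a b l \<Omega> * (\<Prod>i\<in>{1..l}. charfun_cpt \<nu> (freq (a i) (\<Omega> i))) \<partial>gaussMM l)"
proof -
  interpret product_sigma_finite "\<lambda>_::nat. gaussM :: ('d \<Rightarrow> real) measure"
    unfolding product_sigma_finite_def using prob_space_gaussM prob_space_imp_sigma_finite by blast
  interpret G: prob_space "gaussM :: ('d \<Rightarrow> real) measure" by (rule prob_space_gaussM)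
  have "complex_of_real (\<Prod>i\<in>{1..l}. \<integral>z. gaussian (a i) (b i) z \<partial>\<nu>)
     = (\<Prod>i\<in>{1..l}. \<integral>\<omega>. cis (- (freq (a i) \<omega> \<bullet> b i)) * charfun_cpt \<nu> (freq (a i) \<omega>) \<partial>gaussM)"
    unfolding of_real_prod using a by (intro prod.cong refl integral_gaussian \<nu>)
  also have "\<dots> = (\<integral>\<Omega>. (\<Prod>i\<in>{1..l}. cis (- (freq (a i) (\<Omega> i) \<bullet> b i)) * charfun_cpt \<nu> (freq (a i) (\<Omega> i))) \<partial>gaussMM l)"
  proof (rule product_integral_prod[symmetric])
    fix i
    have [measurable]: "(\<lambda>\<omega>. charfun_cpt \<nu> (freq (a i) \<omega>)) \<in> borel_measurable gaussM"
      by (rule charfun_measurable[OF M1_kernel[OF \<nu>]]) (use \<nu> in auto)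
    show "integrable gaussM (\<lambda>\<omega>. cis (- (freq (a i) \<omega> \<bullet> b i)) * charfun_cpt \<nu> (freq (a i) \<omega>))"
    proof (rule G.integrable_const_bound[where B = 1])
      show "AE \<omega> in gaussM. norm (cis (- (freq (a i) \<omega> \<bullet> b i)) * charfun_cpt \<nu> (freq (a i) \<omega>)) \<le> 1"
        using norm_charfun[OF \<nu>] by (intro AE_I2) (simp add: norm_mult)
    qed measurable
  qed simp
  also have "\<dots> = (\<integral>\<Omega>. phase a b l \<Omega> * (\<Prod>i\<in>{1..l}. charfun_cpt \<nu> (freq (a i) (\<Omega> i))) \<partial>gaussMM l)"
    by (simp add: phase_def prod.distrib)
  finally show ?thesis .
qed

section \<open>Empirical measures and convergence of Gaussian moments\<close>

definition tree_prob :: "nat \<Rightarrow> nat list set \<times> (nat list \<Rightarrow> int^'d::finite) \<Rightarrow> real" where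
  "tree_prob n = (\<lambda>(T, \<phi>). P_tree_emb T \<phi> / (\<Sum>(T',\<phi>')\<in>(pairs n :: (nat list set \<times> (nat list \<Rightarrow> int^'d)) set). P_tree_emb T' \<phi>'))"

lemma int_mu_n_eq:
  "int_mu_n n F = (\<Sum>x\<in>(pairs n :: (nat list set \<times> (nat list \<Rightarrow> int^'d::finite)) set). tree_prob n x * F (emp_measure (fst x) (snd x)))"
  unfolding int_mu_n_def tree_prob_def by (simp add: split_def)

lemma tree_prob_nonneg: "tree_prob n x \<ge> 0"
proof -
  have "P_tree_emb T \<phi> \<ge> 0" for T :: "nat list set" and \<phi> :: "nat list \<Rightarrow> int^'d"
    unfolding P_tree_emb_def P_tree_def by (intro mult_nonneg_nonneg prod_nonneg zero_le_power) auto
  then show ?thesis unfolding tree_prob_def split_def by (intro divide_nonneg_nonneg sum_nonneg) auto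
qed

lemma tree_prob_sum:
  assumes "n > 0"
  shows "(\<Sum>x\<in>(pairs n :: (nat list set \<times> (nat list \<Rightarrow> int^'d::finite)) set). tree_prob n x) = 1"
proof -
  have Z: "(\<Sum>(T',\<phi>')\<in>(pairs n :: (nat list set \<times> (nat list \<Rightarrow> int^'d)) set). P_tree_emb T' \<phi>') = tree_mass TYPE('d) n"
    unfolding sum_pairs tree_mass_def by (simp add: tree_weight_eq)
  have "(\<Sum>x\<in>(pairs n :: (nat list set \<times> (nat list \<Rightarrow> int^'d)) set). tree_prob n x) = tree_mass TYPE('d) n / tree_mass TYPE('d) n"
    unfolding tree_prob_def Z by (simp add: split_def sum_divide_distrib[symmetric]) (simp add: Z[symmetric] split_def)
  then show ?thesis using tree_mass_pos[OF assms, where 'd = 'd] by simp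
qed

text \<open>As the image of the uniform measure on the vertices, it is visibly a probability
  measure, and its integrals are averages over vertices.\<close>

lemma emp_measure_distr:
  fixes \<phi> :: "nat list \<Rightarrow> int^'d::finite"
  assumes "finite T" "T \<noteq> {}"
  shows "emp_measure T \<phi> = distr (uniform_count_measure T) borel_cpt (\<lambda>w. Some (rescale (card T) (\<phi> w)))"
proof -
  have s: "sigma_sets UNIV (sets (borel_cpt :: 'd cpt measure)) = sets borel_cpt"
    using sets.sigma_sets_eq[of "borel_cpt :: 'd cpt measure"] by (simp add: space_borel_of)
  show ?thesis
    unfolding emp_measure_def distr_def
  proof (simp add: space_borel_of, rule measure_of_eq)
    fix A :: "'d cpt set"
    have e: "(\<lambda>w. Some (rescale (card T) (\<phi> w))) -` A \<inter> T = {w \<in> T. Some (rescale (card T) (\<phi> w)) \<in> A}" by auto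
    show "ennreal (real (card {w \<in> T. Some (rescale (card T) (\<phi> w)) \<in> A}) / real (card T)) =
       emeasure (uniform_count_measure T) ((\<lambda>w. Some (rescale (card T) (\<phi> w))) -` A \<inter> space (uniform_count_measure T))"
      unfolding space_uniform_count_measure e using assms by (subst emeasure_uniform_count_measure) auto
  qed simp
qed

lemma emp_measure_facts:
  fixes x :: "nat list set \<times> (nat list \<Rightarrow> int^'d::finite)"
  assumes x: "x \<in> pairs n" and n: "n > 0"
  shows "emp_measure (fst x) (snd x) \<in> M1"
    and "charfun_cpt (emp_measure (fst x) (snd x)) k = (\<Sum>w\<in>fst x. cis (k \<bullet> rescale n (snd x w))) / of_nat n"
proof -
  obtain T \<phi> where xe: "x = (T, \<phi>)" by (cases x)
  have T: "finite T" "card T = n" using x by (auto simp: xe pairs_def plane_tree_def)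
  then have T0: "T \<noteq> {}" using n by auto
  have mb: "f \<in> measurable (uniform_count_measure T) N" if "\<And>w. f w \<in> space N" for f :: "nat list \<Rightarrow> 'z" and N
    using that by (auto simp: measurable_def space_uniform_count_measure sets_uniform_count_measure)
  have m: "(\<lambda>w. Some (rescale (card T) (\<phi> w))) \<in> measurable (uniform_count_measure T) borel_cpt"
    by (rule mb) (simp add: space_borel_of)
  note d = emp_measure_distr[OF T(1) T0, of \<phi>]
  show "emp_measure (fst x) (snd x) \<in> M1"
    unfolding M1_def xe fst_conv snd_conv d
    using prob_space.prob_space_distr[OF prob_space_uniform_count_measure[OF T(1) T0] m] by simp
  have em: "cpt_cis k \<in> borel_measurable borel_cpt" unfolding cpt_cis_def by measurable
  have "charfun_cpt (emp_measure T \<phi>) k = (\<integral>w. cpt_cis k (Some (rescale n (\<phi> w))) \<partial>uniform_count_measure T)"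
    unfolding charfun_cpt_cis d using integral_distr[OF m em] by (simp add: T)
  also have "\<dots> = (\<Sum>w\<in>T. cis (k \<bullet> rescale n (\<phi> w))) / of_nat n"
  proof -
    have "(\<integral>w. cpt_cis k (Some (rescale n (\<phi> w))) \<partial>uniform_count_measure T) = (\<Sum>w\<in>T. (1 / real n) *\<^sub>R cpt_cis k (Some (rescale n (\<phi> w))))"
      unfolding uniform_count_measure_def using T by (subst lebesgue_integral_point_measure_finite) auto
    then show ?thesis by (simp add: cpt_cis_def finite_indicator_def finite_value_def scaleR_conv_of_real sum_divide_distrib)
  qed
  finally show "charfun_cpt (emp_measure (fst x) (snd x)) k = (\<Sum>w\<in>fst x. cis (k \<bullet> rescale n (snd x w))) / of_nat n"
    by (simp add: xe)
qed


lemma tree_moment_convergence: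
  fixes Q :: "'d::finite cpt measure measure" and k :: "nat \<Rightarrow> real^'d"
  assumes Q: "is_ISE Q" and l: "l \<ge> 1"
  shows "(\<lambda>n. \<Sum>x\<in>pairs n. of_real (tree_prob n x) * (\<Prod>i\<in>{1..l}. charfun_cpt (emp_measure (fst x) (snd x)) (k i)))
     \<longlonglongrightarrow> (\<integral>\<nu>. (\<Prod>i\<in>{1..l}. charfun_cpt \<nu> (k i)) \<partial>Q)"
proof -
  have "(\<integral>\<nu>. (\<Prod>i\<in>{1..l}. charfun_cpt \<nu> (k i)) \<partial>Q) = of_real (\<Sum>H\<in>shapes l. Ahat H k)"
    using Q l unfolding is_ISE_def by blast
  moreover have "(\<lambda>n. \<Sum>x\<in>pairs n. of_real (tree_prob n x) * (\<Prod>i\<in>{1..l}. charfun_cpt (emp_measure (fst x) (snd x)) (k i)))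
     \<longlonglongrightarrow> of_real (\<Sum>H\<in>shapes l. Ahat H k)"
  proof (rule Lim_transform_eventually[OF moment_limit[OF l]])
    show "\<forall>\<^sub>F n in sequentially. (\<Sum>(T,\<phi>)\<in>(pairs n :: (nat list set \<times> (nat list \<Rightarrow> int^'d)) set).
      complex_of_real (P_tree_emb T \<phi> / (\<Sum>(T',\<phi>')\<in>(pairs n :: (nat list set \<times> (nat list \<Rightarrow> int^'d)) set). P_tree_emb T' \<phi>'))
      * (\<Prod>i\<in>{1..l}. (\<Sum>w\<in>T. cis (k i \<bullet> rescale n (\<phi> w))) / of_nat n))
      = (\<Sum>x\<in>pairs n. of_real (tree_prob n x) * (\<Prod>i\<in>{1..l}. charfun_cpt (emp_measure (fst x) (snd x)) (k i)))"
      using eventually_gt_at_top[of 0]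
    proof eventually_elim
      case (elim n)
      show ?case
        by (intro sum.cong refl) (simp add: emp_measure_facts(2)[OF _ elim] tree_prob_def split_def)
    qed
  qed
  ultimately show ?thesis by simp
qed

text \<open>For each fixed tuple of frequencies the moments converge by
  \<open>tree_moment_convergence\<close>. All of them have modulus at most \<open>1\<close>, so
  dominated convergence applies under the normal law of the frequencies, and Fubini moves that
  average inside both expectations.\<close>

lemma gaussian_moment_convergence:
  fixes Q :: "'d::finite cpt measure measure" and a :: "nat \<Rightarrow> real" and b :: "nat \<Rightarrow> real^'d"
  assumes Q: "is_ISE Q" and l: "l \<ge> 1" and a: "\<And>i. i \<in> {1..l} \<Longrightarrow> a i > 0"
  shows "(\<lambda>n. int_mu_n n (\<lambda>\<nu>. \<Prod>i\<in>{1..l}. \<integral>z. gaussian (a i) (b i) z \<partial>\<nu>))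
     \<longlonglongrightarrow> (\<integral>\<nu>. (\<Prod>i\<in>{1..l}. \<integral>z. gaussian (a i) (b i) z \<partial>\<nu>) \<partial>Q)"
proof -
  have sQ: "sets Q = sets (borel_of weak_top)" and "prob_space Q" using Q by (auto simp: is_ISE_def)
  interpret Q: prob_space Q by fact
  interpret G: prob_space "gaussMM l :: (nat \<Rightarrow> 'd \<Rightarrow> real) measure" by (rule prob_space_gaussMM)
  interpret P: pair_prob_space Q "gaussMM l :: (nat \<Rightarrow> 'd \<Rightarrow> real) measure" ..
  have sp: "space Q = M1" by (rule space_ISE[OF sQ])
  let ?c = "phase a b l" and ?k = "\<lambda>\<Omega> i. freq (a i) (\<Omega> i :: 'd \<Rightarrow> real)"
  let ?X = "\<lambda>\<nu> \<Omega>. ?c \<Omega> * (\<Prod>i\<in>{1..l}. charfun_cpt \<nu> (?k \<Omega> i))"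
  have Xb: "norm (?X \<nu> \<Omega>) \<le> 1" if "\<nu> \<in> M1" for \<nu> \<Omega>
    using norm_prod_charfun[OF that] by (simp add: norm_mult norm_phase)
  have Xm: "?X \<nu> \<in> borel_measurable (gaussMM l)" if "\<nu> \<in> M1" for \<nu>
  proof -
    have "(\<lambda>\<Omega>. charfun_cpt \<nu> (?k \<Omega> i)) \<in> borel_measurable (gaussMM l)" if "i \<in> {1..l}" for i
      by (rule charfun_measurable[OF M1_kernel[OF \<open>\<nu> \<in> M1\<close>] \<open>\<nu> \<in> M1\<close> freq_component_measurable[OF that]])
    then show ?thesis by (intro borel_measurable_times phase_measurable borel_measurable_prod)
  qed
  have Xi: "integrable (gaussMM l) (?X \<nu>)" if "\<nu> \<in> M1" for \<nu>
    using Xb[OF that] Xm[OF that] by (intro G.integrable_const_bound[where B = 1]) auto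
  have XQm: "(\<lambda>(\<nu>, \<Omega>). ?X \<nu> \<Omega>) \<in> borel_measurable (Q \<Otimes>\<^sub>M gaussMM l)"
  proof -
    have "(\<lambda>p. charfun_cpt (fst p) (?k (snd p) i)) \<in> borel_measurable (Q \<Otimes>\<^sub>M gaussMM l)" if "i \<in> {1..l}" for i
    proof (rule charfun_measurable)
      show "fst \<in> measurable (Q \<Otimes>\<^sub>M gaussMM l) (subprob_algebra borel_cpt)"
        using measurable_compose[OF measurable_fst ISE_kernel[OF sQ]] .
      show "fst p \<in> M1" if "p \<in> space (Q \<Otimes>\<^sub>M gaussMM l)" for p
        using that by (auto simp: space_pair_measure sp)
      show "(\<lambda>p. ?k (snd p) i) \<in> borel_measurable (Q \<Otimes>\<^sub>M gaussMM l)"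
        using measurable_compose[OF measurable_snd freq_component_measurable[OF that]] .
    qed
    moreover have "(\<lambda>p. ?c (snd p)) \<in> borel_measurable (Q \<Otimes>\<^sub>M gaussMM l)"
      using measurable_compose[OF measurable_snd phase_measurable] .
    ultimately show ?thesis unfolding split_def by (intro borel_measurable_times borel_measurable_prod)
  qed
  have XQi: "integrable (Q \<Otimes>\<^sub>M gaussMM l) (\<lambda>(\<nu>, \<Omega>). ?X \<nu> \<Omega>)"
    by (rule P.integrable_const_bound[where B = 1, OF AE_I2 XQm])
      (use Xb in \<open>auto simp: space_pair_measure sp\<close>)
  have rhs: "complex_of_real (\<integral>\<nu>. (\<Prod>i\<in>{1..l}. \<integral>z. gaussian (a i) (b i) z \<partial>\<nu>) \<partial>Q)
     = (\<integral>\<Omega>. (\<integral>\<nu>. ?X \<nu> \<Omega> \<partial>Q) \<partial>gaussMM l)"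
  proof -
    have "complex_of_real (\<integral>\<nu>. (\<Prod>i\<in>{1..l}. \<integral>z. gaussian (a i) (b i) z \<partial>\<nu>) \<partial>Q)
      = (\<integral>\<nu>. complex_of_real (\<Prod>i\<in>{1..l}. \<integral>z. gaussian (a i) (b i) z \<partial>\<nu>) \<partial>Q)"
      by (rule integral_complex_of_real[symmetric])
    also have "\<dots> = (\<integral>\<nu>. (\<integral>\<Omega>. ?X \<nu> \<Omega> \<partial>gaussMM l) \<partial>Q)"
      by (rule Bochner_Integration.integral_cong[OF refl], rule prod_integral_gaussian) (use a sp in auto)
    also have "\<dots> = (\<integral>\<Omega>. (\<integral>\<nu>. ?X \<nu> \<Omega> \<partial>Q) \<partial>gaussMM l)"
      by (rule P.Fubini_integral[OF XQi, symmetric])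
    finally show ?thesis .
  qed
  let ?e = "\<lambda>x. emp_measure (fst x) (snd x) :: 'd cpt measure"
  let ?E = "\<lambda>n \<Omega>. \<Sum>x\<in>pairs n. of_real (tree_prob n x) * ?X (?e x) \<Omega>"
  have lhs: "complex_of_real (int_mu_n n (\<lambda>\<nu>. \<Prod>i\<in>{1..l}. \<integral>z. gaussian (a i) (b i) z \<partial>\<nu>))
     = (\<integral>\<Omega>. ?E n \<Omega> \<partial>gaussMM l)" if n: "n > 0" for n
  proof -
    have "complex_of_real (int_mu_n n (\<lambda>\<nu>. \<Prod>i\<in>{1..l}. \<integral>z. gaussian (a i) (b i) z \<partial>\<nu>))
      = (\<Sum>x\<in>pairs n. of_real (tree_prob n x) * of_real (\<Prod>i\<in>{1..l}. \<integral>z. gaussian (a i) (b i) z \<partial>?e x))"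
      unfolding int_mu_n_eq by simp
    also have "\<dots> = (\<Sum>x\<in>pairs n. of_real (tree_prob n x) * (\<integral>\<Omega>. ?X (?e x) \<Omega> \<partial>gaussMM l))"
      by (intro sum.cong refl arg_cong2[where f = "(*)"] prod_integral_gaussian a emp_measure_facts(1)[OF _ n])
    also have "\<dots> = (\<integral>\<Omega>. ?E n \<Omega> \<partial>gaussMM l)"
      using Xi[OF emp_measure_facts(1)[OF _ n]]
      by (subst Bochner_Integration.integral_sum) (auto intro!: integrable_mult_right)
    finally show ?thesis .
  qed
  \<comment> \<open>The shift to \<open>Suc n\<close> excludes \<open>n = 0\<close>, where there are
    no trees; domination and measurability are then available for every index.\<close>
  have "(\<lambda>n. \<integral>\<Omega>. ?E (Suc n) \<Omega> \<partial>gaussMM l) \<longlonglongrightarrow> (\<integral>\<Omega>. (\<integral>\<nu>. ?X \<nu> \<Omega> \<partial>Q) \<partial>gaussMM l)"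
  proof (rule integral_dominated_convergence[where w = "\<lambda>_. 1"])
    show "(\<lambda>\<Omega>. \<integral>\<nu>. ?X \<nu> \<Omega> \<partial>Q) \<in> borel_measurable (gaussMM l)"
      using P.integrable_snd[OF XQi] by (rule borel_measurable_integrable)
    show "?E (Suc n) \<in> borel_measurable (gaussMM l)" for n
      by (intro borel_measurable_sum borel_measurable_times[OF borel_measurable_const] Xm emp_measure_facts(1)[where n = "Suc n"]) auto
    show "AE \<Omega> in gaussMM l. (\<lambda>n. ?E (Suc n) \<Omega>) \<longlonglongrightarrow> (\<integral>\<nu>. ?X \<nu> \<Omega> \<partial>Q)"
    proof (rule AE_I2)
      fix \<Omega>
      have "(\<lambda>n. ?c \<Omega> * (\<Sum>x\<in>pairs n. of_real (tree_prob n x) * (\<Prod>i\<in>{1..l}. charfun_cpt (?e x) (?k \<Omega> i))))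
         \<longlonglongrightarrow> ?c \<Omega> * (\<integral>\<nu>. (\<Prod>i\<in>{1..l}. charfun_cpt \<nu> (?k \<Omega> i)) \<partial>Q)"
        by (intro tendsto_mult tendsto_const tree_moment_convergence[OF Q l])
      then have "(\<lambda>n. ?E n \<Omega>) \<longlonglongrightarrow> (\<integral>\<nu>. ?X \<nu> \<Omega> \<partial>Q)"
        by (simp add: sum_distrib_left mult.left_commute)
      then show "(\<lambda>n. ?E (Suc n) \<Omega>) \<longlonglongrightarrow> (\<integral>\<nu>. ?X \<nu> \<Omega> \<partial>Q)" by (rule LIMSEQ_Suc)
    qed
    show "AE \<Omega> in gaussMM l. norm (?E (Suc n) \<Omega>) \<le> 1" for n
    proof (rule AE_I2)
      fix \<Omega>
      have "norm (?E (Suc n) \<Omega>) \<le> (\<Sum>x\<in>(pairs (Suc n) :: (nat list set \<times> (nat list \<Rightarrow> int^'d)) set). tree_prob (Suc n) x * 1)"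
      proof (rule sum_norm_le)
        fix x :: "nat list set \<times> (nat list \<Rightarrow> int^'d)" assume x: "x \<in> pairs (Suc n)"
        have "norm (?X (?e x) \<Omega>) \<le> 1" by (rule Xb[OF emp_measure_facts(1)[OF x]]) simp
        then show "norm (of_real (tree_prob (Suc n) x) * ?X (?e x) \<Omega>) \<le> tree_prob (Suc n) x * 1"
          unfolding norm_mult[of "of_real _"] using tree_prob_nonneg[of "Suc n" x] by (intro mult_mono) auto
      qed
      also have "\<dots> = 1" using tree_prob_sum[of "Suc n", where 'd = 'd] by simp
      finally show "norm (?E (Suc n) \<Omega>) \<le> 1" .
    qed
    show "integrable (gaussMM l :: (nat \<Rightarrow> 'd \<Rightarrow> real) measure) (\<lambda>_. 1 :: real)" by (rule G.integrable_const)
  qed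
  then have "(\<lambda>n. complex_of_real (int_mu_n (Suc n) (\<lambda>\<nu>. \<Prod>i\<in>{1..l}. \<integral>z. gaussian (a i) (b i) z \<partial>\<nu>)))
     \<longlonglongrightarrow> complex_of_real (\<integral>\<nu>. (\<Prod>i\<in>{1..l}. \<integral>z. gaussian (a i) (b i) z \<partial>\<nu>) \<partial>Q)"
    by (simp only: lhs[OF zero_less_Suc] rhs)
  then have "(\<lambda>n. int_mu_n (Suc n) (\<lambda>\<nu>. \<Prod>i\<in>{1..l}. \<integral>z. gaussian (a i) (b i) z \<partial>\<nu>))
     \<longlonglongrightarrow> (\<integral>\<nu>. (\<Prod>i\<in>{1..l}. \<integral>z. gaussian (a i) (b i) z \<partial>\<nu>) \<partial>Q)"
    by (simp only: tendsto_of_real_iff)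
  then show ?thesis by (rule LIMSEQ_imp_Suc)
qed

text \<open>Polynomials in the integrals of Gaussians. A product of integrals is in general not an
  integral of a product, so monomials are kept as lists: concatenation multiplies them, and the
  empty list gives the constants.\<close>

inductive_set gaussian_poly :: "('d::finite cpt measure \<Rightarrow> real) set" where
  mono: "(\<And>x. x \<in> set xs \<Longrightarrow> fst x > 0) \<Longrightarrow>
    (\<lambda>\<nu>. c * prod_list (map (\<lambda>x. \<integral>z. gaussian (fst x) (snd x) z \<partial>\<nu>) xs)) \<in> gaussian_poly"
| add: "f \<in> gaussian_poly \<Longrightarrow> g \<in> gaussian_poly \<Longrightarrow> (\<lambda>\<nu>. f \<nu> + g \<nu>) \<in> gaussian_poly"

lemma gaussian_poly_mult: "f \<in> gaussian_poly \<Longrightarrow> g \<in> gaussian_poly \<Longrightarrow> (\<lambda>\<nu>. f \<nu> * g \<nu>) \<in> gaussian_poly"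
proof (induction arbitrary: g rule: gaussian_poly.induct)
  case (mono xs c)
  note xs = mono.hyps
  from mono.prems show ?case
  proof (induction rule: gaussian_poly.induct)
    case (mono ys c')
    have "(\<lambda>\<nu>. (c * c') * prod_list (map (\<lambda>x. \<integral>z. gaussian (fst x) (snd x) z \<partial>\<nu>) (xs @ ys))) \<in> gaussian_poly"
      by (rule gaussian_poly.mono) (use xs mono in auto)
    then show ?case by (simp add: mult_ac)
  next
    case (add f g)
    then show ?case using gaussian_poly.add[OF add.IH] by (simp add: ring_distribs)
  qed
next
  case (add f1 f2)
  then show ?case using gaussian_poly.add[OF add.IH(1)[OF add.prems] add.IH(2)[OF add.prems]] by (simp add: ring_distribs)
qed

lemma gaussian_poly_continuous: "f \<in> gaussian_poly \<Longrightarrow> continuous_map weak_top euclideanreal f"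
proof (induction rule: gaussian_poly.induct)
  case (mono xs c)
  then have "continuous_map weak_top euclideanreal (\<lambda>\<nu>. prod_list (map (\<lambda>x. \<integral>z. gaussian (fst x) (snd x) z \<partial>\<nu>) xs))"
  proof (induction xs)
    case (Cons x xs)
    have "continuous_map weak_top euclideanreal (\<lambda>\<nu>. \<integral>z. gaussian (fst x) (snd x) z \<partial>\<nu>)"
      using Cons.prems by (intro weak_top_integral gaussian_continuous) auto
    then show ?case using Cons by (auto intro: continuous_map_real_mult)
  qed simp
  then show ?case by (intro continuous_map_real_mult) auto
next
  case (add f g)
  then show ?case by (intro continuous_map_add)
qed

lemma continuous_weak_top_bounded:
  assumes "continuous_map weak_top euclideanreal F"
  shows "\<exists>B. \<forall>\<nu>\<in>(M1 :: 'd::finite cpt measure set). \<bar>F \<nu>\<bar> \<le> B"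
proof -
  have "compactin euclideanreal (F ` M1)"
    using image_compactin[OF _ assms, of M1] compact_space_weak_top[where 'd = 'd]
    by (simp add: compact_space_def topspace_weak_top)
  then have "bounded (F ` M1)" using compact_imp_bounded by simp
  then show ?thesis unfolding bounded_iff by auto
qed

lemma continuous_weak_top_integrable:
  assumes "prob_space Q" "sets (Q :: 'd::finite cpt measure measure) = sets (borel_of weak_top)"
    and F: "continuous_map weak_top euclideanreal F"
  shows "integrable Q F"
proof -
  interpret prob_space Q by fact
  obtain B where "\<forall>\<nu>\<in>M1. \<bar>F \<nu>\<bar> \<le> B" using continuous_weak_top_bounded[OF F] by blast
  then show ?thesis
    using weak_top_measurable[OF assms(2) F] space_ISE[OF assms(2)] by (intro integrable_const_bound[where B = B]) auto
qed

lemma gaussian_poly_convergence: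
  fixes Q :: "'d::finite cpt measure measure"
  assumes Q: "is_ISE Q"
  shows "f \<in> gaussian_poly \<Longrightarrow> (\<lambda>n. int_mu_n n f) \<longlonglongrightarrow> (\<integral>\<nu>. f \<nu> \<partial>Q)"
proof (induction rule: gaussian_poly.induct)
  case (mono xs c)
  have pQ: "prob_space Q" using Q by (simp add: is_ISE_def)
  interpret prob_space Q by fact
  let ?l = "length xs"
  have e: "prod_list (map (\<lambda>x. \<integral>z. gaussian (fst x) (snd x) z \<partial>\<nu>) xs)
     = (\<Prod>i\<in>{1..?l}. \<integral>z. gaussian (fst (xs ! (i - 1))) (snd (xs ! (i - 1))) z \<partial>\<nu>)" for \<nu> :: "'d cpt measure"
    unfolding prod.list_conv_set_nth length_map
    by (rule prod.reindex_bij_witness[where i = "\<lambda>i. i - 1" and j = Suc]) auto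
  have lin: "int_mu_n n (\<lambda>\<nu>. c * h \<nu>) = c * int_mu_n n h" for n and h :: "'d cpt measure \<Rightarrow> real"
    unfolding int_mu_n_eq by (simp add: sum_distrib_left mult_ac)
  show ?case
  proof (cases "?l \<ge> 1")
    case True
    have "(\<lambda>n. c * int_mu_n n (\<lambda>\<nu> :: 'd cpt measure. \<Prod>i\<in>{1..?l}. \<integral>z. gaussian (fst (xs ! (i - 1))) (snd (xs ! (i - 1))) z \<partial>\<nu>))
      \<longlonglongrightarrow> c * (\<integral>\<nu>. (\<Prod>i\<in>{1..?l}. \<integral>z. gaussian (fst (xs ! (i - 1))) (snd (xs ! (i - 1))) z \<partial>\<nu>) \<partial>Q)"
    proof (intro tendsto_mult tendsto_const gaussian_moment_convergence[OF Q True])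
      show "0 < fst (xs ! (i - 1))" if "i \<in> {1..?l}" for i
        using that by (intro mono nth_mem) auto
    qed
    then show ?thesis unfolding e lin by simp
  next
    case False
    then have xs: "xs = []" by (cases xs) auto
    have "\<forall>\<^sub>F n in sequentially. int_mu_n n (\<lambda>_ :: 'd cpt measure. c) = c"
      using eventually_gt_at_top[of 0]
    proof eventually_elim
      case (elim n)
      then show ?case using tree_prob_sum[OF elim, where 'd = 'd] by (simp add: int_mu_n_eq sum_distrib_right[symmetric])
    qed
    then show ?thesis by (simp add: xs prob_space tendsto_eventually)
  qed
next
  case (add f g)
  have "integrable Q f" "integrable Q g"
    using Q add.hyps gaussian_poly_continuous by (auto simp: is_ISE_def intro!: continuous_weak_top_integrable)
  moreover have "int_mu_n n (\<lambda>\<nu>. f \<nu> + g \<nu>) = int_mu_n n f + int_mu_n n g" for n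
    unfolding int_mu_n_eq by (simp add: ring_distribs sum.distrib)
  ultimately show ?case using tendsto_add[OF add.IH] by simp
qed

text \<open>If all Gaussian integrals under two measures agree, so do the integrals of the whole
  algebra \<open>gaussian_span\<close>. This algebra is uniformly dense in the continuous functions
  on the compactification, and those determine the measure.\<close>

lemma gaussian_poly_separates:
  assumes \<nu>: "\<nu> \<in> (M1 :: 'd::finite cpt measure set)" "\<nu>' \<in> M1" "\<nu> \<noteq> \<nu>'"
  shows "\<exists>g\<in>gaussian_poly. g \<nu> \<noteq> g \<nu>'"
proof (rule ccontr)
  assume "\<not> ?thesis"
  then have eq: "g \<nu> = g \<nu>'" if "g \<in> gaussian_poly" for g using that by blast
  interpret \<nu>: prob_space \<nu> by (rule M1_D(3)[OF \<nu>(1)])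
  interpret \<nu>': prob_space \<nu>' by (rule M1_D(3)[OF \<nu>(2)])
  have cint: "integrable \<mu> f" if \<mu>: "\<mu> \<in> M1" and f: "continuous_map cpt_top euclideanreal f" for \<mu> and f :: "'d cpt \<Rightarrow> real"
  proof -
    interpret prob_space \<mu> by (rule M1_D(3)[OF \<mu>])
    have "compactin euclideanreal (f ` UNIV)"
      using image_compactin[OF _ f, of UNIV] compact_space_cpt_top[where 'd = 'd] by (simp add: compact_space_def)
    then have "bounded (range f)" using compact_imp_bounded by simp
    then obtain B where "\<And>z. \<bar>f z\<bar> \<le> B" unfolding bounded_iff by auto
    moreover have "f \<in> borel_measurable \<mu>" unfolding M1_measurable[OF \<mu>] by (rule borel_of_measurable[OF f])
    ultimately show ?thesis by (intro integrable_const_bound[where B = B]) auto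
  qed
  have gs: "(\<integral>z. g z \<partial>\<nu>) = (\<integral>z. g z \<partial>\<nu>')" if "g \<in> gaussian_span" for g
    using that
  proof (induction rule: gaussian_span.induct)
    case (const c)
    then show ?case using \<nu>.prob_space \<nu>'.prob_space by simp
  next
    case (gauss a c b)
    have "(\<lambda>\<nu>. 1 * prod_list (map (\<lambda>x. \<integral>z. gaussian (fst x) (snd x) z \<partial>\<nu>) [(a, b)])) \<in> gaussian_poly"
      using gauss by (intro gaussian_poly.mono) auto
    from eq[OF this] show ?case by simp
  next
    case (add f g)
    then show ?case using cint[OF \<nu>(1) gaussian_span_continuous] cint[OF \<nu>(2) gaussian_span_continuous] by simp
  qed
  have "\<nu> = \<nu>'"
  proof (rule M1_eqI[OF \<nu>(1,2)])
    fix f :: "'d cpt \<Rightarrow> real" assume f: "continuous_map cpt_top euclideanreal f"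
    have close: "\<bar>(\<integral>z. f z \<partial>\<nu>) - (\<integral>z. f z \<partial>\<nu>')\<bar> \<le> e" if e: "e > 0" for e
    proof -
      have "\<exists>g\<in>gaussian_span. \<forall>x\<in>topspace cpt_top. \<bar>f x - g x\<bar> < e / 2"
        by (rule stone_weierstrass_compact_space[OF compact_space_cpt_top _ gaussian_span.add gaussian_span_mult gaussian_span.const _ f])
          (use e gaussian_span_continuous gaussian_span_separates in auto)
      then obtain g where g: "g \<in> gaussian_span" "\<And>x. \<bar>f x - g x\<bar> < e / 2" by auto
      have b: "\<bar>(\<integral>z. f z \<partial>\<mu>) - (\<integral>z. g z \<partial>\<mu>)\<bar> \<le> e / 2" if \<mu>: "\<mu> \<in> M1" for \<mu>
      proof -
        interpret prob_space \<mu> by (rule M1_D(3)[OF \<mu>])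
        have i: "integrable \<mu> f" "integrable \<mu> g" using cint[OF \<mu>] f gaussian_span_continuous[OF g(1)] by auto
        have "\<bar>(\<integral>z. f z \<partial>\<mu>) - (\<integral>z. g z \<partial>\<mu>)\<bar> = \<bar>\<integral>z. f z - g z \<partial>\<mu>\<bar>" using i by simp
        also have "\<dots> \<le> (\<integral>z. \<bar>f z - g z\<bar> \<partial>\<mu>)" by (rule integral_abs_bound)
        also have "\<dots> \<le> (\<integral>z. e / 2 \<partial>\<mu>)" using i g(2) by (intro integral_mono) (auto intro: less_imp_le)
        finally show ?thesis by (simp add: prob_space)
      qed
      show ?thesis using b[OF \<nu>(1)] b[OF \<nu>(2)] gs[OF g(1)] by linarith
    qed
    have "\<bar>(\<integral>z. f z \<partial>\<nu>) - (\<integral>z. f z \<partial>\<nu>')\<bar> \<le> 0"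
    proof (rule field_le_epsilon)
      fix e :: real assume "0 < e"
      from close[OF this] show "\<bar>(\<integral>z. f z \<partial>\<nu>) - (\<integral>z. f z \<partial>\<nu>')\<bar> \<le> 0 + e" by (simp only: add_0)
    qed
    then show "(\<integral>z. f z \<partial>\<nu>) = (\<integral>z. f z \<partial>\<nu>')" by simp
  qed
  with \<nu>(3) show False by blast
qed

theorem theorem2p4:
  fixes Q :: "'d::finite cpt measure measure"
  assumes "is_ISE Q"
    and "continuous_map weak_top euclideanreal F"
  shows "(\<lambda>n. int_mu_n n F) \<longlonglongrightarrow> (\<integral>\<nu>. F \<nu> \<partial>Q)"
proof (rule LIMSEQ_I)
  fix e :: real assume e: "e > 0"
  have pQ: "prob_space Q" and sQ: "sets Q = sets (borel_of weak_top)" using assms(1) by (auto simp: is_ISE_def)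
  interpret prob_space Q by (rule pQ)
  have sp: "space Q = M1" by (rule space_ISE[OF sQ])
  have "(\<lambda>_. c) \<in> gaussian_poly" for c using gaussian_poly.mono[of "[]" c] by simp
  \<comment> \<open>Uniform approximation on \<open>M1\<close> costs at most \<open>e / 3\<close>
    under the law of the empirical measure and \<open>e / 3\<close> under \<open>Q\<close>, since
    both have total mass \<open>1\<close>; the last third is for the convergence of
    \<open>g\<close>.\<close>
  then have "\<exists>g\<in>gaussian_poly. \<forall>\<nu>\<in>topspace weak_top. \<bar>F \<nu> - g \<nu>\<bar> < e / 3"
    by (intro stone_weierstrass_compact_space[OF compact_space_weak_top gaussian_poly_continuous gaussian_poly.add gaussian_poly_mult _ _ assms(2)])
      (use e gaussian_poly_separates in \<open>auto simp: topspace_weak_top\<close>)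
  then obtain g where g: "g \<in> gaussian_poly" "\<And>\<nu>. \<nu> \<in> M1 \<Longrightarrow> \<bar>F \<nu> - g \<nu>\<bar> < e / 3" by (auto simp: topspace_weak_top)
  have iQ: "\<bar>(\<integral>\<nu>. F \<nu> \<partial>Q) - (\<integral>\<nu>. g \<nu> \<partial>Q)\<bar> \<le> e / 3"
  proof -
    have i: "integrable Q F" "integrable Q g"
      using continuous_weak_top_integrable[OF pQ sQ] assms(2) gaussian_poly_continuous[OF g(1)] by auto
    have "\<bar>(\<integral>\<nu>. F \<nu> \<partial>Q) - (\<integral>\<nu>. g \<nu> \<partial>Q)\<bar> = \<bar>\<integral>\<nu>. F \<nu> - g \<nu> \<partial>Q\<bar>" using i by simp
    also have "\<dots> \<le> (\<integral>\<nu>. \<bar>F \<nu> - g \<nu>\<bar> \<partial>Q)" by (rule integral_abs_bound)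
    also have "\<dots> \<le> (\<integral>\<nu>. e / 3 \<partial>Q)" using i g(2) sp by (intro integral_mono) (auto intro: less_imp_le)
    finally show ?thesis by (simp add: prob_space)
  qed
  have In: "\<bar>int_mu_n n F - int_mu_n n g\<bar> \<le> e / 3" if n: "n > 0" for n
  proof -
    let ?e = "\<lambda>x. emp_measure (fst x) (snd x) :: 'd cpt measure"
    have "int_mu_n n F - int_mu_n n g = (\<Sum>x\<in>pairs n. tree_prob n x * (F (?e x) - g (?e x)))"
      unfolding int_mu_n_eq by (simp add: sum_subtractf right_diff_distrib)
    also have "\<bar>\<dots>\<bar> \<le> (\<Sum>x\<in>pairs n. \<bar>tree_prob n x * (F (?e x) - g (?e x))\<bar>)" by (rule sum_abs)
    also have "\<dots> \<le> (\<Sum>x\<in>(pairs n :: (nat list set \<times> (nat list \<Rightarrow> int^'d)) set). tree_prob n x * (e / 3))"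
    proof (rule sum_mono)
      fix x :: "nat list set \<times> (nat list \<Rightarrow> int^'d)" assume x: "x \<in> pairs n"
      have "\<bar>tree_prob n x * (F (?e x) - g (?e x))\<bar> = tree_prob n x * \<bar>F (?e x) - g (?e x)\<bar>"
        using tree_prob_nonneg[of n x] by (simp only: abs_mult abs_of_nonneg)
      also have "\<dots> \<le> tree_prob n x * (e / 3)"
        using g(2)[OF emp_measure_facts(1)[OF x n]] by (intro mult_left_mono tree_prob_nonneg) simp
      finally show "\<bar>tree_prob n x * (F (?e x) - g (?e x))\<bar> \<le> tree_prob n x * (e / 3)" .
    qed
    also have "\<dots> = e / 3" using tree_prob_sum[OF n, where 'd = 'd] by (simp only: sum_distrib_right[symmetric] mult_1)
    finally show ?thesis .
  qed
  obtain N where N: "\<And>n. n \<ge> N \<Longrightarrow> norm (int_mu_n n g - (\<integral>\<nu>. g \<nu> \<partial>Q)) < e / 3"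
    using LIMSEQ_D[OF gaussian_poly_convergence[OF assms(1) g(1)], of "e / 3"] e by auto
  show "\<exists>N. \<forall>n\<ge>N. norm (int_mu_n n F - (\<integral>\<nu>. F \<nu> \<partial>Q)) < e"
  proof (intro exI allI impI)
    fix n assume "n \<ge> max N 1"
    then have "\<bar>int_mu_n n g - (\<integral>\<nu>. g \<nu> \<partial>Q)\<bar> < e / 3" "\<bar>int_mu_n n F - int_mu_n n g\<bar> \<le> e / 3" using N[of n] In[of n] by auto
    then show "norm (int_mu_n n F - (\<integral>\<nu>. F \<nu> \<partial>Q)) < e" unfolding real_norm_def using iQ by linarith
  qed
qed


end
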